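(* Let $m\ge2$, let $\Omega\subset\mathbb R^m$ be open, let $\lambda>0$, and let the real-valued function $\varphi\in C^2(\Omega)\cap C(\overline\Omega)$ satisfy $\Delta\varphi+\lambda\varphi=0$ in $\Omega$ and $\varphi=0$ on $\partial\Omega$; the case $\Omega=\mathbb R^m$ is allowed. Let $\ell\ge0$, let $C$ be a bounded connected component of $\{\varphi>\ell\}$, and choose $x_C\in C$ with $M_C:=\varphi(x_C)=\max_C\varphi$ and $\vartheta_C:=\ell/M_C$. For $0<\vartheta_C<1$, let $\beta_m(\vartheta_C)$ be determined by $$q_m(\beta_m(\vartheta_C))=\vartheta_C^{-1},\qquad0<\beta_m(\vartheta_C)<\tfrac12j_{\nu,1}^2 .$$ Then $$|C|\ge\omega_m\left(\frac{2\beta_m(\vartheta_C)}{\lambda}\right)^{m/2}.$$ The estimate is sharp (equality holds) for concentric superlevel components of the regular radial Helmholtz solution, equivalently for the first Dirichlet eigenfunction inside its first nodal ball. Moreover, $$\beta_m(\vartheta)=m(1-\vartheta)+O_m((1-\vartheta)^2)\quad\text{as }\vartheta\uparrow1,$$ while $\beta_m(\vartheta)\to j_{\nu,1}^2/2$ as $\vartheta\downarrow0$; thus the bound tends to the sharp Faber–Krahn bound at level zero.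
   Context: $\nu=(m-2)/2$ and $j_{\nu,1}$ is the first positive zero of the Bessel function $J_\nu$; $\omega_m$ is the volume of the unit ball in $\mathbb R^m$; $|\cdot|$ is Lebesgue measure. For $0\le\beta<\tfrac12j_{\nu,1}^2$, $q_m(\beta)=\mathbb E_0[e^{\beta\tau_{B(0,1)}}]$, the exponential moment of the exit time from the unit ball of Brownian motion (generator $\tfrac12\Delta$) started at the origin; explicitly $q_m(\beta)=\dfrac{(\sqrt{2\beta}/2)^\nu}{\Gamma(\nu+1)J_\nu(\sqrt{2\beta})}$ for $\beta>0$ and $q_m(0)=1$. The regular radial Helmholtz solution is the radial solution of $\Delta\varphi+\lambda\varphi=0$ on $\mathbb R^m$, smooth at $0$ with $\varphi(0)>0$, i.e. a positive multiple of $|x|^{-\nu}J_\nu(\sqrt\lambda|x|)$. *)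

theory Defs
  imports "HOL-Analysis.Analysis" "HOL-Library.Landau_Symbols"
begin

text \<open>Bessel function of the first kind, by its power series. Because of \<open>powr\<close>, it agrees with
  the usual function only for \<open>x > 0\<close>, and only such arguments are used.\<close>

definition Bessel_J :: "real \<Rightarrow> real \<Rightarrow> real" where
  "Bessel_J \<nu> x =
     (\<Sum>k. (-1) ^ k / (fact k * Gamma (real k + \<nu> + 1)) * (x / 2) powr (2 * real k + \<nu>))"

definition Bessel_J_zero1 :: "real \<Rightarrow> real" where
  "Bessel_J_zero1 \<nu> = Inf {x. 0 < x \<and> Bessel_J \<nu> x = 0}"

definition nu :: "nat \<Rightarrow> real" where
  "nu m = (real m - 2) / 2"

text \<open>Closed form of the exponential moment \<open>E\<^sub>0[exp (\<beta> \<tau>)]\<close>, where \<open>\<tau>\<close> is the exit time from the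
  unit ball of \<open>m\<close>-dimensional Brownian motion (generator \<open>\<Delta>/2\<close>) started at the origin. It is
  meaningful for \<open>0 \<le> \<beta>\<close> and \<open>\<beta>\<close> below half the square of the first zero.\<close>

definition q_moment :: "nat \<Rightarrow> real \<Rightarrow> real" where
  "q_moment m \<beta> =
     (if \<beta> = 0 then 1
      else (sqrt (2 * \<beta>) / 2) powr nu m / (Gamma (nu m + 1) * Bessel_J (nu m) (sqrt (2 * \<beta>))))"

definition is_level_beta :: "nat \<Rightarrow> real \<Rightarrow> real \<Rightarrow> bool" where
  "is_level_beta m \<theta> \<beta> \<longleftrightarrow>
     q_moment m \<beta> = inverse \<theta> \<and> 0 < \<beta> \<and> \<beta> < (Bessel_J_zero1 (nu m))\<^sup>2 / 2"

definition level_beta :: "nat \<Rightarrow> real \<Rightarrow> real" where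
  "level_beta m \<theta> = (THE \<beta>. is_level_beta m \<theta> \<beta>)"

definition partial_deriv :: "'n \<Rightarrow> (real ^ 'n::finite \<Rightarrow> real) \<Rightarrow> real ^ 'n \<Rightarrow> real" where
  "partial_deriv i f x = deriv (\<lambda>t. f (x + t *\<^sub>R axis i 1)) 0"

definition C1_on :: "(real ^ 'n::finite) set \<Rightarrow> (real ^ 'n \<Rightarrow> real) \<Rightarrow> bool" where
  "C1_on S f \<longleftrightarrow>
     continuous_on S f \<and>
     (\<forall>i. (\<forall>x\<in>S. (\<lambda>t. f (x + t *\<^sub>R axis i 1)) field_differentiable at 0) \<and>
          continuous_on S (partial_deriv i f))"

definition C2_on :: "(real ^ 'n::finite) set \<Rightarrow> (real ^ 'n \<Rightarrow> real) \<Rightarrow> bool" where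
  "C2_on S f \<longleftrightarrow> C1_on S f \<and> (\<forall>i. C1_on S (partial_deriv i f))"

definition laplacian :: "(real ^ 'n::finite \<Rightarrow> real) \<Rightarrow> real ^ 'n \<Rightarrow> real" where
  "laplacian f x = (\<Sum>i\<in>UNIV. partial_deriv i (partial_deriv i f) x)"

definition dirichlet_helmholtz ::
    "real \<Rightarrow> (real ^ 'n::finite) set \<Rightarrow> (real ^ 'n \<Rightarrow> real) \<Rightarrow> bool" where
  "dirichlet_helmholtz lam \<Omega> \<phi> \<longleftrightarrow>
     C2_on \<Omega> \<phi> \<and> continuous_on (closure \<Omega>) \<phi> \<and>
     (\<forall>x\<in>\<Omega>. laplacian \<phi> x + lam * \<phi> x = 0) \<and> (\<forall>x\<in>frontier \<Omega>. \<phi> x = 0)"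

definition regular_radial_helmholtz :: "real \<Rightarrow> (real ^ 'n::finite \<Rightarrow> real) \<Rightarrow> bool" where
  "regular_radial_helmholtz lam \<phi> \<longleftrightarrow>
     C2_on UNIV \<phi> \<and> (\<forall>x. laplacian \<phi> x + lam * \<phi> x = 0) \<and>
     (\<forall>x y. norm x = norm y \<longrightarrow> \<phi> x = \<phi> y) \<and> \<phi> 0 > 0"

text \<open>\<open>u\<close> is an eigenfunction of the Dirichlet Laplacian on \<open>\<Omega>\<close> for its smallest eigenvalue \<open>\<mu>\<close>
  (classical eigenfunctions; only applied to balls). No sign of \<open>u\<close> is prescribed.\<close>

definition first_dirichlet_eigenfunction ::
    "(real ^ 'n::finite) set \<Rightarrow> real \<Rightarrow> (real ^ 'n \<Rightarrow> real) \<Rightarrow> bool" where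
  "first_dirichlet_eigenfunction \<Omega> \<mu> u \<longleftrightarrow>
     dirichlet_helmholtz \<mu> \<Omega> u \<and> (\<exists>x\<in>\<Omega>. u x \<noteq> 0) \<and>
     (\<forall>\<mu>' v. dirichlet_helmholtz \<mu>' \<Omega> v \<and> (\<exists>x\<in>\<Omega>. v x \<noteq> 0) \<longrightarrow> \<mu> \<le> \<mu>')"

text \<open>The lower bound for the volume of a superlevel component with normalised level \<open>\<theta>\<close>. At level
  zero, where no \<open>\<beta>\<close> solves the defining equation, it is the Faber--Krahn value, i.e. \<open>\<beta>\<close> is
  replaced by its limit, half the square of the first zero.\<close>

definition level_volume_bound :: "'n::finite itself \<Rightarrow> real \<Rightarrow> real \<Rightarrow> real" where
  "level_volume_bound _ lam \<theta> =
     measure lebesgue (ball (0 :: real ^ 'n) 1) *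
       (2 * (if \<theta> = 0 then (Bessel_J_zero1 (nu CARD('n)))\<^sup>2 / 2 else level_beta CARD('n) \<theta>) / lam)
         powr (real CARD('n) / 2)"

end

theory Submission
  imports Defs "HOL-Analysis.Analysis"
begin

text \<open>
  The volume bound is a pointwise form of Chiti's comparison principle. Fix a bounded component
  \<open>C\<close> of \<open>{\<phi> > l}\<close>, and for levels \<open>s > l\<close> let \<open>\<mu> s\<close> be the volume of \<open>C \<inter> {\<phi> > s}\<close> and \<open>H s\<close> the
  integral of \<open>\<phi>\<close> over that set. Two estimates control \<open>|\<nabla>\<phi>|\<close> between the levels \<open>s\<close> and \<open>s + \<delta>\<close>.
  Testing the equation with a truncation of \<open>\<phi>\<close> bounds the integral of \<open>|\<nabla>\<phi>|\<^sup>2\<close> by \<open>\<lambda> \<delta> H s\<close>; the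
  isoperimetric inequality for functions bounds the integral of \<open>|\<nabla>\<phi>|\<close> from below by \<open>\<delta> c\<close> times
  the power \<open>1 - 1/m\<close> of \<open>\<mu>(s + \<delta>)\<close>. With the Cauchy-Schwarz inequality this gives Talenti's
  differential inequality for \<open>\<mu>\<close> (\<open>talenti_inequality\<close>). For the radial solution it is an equality,
  and there it reads \<open>W'' = - b W / x powr p\<close> for the mass \<open>W\<close> as a function \<open>W x\<close> of the volume
  \<open>x\<close>. A Sturm comparison (\<open>sturm_comparison\<close>) shows first that the Wronskian
  \<open>s W(\<mu> s) - H s W'(\<mu> s)\<close> is nonnegative and then that \<open>H s / W(\<mu> s)\<close> is nonincreasing in \<open>s\<close>;
  as it is at least \<open>s\<close>, it is at least the maximum \<open>M\<close> at every level. Together they yield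
  \<open>M W'(|C|) \<le> l\<close>, where \<open>W'\<close> is the normalised radial solution, i.e. the reciprocal of the
  exponential moment; as \<open>W'\<close> decreases, this is the bound.

  The isoperimetric inequality comes from the Brunn-Minkowski inequality, which is proved by the
  Hadwiger-Ohmann induction on the number of boxes. Applied to the sets \<open>{g > t}\<close> and a small
  ball, and integrated over \<open>t\<close>, it bounds the integral of \<open>|\<nabla>g|\<close> without the coarea formula.

  The Bessel function enters through the entire series \<open>bessel_series a\<close> with \<open>a = m/2\<close>, for which
  \<open>J\<close> of order \<open>a - 1\<close> at \<open>x\<close> is, up to an explicit factor, \<open>bessel_series a (x\<^sup>2/4)\<close>, and
  \<open>q(\<beta>) = 1 / bessel_series a (\<beta>/2)\<close>. Differentiation raises the parameter \<open>a\<close> by one, so the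
  Helmholtz equation and the equation for \<open>W\<close> are both the same contiguous relation. The expansion of
  \<open>\<beta>\<close> near \<open>\<theta> = 1\<close> and its limit at \<open>\<theta> = 0\<close> are statements on the inverse of this series.

  Everything about balls uses one maximum principle: comparing a Dirichlet solution on a ball with a
  positive radial solution of larger eigenvalue shows that it vanishes when its eigenvalue is below
  the first one (\<open>dirichlet_eq_0_below_first_zero\<close>). This identifies the first eigenvalue, and, after
  subtracting a multiple of the radial solution that agrees on a sphere, it shows that a regular
  radial solution is unique up to a factor. Simplicity of the first eigenvalue follows from the volume
  bound itself: an eigenfunction independent of the radial one would have a combination with it that
  changes sign, and each of its two nodal sets would fill the whole ball.
\<close>

section \<open>The Brunn-Minkowski inequality\<close>

text \<open>The arithmetic-geometric mean inequality for the ratios \<open>x/(x+y)\<close> and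
  \<open>y/(x+y)\<close>; these add up to \<open>1\<close> in every coordinate. It is the
  Brunn-Minkowski inequality for two boxes.\<close>

lemma root_prod_superadditive:
  fixes x y :: "'i \<Rightarrow> real"
  assumes "finite I" "I \<noteq> {}" and x: "\<And>i. i \<in> I \<Longrightarrow> x i > 0" and y: "\<And>i. i \<in> I \<Longrightarrow> y i > 0"
  shows "root (card I) (\<Prod>i\<in>I. x i) + root (card I) (\<Prod>i\<in>I. y i) \<le> root (card I) (\<Prod>i\<in>I. x i + y i)"
proof -
  define n where "n = card I"
  have n: "n > 0" using assms by (simp add: n_def card_gt_0_iff)
  have amgm: "root n (\<Prod>i\<in>I. w i) \<le> (\<Sum>i\<in>I. w i) / n" if "\<And>i. i \<in> I \<Longrightarrow> w i > 0" for w :: "'i \<Rightarrow> real"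
  proof -
    have "(\<Prod>i\<in>I. w i) powr (1 / card I) \<le> (\<Sum>i\<in>I. w i / card I)"
      by (rule arith_geom_mean) (use assms that in \<open>auto intro: less_imp_le\<close>)
    moreover have "(\<Prod>i\<in>I. w i) powr (1 / card I) = root n (\<Prod>i\<in>I. w i)"
      using n prod_pos[of I w] that by (subst root_powr_inverse) (auto simp: n_def less_imp_le)
    ultimately show ?thesis by (simp add: sum_divide_distrib n_def)
  qed
  have P: "(\<Prod>i\<in>I. x i + y i) > 0" using x y by (intro prod_pos) (auto intro: add_pos_pos)
  have "root n (\<Prod>i\<in>I. x i / (x i + y i)) + root n (\<Prod>i\<in>I. y i / (x i + y i)) \<le>
        (\<Sum>i\<in>I. x i / (x i + y i)) / n + (\<Sum>i\<in>I. y i / (x i + y i)) / n"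
    using x y by (intro add_mono amgm divide_pos_pos add_pos_pos) auto
  also have "\<dots> = (\<Sum>i\<in>I. x i / (x i + y i) + y i / (x i + y i)) / n"
    by (simp add: sum.distrib add_divide_distrib)
  also have "(\<Sum>i\<in>I. x i / (x i + y i) + y i / (x i + y i)) = (\<Sum>i\<in>I. 1)"
    by (intro sum.cong refl) (use x y in \<open>simp add: add_divide_distrib[symmetric] add_pos_pos order_less_imp_not_eq2\<close>)
  also have "(\<Sum>i\<in>I. (1::real)) / n = 1" using n by (simp add: n_def)
  finally have "root n (\<Prod>i\<in>I. x i) / root n (\<Prod>i\<in>I. x i + y i) +
      root n (\<Prod>i\<in>I. y i) / root n (\<Prod>i\<in>I. x i + y i) \<le> 1"
    by (simp add: prod_dividef real_root_divide)
  then show ?thesis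
    using n P by (simp add: add_divide_distrib[symmetric] divide_le_eq n_def)
qed

lemma measure_lebesgue_box:
  fixes a b :: "'a::euclidean_space"
  assumes "box a b \<noteq> {}"
  shows "measure lebesgue (box a b) = (\<Prod>i\<in>Basis. b \<bullet> i - a \<bullet> i)"
  using assms by (auto simp: measure_lborel_box_eq box_eq_empty inner_diff_left less_imp_le not_le)

text \<open>A point of the large box is split coordinatewise, with the same ratio in both
  summands.\<close>

lemma box_subset_sum_boxes:
  fixes a b c d :: "'a::euclidean_space"
  assumes "box a b \<noteq> {}" "box c d \<noteq> {}"
  shows "box (a + c) (b + d) \<subseteq> box a b + box c d"
proof
  fix z assume z: "z \<in> box (a + c) (b + d)"
  have ab: "a \<bullet> i < b \<bullet> i" and cd: "c \<bullet> i < d \<bullet> i" if "i \<in> Basis" for i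
    using assms that by (auto simp: box_eq_empty not_le)
  define t where "t i = ((z - (a + c)) \<bullet> i) / ((b + d - (a + c)) \<bullet> i)" for i
  have t: "0 < t i" "t i < 1" "z \<bullet> i = (a + c) \<bullet> i + t i * ((b + d - (a + c)) \<bullet> i)" if "i \<in> Basis" for i
  proof -
    have "0 < (b + d - (a + c)) \<bullet> i"
      using ab[OF that] cd[OF that] by (simp add: inner_add_left inner_diff_left)
    moreover have "0 < (z - (a + c)) \<bullet> i" "(z - (a + c)) \<bullet> i < (b + d - (a + c)) \<bullet> i"
      using z that by (auto simp: mem_box inner_diff_left)
    ultimately show "0 < t i" "t i < 1" "z \<bullet> i = (a + c) \<bullet> i + t i * ((b + d - (a + c)) \<bullet> i)"
      by (auto simp: t_def inner_diff_left)
  qed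
  define x where "x = (\<Sum>i\<in>Basis. (a \<bullet> i + t i * ((b - a) \<bullet> i)) *\<^sub>R i)"
  define y where "y = (\<Sum>i\<in>Basis. (c \<bullet> i + t i * ((d - c) \<bullet> i)) *\<^sub>R i)"
  have between: "p < p + s * (q - p)" "p + s * (q - p) < q" if "p < q" "0 < s" "s < 1" for p q s :: real
  proof -
    show "p < p + s * (q - p)" using that by simp
    have "s * (q - p) < 1 * (q - p)" using that by (intro mult_strict_right_mono) auto
    then show "p + s * (q - p) < q" by simp
  qed
  have "x \<in> box a b" "y \<in> box c d"
    using ab cd t by (auto simp: x_def y_def mem_box inner_diff_left intro!: between)
  moreover have "z = x + y"
  proof (rule euclidean_eqI)
    fix i :: 'a assume i: "i \<in> Basis"
    have "x \<bullet> i = a \<bullet> i + t i * ((b - a) \<bullet> i)" "y \<bullet> i = c \<bullet> i + t i * ((d - c) \<bullet> i)"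
      using i by (simp_all add: x_def y_def)
    then show "z \<bullet> i = (x + y) \<bullet> i"
      using t(3)[OF i] by (simp add: inner_add_left inner_diff_left algebra_simps)
  qed
  ultimately show "z \<in> box a b + box c d" by (auto intro: set_plus_intro)
qed

definition box_packing :: "'a::euclidean_space set set \<Rightarrow> bool" where
  "box_packing \<D> \<longleftrightarrow> finite \<D> \<and> pairwise disjnt \<D> \<and> (\<forall>D\<in>\<D>. D \<noteq> {} \<and> (\<exists>a b. D = box a b))"

lemma box_packing_Union:
  assumes "box_packing \<D>"
  shows "open (\<Union>\<D>)" "bounded (\<Union>\<D>)" "\<Union>\<D> \<in> lmeasurable"
proof -
  show 1: "open (\<Union>\<D>)" using assms by (force simp: box_packing_def intro!: open_Union)
  have "bounded D" if "D \<in> \<D>" for D using assms that by (auto simp: box_packing_def)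
  then show 2: "bounded (\<Union>\<D>)" using assms by (auto simp: box_packing_def)
  show "\<Union>\<D> \<in> lmeasurable" using 1 2 lmeasurable_open by blast
qed

lemma measure_open_pos:
  fixes S :: "'a::euclidean_space set"
  assumes "open S" "bounded S" "S \<noteq> {}"
  shows "measure lebesgue S > 0"
  using assms by (metis lmeasurable_open negligible_iff_measure open_not_negligible zero_less_measure_iff)

lemma open_sums_set_plus:
  fixes S T :: "'a::euclidean_space set"
  assumes "open S"
  shows "open (S + T)"
proof -
  have "S + T = (\<Union>x\<in>S. \<Union>y\<in>T. {x + y})" by (auto simp: set_plus_def)
  then show ?thesis using open_sums[of S T] assms by simp
qed

lemma bounded_set_plus:
  fixes S T :: "'a::real_normed_vector set"
  assumes "bounded S" "bounded T"
  shows "bounded (S + T)"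
proof -
  have "S + T = (\<Union>x\<in>S. \<Union>y\<in>T. {x + y})" by (auto simp: set_plus_def)
  then show ?thesis using bounded_sums[OF assms] by simp
qed

lemma box_Int_halfspace:
  fixes a b :: "'a::euclidean_space"
  assumes k: "k \<in> Basis"
  shows "\<exists>b'. box a b \<inter> {x. x \<bullet> k < c} = box a b'" "\<exists>a'. box a b \<inter> {x. c < x \<bullet> k} = box a' b"
proof -
  have "box a b \<inter> {x. x \<bullet> k < c} = box a (\<Sum>i\<in>Basis. (if i = k then min (b \<bullet> k) c else b \<bullet> i) *\<^sub>R i)"
    using k by (auto simp: mem_box split: if_splits)
  then show "\<exists>b'. box a b \<inter> {x. x \<bullet> k < c} = box a b'" by blast
  have "box a b \<inter> {x. c < x \<bullet> k} = box (\<Sum>i\<in>Basis. (if i = k then max (a \<bullet> k) c else a \<bullet> i) *\<^sub>R i) b"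
    using k by (auto simp: mem_box split: if_splits)
  then show "\<exists>a'. box a b \<inter> {x. c < x \<bullet> k} = box a' b" by blast
qed

text \<open>Boxes that miss \<open>H\<close> are dropped, since a packing consists of nonempty
  boxes; this makes the number of boxes decrease in the induction.\<close>

definition cut_packing :: "'a::euclidean_space set set \<Rightarrow> 'a set \<Rightarrow> 'a set set" where
  "cut_packing \<D> H = (\<lambda>D. D \<inter> H) ` {D\<in>\<D>. D \<inter> H \<noteq> {}}"

lemma Union_cut_packing: "\<Union>(cut_packing \<D> H) = \<Union>\<D> \<inter> H"
  by (auto simp: cut_packing_def)

lemma card_cut_packing:
  assumes "finite \<D>"
  shows "card (cut_packing \<D> H) \<le> card {D\<in>\<D>. D \<inter> H \<noteq> {}}"
  unfolding cut_packing_def using assms by (intro card_image_le) auto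

lemma box_packing_cut:
  assumes "box_packing \<D>" "k \<in> Basis" "H = {x. x \<bullet> k < c} \<or> H = {x. c < x \<bullet> k}"
  shows "box_packing (cut_packing \<D> H)"
  unfolding box_packing_def
proof (intro conjI ballI)
  show "finite (cut_packing \<D> H)" using assms by (auto simp: box_packing_def cut_packing_def)
  show "pairwise disjnt (cut_packing \<D> H)"
    using assms unfolding box_packing_def cut_packing_def pairwise_def disjnt_def by blast
  fix D assume "D \<in> cut_packing \<D> H"
  then obtain E where E: "E \<in> \<D>" "D = E \<inter> H" "D \<noteq> {}" by (auto simp: cut_packing_def)
  moreover obtain a b where "E = box a b" using assms(1) E(1) unfolding box_packing_def by blast
  ultimately show "D \<noteq> {}" "\<exists>a b. D = box a b"
    using E box_Int_halfspace[OF assms(2)] assms(3) by metis+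
qed

lemma measure_split_hyperplane:
  fixes A :: "'a::euclidean_space set"
  assumes "A \<in> lmeasurable" "k \<in> Basis"
  shows "measure lebesgue A = measure lebesgue (A \<inter> {x. x \<bullet> k < c}) + measure lebesgue (A \<inter> {x. c < x \<bullet> k})"
proof -
  have [simp]: "A \<inter> {x. x \<bullet> k < c} \<in> lmeasurable" "A \<inter> {x. c < x \<bullet> k} \<in> lmeasurable"
    by (auto intro!: fmeasurable_Int_fmeasurable assms lborelD borel_open open_halfspace_component_lt open_halfspace_component_gt)
  have N: "negligible {x. x \<bullet> k = c}" using assms(2) by (rule negligible_standard_hyperplane)
  have "measure lebesgue A = measure lebesgue ((A \<inter> {x. x \<bullet> k < c}) \<union> (A \<inter> {x. c < x \<bullet> k}))"
    by (rule measure_negligible_symdiff)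
       (use assms in \<open>auto intro!: negligible_subset[OF N]\<close>)
  also have "\<dots> = measure lebesgue (A \<inter> {x. x \<bullet> k < c}) + measure lebesgue (A \<inter> {x. c < x \<bullet> k})"
    by (subst measure_Un3) (auto intro: arg_cong[of _ "{}" "measure lebesgue", simplified])
  finally show ?thesis .
qed

lemma continuous_measure_below_hyperplane:
  fixes B :: "'a::euclidean_space set"
  assumes B: "B \<in> lmeasurable" and k: "k \<in> Basis"
  shows "continuous_on UNIV (\<lambda>t. measure lebesgue (B \<inter> {x. x \<bullet> k < t}))"
proof (rule continuous_on_sequentiallyI)
  fix u :: "nat \<Rightarrow> real" and t assume u: "u \<longlonglongrightarrow> t"
  have M: "B \<inter> {x. x \<bullet> k < s} \<in> lmeasurable" for s
    by (auto intro!: fmeasurable_Int_fmeasurable B lborelD borel_open open_halfspace_component_lt)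
  have "(\<lambda>n. \<integral>x. indicat_real (B \<inter> {x. x \<bullet> k < u n}) x \<partial>lebesgue) \<longlonglongrightarrow>
        (\<integral>x. indicat_real (B \<inter> {x. x \<bullet> k < t}) x \<partial>lebesgue)"
  proof (rule integral_dominated_convergence)
    show "integrable lebesgue (indicat_real B)"
      using B by (intro integrable_real_indicator) (auto simp: fmeasurable_def)
    have "AE x in lebesgue. x \<bullet> k \<noteq> t"
      using negligible_standard_hyperplane[OF k, of t]
      by (auto simp: negligible_iff_null_sets intro!: AE_I'[where N="{x. x \<bullet> k = t}"])
    then show "AE x in lebesgue. (\<lambda>n. indicat_real (B \<inter> {x. x \<bullet> k < u n}) x)
        \<longlonglongrightarrow> indicat_real (B \<inter> {x. x \<bullet> k < t}) x"
    proof eventually_elim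
      case (elim x)
      have "\<forall>\<^sub>F n in sequentially. (x \<bullet> k < u n) = (x \<bullet> k < t)"
      proof (cases "x \<bullet> k < t")
        case True
        then show ?thesis using order_tendstoD(1)[OF u, of "x \<bullet> k"] by (auto elim: eventually_mono)
      next
        case False
        then have "t < x \<bullet> k" using elim by auto
        then show ?thesis using order_tendstoD(2)[OF u] False by (fastforce elim: eventually_mono)
      qed
      then show ?case
        by (intro tendsto_eventually) (auto elim!: eventually_mono simp: indicator_def)
    qed
    show "indicat_real (B \<inter> {x. x \<bullet> k < t}) \<in> borel_measurable lebesgue"
      using M by (intro borel_measurable_indicator) (auto simp: fmeasurable_def)
    show "indicat_real (B \<inter> {x. x \<bullet> k < u n}) \<in> borel_measurable lebesgue" for n
      using M[of "u n"] by (intro borel_measurable_indicator) (auto simp: fmeasurable_def)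
    show "AE x in lebesgue. norm (indicat_real (B \<inter> {x. x \<bullet> k < u n}) x) \<le> indicat_real B x" for n
      by (auto simp: indicator_def)
  qed
  then show "(\<lambda>n. measure lebesgue (B \<inter> {x. x \<bullet> k < u n})) \<longlonglongrightarrow> measure lebesgue (B \<inter> {x. x \<bullet> k < t})"
    using M by simp
qed

text \<open>The intermediate value theorem: a hyperplane orthogonal to a given axis can be moved so
  that it cuts off any prescribed fraction of the volume.\<close>

lemma hyperplane_cutting_fraction:
  fixes B :: "'a::euclidean_space set"
  assumes B: "B \<in> lmeasurable" "bounded B" and k: "k \<in> Basis" and p: "0 \<le> p" "p \<le> 1"
  shows "\<exists>t. measure lebesgue (B \<inter> {x. x \<bullet> k < t}) = p * measure lebesgue B"
proof -
  let ?g = "\<lambda>t. measure lebesgue (B \<inter> {x. x \<bullet> k < t})"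
  obtain N where "\<And>x. x \<in> B \<Longrightarrow> norm x \<le> N" using B(2) by (auto simp: bounded_iff)
  then have N: "\<bar>x \<bullet> k\<bar> \<le> N" if "x \<in> B" for x
    using Basis_le_norm[OF k, of x] that by fastforce
  have low: "B \<inter> {x. x \<bullet> k < - \<bar>N\<bar>} = {}" using N by fastforce
  have high: "B \<inter> {x. x \<bullet> k < \<bar>N\<bar> + 1} = B" using N by fastforce
  have "\<exists>t\<ge>-\<bar>N\<bar>. t \<le> \<bar>N\<bar> + 1 \<and> ?g t = p * measure lebesgue B"
    by (rule IVT', unfold low high)
       (use p B in \<open>auto intro!: continuous_on_subset[OF continuous_measure_below_hyperplane[OF B(1) k]] mult_left_le_one_le\<close>)
  then show ?thesis by blast
qed

lemma brunn_minkowski_boxes: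
  fixes a b c d :: "'a::euclidean_space"
  assumes ne: "box a b \<noteq> {}" "box c d \<noteq> {}"
  shows "root DIM('a) (measure lebesgue (box a b)) + root DIM('a) (measure lebesgue (box c d))
       \<le> root DIM('a) (measure lebesgue (box a b + box c d))"
proof -
  have pos: "a \<bullet> i < b \<bullet> i" "c \<bullet> i < d \<bullet> i" if "i \<in> Basis" for i
    using ne that by (auto simp: box_eq_empty not_le)
  then have ne': "box (a + c) (b + d) \<noteq> {}"
    by (auto simp: box_eq_empty not_le inner_add_left intro: add_strict_mono)
  have "root DIM('a) (\<Prod>i\<in>Basis. b \<bullet> i - a \<bullet> i) + root DIM('a) (\<Prod>i\<in>Basis. d \<bullet> i - c \<bullet> i)
      \<le> root DIM('a) (\<Prod>i\<in>Basis. (b \<bullet> i - a \<bullet> i) + (d \<bullet> i - c \<bullet> i))"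
    by (rule root_prod_superadditive) (use pos in auto)
  also have "(\<Prod>i\<in>Basis. (b \<bullet> i - a \<bullet> i) + (d \<bullet> i - c \<bullet> i)) = measure lebesgue (box (a + c) (b + d))"
    by (subst measure_lebesgue_box[OF ne']) (simp add: inner_add_left algebra_simps)
  also have "root DIM('a) (measure lebesgue (box (a + c) (b + d))) \<le> root DIM('a) (measure lebesgue (box a b + box c d))"
    by (intro iffD2[OF real_root_le_iff] measure_mono_fmeasurable box_subset_sum_boxes ne
          lmeasurable_open bounded_set_plus open_sums_set_plus) auto
  finally show ?thesis by (simp only: measure_lebesgue_box[OF ne(1)] measure_lebesgue_box[OF ne(2)])
qed

text \<open>Hadwiger and Ohmann's induction on the total number of boxes. If one packing has two
  boxes, a hyperplane separates them, so each side meets fewer boxes of that packing; the other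
  packing is cut in the same proportion of volume. The two halves of the sum lie on different sides
  of a hyperplane, and the inequalities for the halves are homogeneous, so that they add up.\<close>

lemma brunn_minkowski_packings:
  fixes \<D> \<E> :: "'a::euclidean_space set set"
  assumes "box_packing \<D>" "box_packing \<E>" "\<D> \<noteq> {}" "\<E> \<noteq> {}"
  shows "root DIM('a) (measure lebesgue (\<Union>\<D>)) + root DIM('a) (measure lebesgue (\<Union>\<E>))
       \<le> root DIM('a) (measure lebesgue (\<Union>\<D> + \<Union>\<E>))"
  using assms
proof (induction "card \<D> + card \<E>" arbitrary: \<D> \<E> rule: less_induct)
  case less
  let ?m = "measure lebesgue :: 'a set \<Rightarrow> real" and ?r = "root DIM('a)"
  have cut: "?r (?m (\<Union>\<D>)) + ?r (?m (\<Union>\<E>)) \<le> ?r (?m (\<Union>\<D> + \<Union>\<E>))"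
    if IH: "\<And>\<D>' \<E>'. card \<D>' + card \<E>' < card \<D> + card \<E> \<Longrightarrow> box_packing \<D>' \<Longrightarrow> box_packing \<E>' \<Longrightarrow>
                \<D>' \<noteq> {} \<Longrightarrow> \<E>' \<noteq> {} \<Longrightarrow> ?r (?m (\<Union>\<D>')) + ?r (?m (\<Union>\<E>')) \<le> ?r (?m (\<Union>\<D>' + \<Union>\<E>'))"
      and D: "box_packing \<D>" and E: "box_packing \<E>" "\<E> \<noteq> {}" and two: "D1 \<in> \<D>" "D2 \<in> \<D>" "D1 \<noteq> D2"
    for \<D> \<E> :: "'a set set" and D1 D2
  proof -
    obtain a1 b1 a2 b2 where boxes: "D1 = box a1 b1" "D2 = box a2 b2" "D1 \<noteq> {}" "D2 \<noteq> {}"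
      using D two unfolding box_packing_def by metis
    have "D1 \<inter> D2 = {}" using D two by (auto simp: box_packing_def pairwise_def disjnt_def)
    then obtain k where k: "k \<in> Basis" "b1 \<bullet> k \<le> a2 \<bullet> k \<or> b2 \<bullet> k \<le> a1 \<bullet> k"
    proof -
      have "\<exists>k\<in>Basis. b1 \<bullet> k \<le> a1 \<bullet> k \<or> b2 \<bullet> k \<le> a2 \<bullet> k \<or> b1 \<bullet> k \<le> a2 \<bullet> k \<or> b2 \<bullet> k \<le> a1 \<bullet> k"
        using \<open>D1 \<inter> D2 = {}\<close> by (simp only: boxes(1,2) disjoint_interval(4))
      moreover have "\<not> b1 \<bullet> k \<le> a1 \<bullet> k" "\<not> b2 \<bullet> k \<le> a2 \<bullet> k" if "k \<in> Basis" for k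
        using boxes that by (auto simp: box_eq_empty)
      ultimately show ?thesis using that by blast
    qed
    \<comment> \<open>the lower end of the upper box in direction \<open>k\<close>: the two boxes lie on different sides of the hyperplane\<close>
    define c where "c = (if b1 \<bullet> k \<le> a2 \<bullet> k then a2 \<bullet> k else a1 \<bullet> k)"
    let ?L = "\<lambda>t. {x::'a. x \<bullet> k < t}" and ?R = "\<lambda>t. {x::'a. t < x \<bullet> k}"
    have sep: "(D1 \<inter> ?R c = {} \<and> D2 \<inter> ?L c = {}) \<or> (D2 \<inter> ?R c = {} \<and> D1 \<inter> ?L c = {})"
    proof -
      have "a1 \<bullet> k < x \<bullet> k \<and> x \<bullet> k < b1 \<bullet> k" if "x \<in> D1" for x
        using that k(1) by (auto simp: boxes(1) mem_box)
      moreover have "a2 \<bullet> k < x \<bullet> k \<and> x \<bullet> k < b2 \<bullet> k" if "x \<in> D2" for x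
        using that k(1) by (auto simp: boxes(2) mem_box)
      ultimately show ?thesis
        using k(2) unfolding c_def by (cases "b1 \<bullet> k \<le> a2 \<bullet> k") (auto, fastforce+)
    qed
    have fin: "finite \<D>" "finite \<E>" using D E by (auto simp: box_packing_def)
    have "{D \<in> \<D>. D \<inter> ?L c \<noteq> {}} \<subset> \<D>" "{D \<in> \<D>. D \<inter> ?R c \<noteq> {}} \<subset> \<D>"
      using sep two by auto
    then have cD: "card (cut_packing \<D> (?L c)) < card \<D>" "card (cut_packing \<D> (?R c)) < card \<D>"
      by (simp_all only: le_less_trans[OF card_cut_packing[OF fin(1)] psubset_card_mono[OF fin(1)]])
    have cE: "card (cut_packing \<E> H) \<le> card \<E>" for H
      by (rule order_trans[OF card_cut_packing card_mono]) (use fin in auto)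
    define A where "A = \<Union>\<D>"
    define B where "B = \<Union>\<E>"
    note oA = box_packing_Union[OF D, folded A_def] and oB = box_packing_Union[OF E(1), folded B_def]
    have ne1: "D1 \<inter> ?L c \<noteq> {} \<or> D2 \<inter> ?L c \<noteq> {}" "D1 \<inter> ?R c \<noteq> {} \<or> D2 \<inter> ?R c \<noteq> {}"
    proof -
      have "\<not> D \<subseteq> {x. x \<bullet> k = c}" if "D = D1 \<or> D = D2" for D
        using negligible_subset[OF negligible_standard_hyperplane[OF k(1), of c]] boxes that
          open_not_negligible[of D] by (metis open_box)
      then show "D1 \<inter> ?L c \<noteq> {} \<or> D2 \<inter> ?L c \<noteq> {}" "D1 \<inter> ?R c \<noteq> {} \<or> D2 \<inter> ?R c \<noteq> {}"
        using sep by (auto simp: set_eq_iff subset_iff) (metis linorder_neqE)+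
    qed
    have oH: "open (A \<inter> ?L t)" "open (A \<inter> ?R t)" "open (B \<inter> ?L t)" "open (B \<inter> ?R t)" for t
      using oA oB by (auto intro!: open_Int open_halfspace_component_lt open_halfspace_component_gt)
    have bH: "bounded (A \<inter> X)" "bounded (B \<inter> X)" for X
      using oA oB by (auto intro: bounded_subset)
    have neA: "A \<inter> ?L c \<noteq> {}" "A \<inter> ?R c \<noteq> {}" using ne1 two unfolding A_def by blast+
    have mA: "?m (A \<inter> ?L c) > 0" "?m (A \<inter> ?R c) > 0"
      by (rule measure_open_pos[OF oH(1) bH(1) neA(1)], rule measure_open_pos[OF oH(2) bH(1) neA(2)])
    have sA: "?m A = ?m (A \<inter> ?L c) + ?m (A \<inter> ?R c)" by (rule measure_split_hyperplane[OF oA(3) k(1)])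
    define p where "p = ?m (A \<inter> ?L c) / ?m A"
    have p: "0 < p" "p < 1" "?m (A \<inter> ?L c) = p * ?m A" "?m (A \<inter> ?R c) = (1 - p) * ?m A"
      using mA sA by (auto simp: p_def field_simps)
    obtain t where t: "?m (B \<inter> ?L t) = p * ?m B"
      using hyperplane_cutting_fraction[OF oB(3,2) k(1), of p] p by auto
    have t': "?m (B \<inter> ?R t) = (1 - p) * ?m B"
      using measure_split_hyperplane[OF oB(3) k(1), of t] t by (simp add: algebra_simps)
    have "B \<noteq> {}" using E unfolding B_def box_packing_def by auto
    then have mB: "?m B > 0" by (rule measure_open_pos[OF oB(1,2)])
    have neB: "B \<inter> ?L t \<noteq> {}" "B \<inter> ?R t \<noteq> {}" using t t' mB p by auto
    have half: "q * (?r (?m A) + ?r (?m B)) ^ DIM('a) \<le> ?m ((A \<inter> X) + (B \<inter> Y))"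
      if XY: "X = ?L c \<and> Y = ?L t \<or> X = ?R c \<and> Y = ?R t" and q: "0 < q" "?m (A \<inter> X) = q * ?m A" "?m (B \<inter> Y) = q * ?m B"
      for X Y q
    proof -
      have "?r (?m (\<Union>(cut_packing \<D> X))) + ?r (?m (\<Union>(cut_packing \<E> Y)))
          \<le> ?r (?m (\<Union>(cut_packing \<D> X) + \<Union>(cut_packing \<E> Y)))"
      proof (rule IH)
        show "card (cut_packing \<D> X) + card (cut_packing \<E> Y) < card \<D> + card \<E>"
          using cD cE[of Y] XY by (intro add_less_le_mono) auto
        show "box_packing (cut_packing \<D> X)" "box_packing (cut_packing \<E> Y)"
          using XY by (blast intro!: box_packing_cut[OF D k(1)] box_packing_cut[OF E(1) k(1)])+
        have "\<Union>(cut_packing \<D> X) \<noteq> {}" "\<Union>(cut_packing \<E> Y) \<noteq> {}"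
          unfolding Union_cut_packing A_def[symmetric] B_def[symmetric] using XY neA neB by auto
        then show "cut_packing \<D> X \<noteq> {}" "cut_packing \<E> Y \<noteq> {}" by auto
      qed
      then have "?r (q * ?m A) + ?r (q * ?m B) \<le> ?r (?m ((A \<inter> X) + (B \<inter> Y)))"
        unfolding Union_cut_packing A_def[symmetric] B_def[symmetric] q .
      then have "(?r q * (?r (?m A) + ?r (?m B))) ^ DIM('a) \<le> ?r (?m ((A \<inter> X) + (B \<inter> Y))) ^ DIM('a)"
        using q mB by (intro power_mono) (auto simp: real_root_mult algebra_simps)
      then show ?thesis
        using q by (simp add: power_mult_distrib real_root_pow_pos2)
    qed
    have "(?r (?m A) + ?r (?m B)) ^ DIM('a) =
        p * (?r (?m A) + ?r (?m B)) ^ DIM('a) + (1 - p) * (?r (?m A) + ?r (?m B)) ^ DIM('a)"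
      by (simp add: algebra_simps)
    also have "\<dots> \<le> ?m ((A \<inter> ?L c) + (B \<inter> ?L t)) + ?m ((A \<inter> ?R c) + (B \<inter> ?R t))"
      by (intro add_mono half) (use p t t' in auto)
    also have "\<dots> = ?m (((A \<inter> ?L c) + (B \<inter> ?L t)) \<union> ((A \<inter> ?R c) + (B \<inter> ?R t)))"
    proof -
      have "((A \<inter> ?L c) + (B \<inter> ?L t)) \<inter> ((A \<inter> ?R c) + (B \<inter> ?R t)) = {}"
      proof -
        have "x \<bullet> k < c + t" if "x \<in> (A \<inter> ?L c) + (B \<inter> ?L t)" for x
          using that by (auto elim!: set_plus_elim simp: inner_add_left)
        moreover have "x \<bullet> k > c + t" if "x \<in> (A \<inter> ?R c) + (B \<inter> ?R t)" for x
          using that by (auto elim!: set_plus_elim simp: inner_add_left)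
        ultimately show ?thesis by fastforce
      qed
      then show ?thesis
        by (subst measure_Un3) (auto intro!: lmeasurable_open bounded_set_plus open_sums_set_plus oH bH)
    qed
    also have "\<dots> \<le> ?m (A + B)"
      by (intro measure_mono_fmeasurable Un_least set_plus_mono2 fmeasurableD fmeasurable.Un
            lmeasurable_open bounded_set_plus open_sums_set_plus oH bH oA oB) auto
    finally have "?r ((?r (?m A) + ?r (?m B)) ^ DIM('a)) \<le> ?r (?m (A + B))" by simp
    then show ?thesis
      by (simp add: real_root_power_cancel A_def B_def)
  qed
  show ?case
  proof (cases "card \<D> \<le> 1 \<and> card \<E> \<le> 1")
    case True
    moreover have "finite \<D>" "finite \<E>" using less by (auto simp: box_packing_def)
    ultimately have "card \<D> = 1" "card \<E> = 1"
      using less(4,5) by (metis One_nat_def card_gt_0_iff le_antisym Suc_leI)+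
    then obtain D E where DE: "\<D> = {D}" "\<E> = {E}" by (auto simp: card_1_singleton_iff)
    have "D \<noteq> {} \<and> (\<exists>a b. D = box a b)" "E \<noteq> {} \<and> (\<exists>a b. E = box a b)"
      using less(2,3) unfolding box_packing_def DE by blast+
    then obtain a b c d where "D = box a b" "E = box c d" "box a b \<noteq> {}" "box c d \<noteq> {}" by blast
    then show ?thesis unfolding DE cSup_singleton using brunn_minkowski_boxes by metis
  next
    case False
    then consider D1 D2 where "D1 \<in> \<D>" "D2 \<in> \<D>" "D1 \<noteq> D2" | E1 E2 where "E1 \<in> \<E>" "E2 \<in> \<E>" "E1 \<noteq> E2"
      by (metis card_le_Suc0_iff_eq One_nat_def card.infinite linorder_not_le not_less_zero zero_le)
    then show ?thesis
    proof cases
      case 1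
      then show ?thesis using cut[OF less(1)] less by blast
    next
      case 2
      have "?r (?m (\<Union>\<E>)) + ?r (?m (\<Union>\<D>)) \<le> ?r (?m (\<Union>\<E> + \<Union>\<D>))"
        by (rule cut[OF _ less(3,2,4) 2]) (rule less(1), auto)
      then show ?thesis by (simp add: add.commute)
    qed
  qed
qed

text \<open>An open set is a countable union of closed boxes. A finite subunion of almost full
  measure has a division, whose interiors form a packing.\<close>

lemma open_inner_box_packing:
  fixes A :: "'a::euclidean_space set"
  assumes A: "open A" "bounded A" and e: "e > 0"
  shows "\<exists>\<D>. box_packing \<D> \<and> \<Union>\<D> \<subseteq> A \<and> measure lebesgue A < measure lebesgue (\<Union>\<D>) + e"
proof -
  obtain \<C> where C: "countable \<C>" "\<C> \<subseteq> Pow A" "\<And>X. X \<in> \<C> \<Longrightarrow> \<exists>a b. X = cbox a b" "\<Union>\<C> = A"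
    using open_countable_Union_open_cbox[OF A(1)] by metis
  define K where "K = (\<lambda>n. from_nat_into (insert {} \<C>) n)"
  have rK: "range K = insert {} \<C>"
    unfolding K_def using C(1) by (simp add: range_from_nat_into)
  have Kbox: "\<exists>a b. K n = cbox a b" for n
  proof -
    have "K n \<in> insert {} \<C>" using rK by blast
    then show ?thesis using C(3) by (metis empty_iff insert_iff empty_as_interval)
  qed
  define F where "F n = \<Union>(K ` {..n})" for n
  have UF: "(\<Union>n. F n) = A"
  proof -
    have "(\<Union>n. F n) = \<Union>(range K)" unfolding F_def by blast
    then show ?thesis using rK C(4) by simp
  qed
  have ex: "\<exists>p. p division_of F n" for n
    unfolding F_def by (rule elementary_unions_intervals[of "K ` {..n}"]) (use Kbox in auto)
  have Fm: "F n \<in> lmeasurable" for n using ex lmeasurable_division by blast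
  have "(\<lambda>n. measure lebesgue (F n)) \<longlonglongrightarrow> measure lebesgue (\<Union>n. F n)"
  proof (rule measure_nested_Union[OF Fm])
    fix n
    show "measure lebesgue (F n) \<le> measure lebesgue A"
      using Fm[of n] UF lmeasurable_open[OF A(2,1)] by (intro measure_mono_fmeasurable) auto
    show "F n \<subseteq> F (Suc n)" unfolding F_def by (intro Union_mono image_mono) auto
  qed
  then have "\<forall>\<^sub>F n in sequentially. measure lebesgue A - e < measure lebesgue (F n)"
    unfolding UF by (rule order_tendstoD) (use e in auto)
  then obtain n where n: "measure lebesgue A - e < measure lebesgue (F n)"
    by (auto simp: eventually_sequentially)
  obtain p where p: "p division_of F n" using ex by blast
  define \<D> where "\<D> = interior ` p - {{}}"
  have "box_packing \<D>"
    unfolding box_packing_def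
  proof (intro conjI ballI)
    show "finite \<D>" using p by (auto simp: \<D>_def)
    show "pairwise disjnt \<D>"
      using division_ofD(5)[OF p] unfolding \<D>_def pairwise_def disjnt_def by blast
    fix D assume "D \<in> \<D>"
    then obtain k where k: "k \<in> p" "D = interior k" "D \<noteq> {}" by (auto simp: \<D>_def)
    show "D \<noteq> {}" by fact
    show "\<exists>a b. D = box a b" using division_ofD(4)[OF p k(1)] k(2) interior_cbox by metis
  qed
  moreover have UD: "\<Union>\<D> = (\<Union>k\<in>p. interior k)" by (auto simp: \<D>_def)
  have "\<Union>\<D> \<subseteq> \<Union>p" unfolding UD using interior_subset by blast
  then have "\<Union>\<D> \<subseteq> A" using division_ofD(6)[OF p] UF by blast
  moreover have "measure lebesgue (\<Union>\<D>) = measure lebesgue (F n)"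
  proof -
    have int: "interior k \<in> lmeasurable" "measure lebesgue (interior k) = measure lebesgue k" if "k \<in> p" for k
    proof -
      obtain a b where "k = cbox a b" using division_ofD(4)[OF p \<open>k \<in> p\<close>] by blast
      then show "interior k \<in> lmeasurable" "measure lebesgue (interior k) = measure lebesgue k"
        by (auto simp: measure_lborel_box_eq measure_lborel_cbox_eq)
    qed
    have "measure lebesgue (\<Union>k\<in>p. interior k) = (\<Sum>k\<in>p. measure lebesgue (interior k))"
      by (rule measure_UNION') (use p int division_ofD(5)[OF p] in \<open>auto simp: pairwise_def disjnt_def\<close>)
    also have "\<dots> = measure lebesgue (F n)" using int content_division[OF p] by simp
    finally show ?thesis unfolding UD .
  qed
  ultimately show ?thesis using n by (intro exI[of _ \<D>]) auto
qed

theorem brunn_minkowski_open: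
  fixes A B :: "'a::euclidean_space set"
  assumes A: "open A" "bounded A" "A \<noteq> {}" and B: "open B" "bounded B" "B \<noteq> {}"
  shows "root DIM('a) (measure lebesgue A) + root DIM('a) (measure lebesgue B)
       \<le> root DIM('a) (measure lebesgue (A + B))"
proof -
  let ?m = "measure lebesgue :: 'a set \<Rightarrow> real" and ?r = "root DIM('a)"
  have approx: "\<exists>\<D>. \<forall>n. box_packing (\<D> n) \<and> \<D> n \<noteq> {} \<and> \<Union>(\<D> n) \<subseteq> S \<and> ?m S < ?m (\<Union>(\<D> n)) + ?m S / real (Suc n)"
    if S: "open S" "bounded S" "S \<noteq> {}" for S :: "'a set"
  proof -
    have pos: "?m S > 0" using S by (rule measure_open_pos)
    have "\<exists>\<D>. box_packing \<D> \<and> \<D> \<noteq> {} \<and> \<Union>\<D> \<subseteq> S \<and> ?m S < ?m (\<Union>\<D>) + ?m S / real (Suc n)" for n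
    proof -
      have "?m S / real (Suc n) > 0" using pos by simp
      then obtain \<D> where D: "box_packing \<D>" "\<Union>\<D> \<subseteq> S" "?m S < ?m (\<Union>\<D>) + ?m S / real (Suc n)"
        using open_inner_box_packing[OF S(1,2)] by blast
      have "?m S / real (Suc n) \<le> ?m S" using pos by (simp add: field_simps)
      then have "\<D> \<noteq> {}" using D(3) by auto
      then show ?thesis using D by blast
    qed
    then show ?thesis by metis
  qed
  have lim: "(\<lambda>n. ?m (\<Union>(\<D> n))) \<longlonglongrightarrow> ?m S"
    if S: "open S" "bounded S"
      and D: "\<forall>n. box_packing (\<D> n) \<and> \<D> n \<noteq> {} \<and> \<Union>(\<D> n) \<subseteq> S \<and> ?m S < ?m (\<Union>(\<D> n)) + ?m S / real (Suc n)"
    for S :: "'a set" and \<D>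
  proof (rule tendsto_sandwich[where f="\<lambda>n. ?m S - ?m S / real (Suc n)" and h="\<lambda>_. ?m S"])
    have "(\<lambda>n. ?m S * inverse (real (Suc n))) \<longlonglongrightarrow> ?m S * 0"
      by (intro tendsto_mult tendsto_const LIMSEQ_inverse_real_of_nat)
    then show "(\<lambda>n. ?m S - ?m S / real (Suc n)) \<longlonglongrightarrow> ?m S"
      using tendsto_diff[OF tendsto_const[of "?m S"]] by (fastforce simp: divide_inverse)
    show "\<forall>\<^sub>F n in sequentially. ?m S - ?m S / real (Suc n) \<le> ?m (\<Union>(\<D> n))"
      using D by (intro always_eventually allI) (smt (verit))
    show "\<forall>\<^sub>F n in sequentially. ?m (\<Union>(\<D> n)) \<le> ?m S"
      using D lmeasurable_open[OF S(2,1)]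
      by (intro always_eventually allI measure_mono_fmeasurable fmeasurableD[OF box_packing_Union(3)]) auto
  qed auto
  obtain \<D> where D: "\<forall>n. box_packing (\<D> n) \<and> \<D> n \<noteq> {} \<and> \<Union>(\<D> n) \<subseteq> A \<and> ?m A < ?m (\<Union>(\<D> n)) + ?m A / real (Suc n)"
    using approx[OF A] by blast
  obtain \<E> where E: "\<forall>n. box_packing (\<E> n) \<and> \<E> n \<noteq> {} \<and> \<Union>(\<E> n) \<subseteq> B \<and> ?m B < ?m (\<Union>(\<E> n)) + ?m B / real (Suc n)"
    using approx[OF B] by blast
  have "(\<lambda>n. ?r (?m (\<Union>(\<D> n))) + ?r (?m (\<Union>(\<E> n)))) \<longlonglongrightarrow> ?r (?m A) + ?r (?m B)"
    by (intro tendsto_add tendsto_real_root lim A B D E)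
  moreover have "?r (?m (\<Union>(\<D> n))) + ?r (?m (\<Union>(\<E> n))) \<le> ?r (?m (A + B))" for n
  proof -
    have "?r (?m (\<Union>(\<D> n))) + ?r (?m (\<Union>(\<E> n))) \<le> ?r (?m (\<Union>(\<D> n) + \<Union>(\<E> n)))"
      using D E by (intro brunn_minkowski_packings) auto
    also have "\<dots> \<le> ?r (?m (A + B))"
    proof (intro iffD2[OF real_root_le_iff] measure_mono_fmeasurable)
      show "\<Union>(\<D> n) + \<Union>(\<E> n) \<subseteq> A + B" using D E by (intro set_plus_mono2) auto
      show "A + B \<in> lmeasurable"
        by (intro lmeasurable_open bounded_set_plus open_sums_set_plus A B)
      have "box_packing (\<D> n)" "box_packing (\<E> n)" using D E by auto
      then show "\<Union>(\<D> n) + \<Union>(\<E> n) \<in> sets lebesgue"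
        by (intro fmeasurableD lmeasurable_open bounded_set_plus open_sums_set_plus box_packing_Union)
    qed auto
    finally show ?thesis .
  qed
  ultimately show ?thesis by (intro LIMSEQ_le_const2) auto
qed

lemma power_add_ge_linear:
  fixes x y :: real
  assumes "0 \<le> x" "0 \<le> y"
  shows "x ^ n + real n * y * x ^ (n - 1) \<le> (x + y) ^ n"
proof (induction n)
  case (Suc n)
  have "x ^ Suc n + real (Suc n) * y * x ^ n = x * (x ^ n + real n * y * x ^ (n - 1)) + y * x ^ n"
    by (cases n) (auto simp: algebra_simps)
  also have "\<dots> \<le> x * (x + y) ^ n + y * (x + y) ^ n"
    using assms Suc by (intro add_mono mult_left_mono power_mono) auto
  also have "\<dots> = (x + y) ^ Suc n" by (simp add: algebra_simps)
  finally show ?case by simp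
qed simp

text \<open>The growth of volume under a small enlargement: the first-order term is the
  isoperimetric lower bound for the surface area.\<close>

corollary measure_enlarge_ball:
  fixes A :: "'a::euclidean_space set"
  assumes A: "open A" "bounded A" "A \<noteq> {}" and r: "r > 0"
  shows "measure lebesgue A + r * (real DIM('a) * root DIM('a) (unit_ball_vol DIM('a)) *
           root DIM('a) (measure lebesgue A) ^ (DIM('a) - 1)) \<le> measure lebesgue (A + ball 0 r)"
proof -
  let ?r = "root DIM('a)"
  have "measure lebesgue A + r * (real DIM('a) * ?r (unit_ball_vol DIM('a)) * ?r (measure lebesgue A) ^ (DIM('a) - 1))
      = ?r (measure lebesgue A) ^ DIM('a) + real DIM('a) * (r * ?r (unit_ball_vol DIM('a))) * ?r (measure lebesgue A) ^ (DIM('a) - 1)"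
    by (simp add: real_root_pow_pos2 algebra_simps)
  also have "\<dots> \<le> (?r (measure lebesgue A) + r * ?r (unit_ball_vol DIM('a))) ^ DIM('a)"
    using r by (intro power_add_ge_linear) (auto simp: unit_ball_vol_nonneg)
  also have "r * ?r (unit_ball_vol DIM('a)) = ?r (measure lebesgue (ball (0::'a) r))"
    using r by (simp add: content_ball real_root_mult real_root_power_cancel)
  also have "(?r (measure lebesgue A) + ?r (measure lebesgue (ball (0::'a) r))) ^ DIM('a)
      \<le> ?r (measure lebesgue (A + ball 0 r)) ^ DIM('a)"
    using brunn_minkowski_open[OF A, of "ball 0 r"] r by (intro power_mono) auto
  also have "\<dots> = measure lebesgue (A + ball 0 r)" by (simp add: real_root_pow_pos2)
  finally show ?thesis .
qed

section \<open>The isoperimetric inequality for functions\<close>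

text \<open>Points near the support lie in a compact neighbourhood of it; elsewhere the function
  vanishes at both points.\<close>

lemma compact_support_uniformly_continuous:
  fixes f :: "'a::euclidean_space \<Rightarrow> 'b::real_normed_vector"
  assumes f: "continuous_on UNIV f" and K: "compact K" "\<And>x. x \<notin> K \<Longrightarrow> f x = 0" and e: "e > 0"
  shows "\<exists>d>0. \<forall>x y. dist x y < d \<longrightarrow> dist (f x) (f y) < e"
proof -
  define K' where "K' = {x + y |x y. x \<in> K \<and> y \<in> cball (0::'a) 1}"
  have "compact K'" unfolding K'_def using K(1) by (intro compact_sums) auto
  then have "uniformly_continuous_on K' f"
    by (intro compact_uniformly_continuous continuous_on_subset[OF f]) auto
  then obtain d where d: "d > 0" "\<And>x y. x \<in> K' \<Longrightarrow> y \<in> K' \<Longrightarrow> dist x y < d \<Longrightarrow> dist (f x) (f y) < e"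
    using e unfolding uniformly_continuous_on_def by blast
  have near: "y \<in> K'" if "x \<in> K" "dist x y \<le> 1" for x y
    using that unfolding K'_def by (intro CollectI exI[of _ x] exI[of _ "y - x"]) (auto simp: dist_norm norm_minus_commute)
  have "dist (f x) (f y) < e" if "dist x y < min d 1" for x y
  proof (cases "x \<in> K \<or> y \<in> K")
    case True
    then have "x \<in> K'" "y \<in> K'"
      using near[of x x] near[of x y] near[of y x] near[of y y] that by (auto simp: dist_commute)
    then show ?thesis using d that by auto
  next
    case False
    then show ?thesis using K e by simp
  qed
  then show ?thesis using d(1) by (intro exI[of _ "min d 1"]) auto
qed

lemma increment_along_vector:
  fixes f h :: "'a::real_normed_vector \<Rightarrow> real"
  assumes der: "\<And>y. ((\<lambda>t. f (y + t *\<^sub>R v)) has_real_derivative h y) (at 0)"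
    and near: "\<And>s. s \<in> closed_segment 0 t \<Longrightarrow> \<bar>h (x + s *\<^sub>R v) - c\<bar> \<le> e"
  shows "\<bar>f (x + t *\<^sub>R v) - f x - t * c\<bar> \<le> e * \<bar>t\<bar>"
proof -
  have D: "((\<lambda>t. f (x + t *\<^sub>R v)) has_real_derivative h (x + s *\<^sub>R v)) (at s)" for s
  proof -
    have "((\<lambda>t. f (x + (t + s) *\<^sub>R v)) has_real_derivative h (x + s *\<^sub>R v)) (at 0)"
      using der[of "x + s *\<^sub>R v"] by (simp add: algebra_simps)
    then show ?thesis using DERIV_shift[of "\<lambda>t. f (x + t *\<^sub>R v)" "h (x + s *\<^sub>R v)" 0 s] by simp
  qed
  have "norm ((f (x + t *\<^sub>R v) - t * c) - (f (x + 0 *\<^sub>R v) - 0 * c)) \<le> e * norm (t - 0)"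
  proof (rule field_differentiable_bound[where S="closed_segment 0 t" and f="\<lambda>t. f (x + t *\<^sub>R v) - t * c"])
    show "((\<lambda>t. f (x + t *\<^sub>R v) - t * c) has_field_derivative h (x + s *\<^sub>R v) - c) (at s within closed_segment 0 t)" for s
      by (auto intro!: derivative_eq_intros DERIV_subset[OF D])
  qed (use near in auto)
  then show ?thesis by (simp add: algebra_simps)
qed

text \<open>Continuous partial derivatives control the increment in every direction: move along one
  coordinate axis after the other and use the mean value theorem on each piece.\<close>

lemma increment_near_gradient:
  fixes g :: "'a::euclidean_space \<Rightarrow> real" and G :: "'a \<Rightarrow> 'a"
  assumes der: "\<And>x i. i \<in> Basis \<Longrightarrow> ((\<lambda>t. g (x + t *\<^sub>R i)) has_real_derivative G x \<bullet> i) (at 0)"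
    and near: "\<And>y. dist x y \<le> norm z \<Longrightarrow> dist (G x) (G y) \<le> e"
  shows "\<bar>g (x + z) - g x - G x \<bullet> z\<bar> \<le> real DIM('a) * e * norm z"
proof -
  have e: "0 \<le> e" using near[of x] by auto
  let ?z = "\<lambda>S. \<Sum>i\<in>S. (z \<bullet> i) *\<^sub>R i"
  have "\<bar>g (x + ?z S) - g x - (\<Sum>i\<in>S. (z \<bullet> i) * (G x \<bullet> i))\<bar> \<le> (\<Sum>i\<in>S. e * \<bar>z \<bullet> i\<bar>)"
    if "S \<subseteq> Basis" for S
    using finite_subset[OF that finite_Basis] that
  proof (induction S)
    case (insert i S)
    have i: "i \<in> Basis" using insert by auto
    have zS: "?z S \<bullet> b = (if b \<in> S then z \<bullet> b else 0)" if "b \<in> Basis" for b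
    proof -
      have "?z S \<bullet> b = (\<Sum>j\<in>S. if j = b then z \<bullet> b else 0)"
        unfolding inner_sum_left using insert that by (intro sum.cong) (auto simp: inner_Basis)
      then show ?thesis using insert by simp
    qed
    have "\<bar>g ((x + ?z S) + (z \<bullet> i) *\<^sub>R i) - g (x + ?z S) - (z \<bullet> i) * (G x \<bullet> i)\<bar> \<le> e * \<bar>z \<bullet> i\<bar>"
    proof (rule increment_along_vector[where h="\<lambda>y. G y \<bullet> i"])
      fix s assume "s \<in> closed_segment 0 (z \<bullet> i)"
      then have s: "\<bar>s\<bar> \<le> \<bar>z \<bullet> i\<bar>" by (auto simp: closed_segment_eq_real_ivl split: if_splits)
      have "norm (?z S + s *\<^sub>R i) \<le> norm z"
        by (rule norm_le_componentwise) (use i insert s in \<open>auto simp: inner_add_left zS inner_Basis\<close>)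
      moreover have "x - (x + ?z S + s *\<^sub>R i) = - (?z S + s *\<^sub>R i)" by simp
      ultimately have "dist x (x + ?z S + s *\<^sub>R i) \<le> norm z"
        unfolding dist_norm by (simp only: norm_minus_cancel)
      then have "dist (G x) (G (x + ?z S + s *\<^sub>R i)) \<le> e" by (rule near)
      then show "\<bar>G (x + ?z S + s *\<^sub>R i) \<bullet> i - G x \<bullet> i\<bar> \<le> e"
        using Basis_le_norm[OF i, of "G (x + ?z S + s *\<^sub>R i) - G x"]
        by (simp add: dist_norm norm_minus_commute inner_diff_left)
    qed (use der i in blast)
    then show ?case using insert by (simp add: algebra_simps)
  qed simp
  from this[of Basis] have "\<bar>g (x + z) - g x - (\<Sum>i\<in>Basis. (z \<bullet> i) * (G x \<bullet> i))\<bar> \<le> (\<Sum>i\<in>Basis. e * \<bar>z \<bullet> i\<bar>)"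
    by (simp add: euclidean_representation)
  also have "\<dots> \<le> (\<Sum>i\<in>(Basis::'a set). e * norm z)"
    using e by (intro sum_mono mult_left_mono Basis_le_norm) auto
  also have "\<dots> = real DIM('a) * e * norm z" by simp
  also have "(\<Sum>i\<in>Basis. (z \<bullet> i) * (G x \<bullet> i)) = G x \<bullet> z"
    by (subst euclidean_inner) (simp add: mult.commute)
  finally show ?thesis .
qed

lemma integrable_compact_support:
  fixes f :: "'a::euclidean_space \<Rightarrow> real"
  assumes "continuous_on UNIV f" "compact K" "\<And>x. x \<notin> K \<Longrightarrow> f x = 0"
  shows "integrable lborel f"
proof -
  have "integrable lborel (\<lambda>x. indicator K x *\<^sub>R f x)"
    by (rule borel_integrable_compact) (use assms in \<open>auto intro: continuous_on_subset\<close>)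
  also have "(\<lambda>x. indicator K x *\<^sub>R f x) = f"
    using assms(3) by (auto simp: fun_eq_iff indicator_def)
  finally show ?thesis .
qed

lemma abs_integral_le_bound_on_compact:
  fixes f :: "'a::euclidean_space \<Rightarrow> real"
  assumes "integrable lborel f" "compact K" "\<And>x. x \<notin> K \<Longrightarrow> f x = 0" "\<And>x. \<bar>f x\<bar> \<le> e"
  shows "\<bar>\<integral>x. f x \<partial>lborel\<bar> \<le> e * measure lborel K"
proof -
  have "\<bar>\<integral>x. f x \<partial>lborel\<bar> \<le> (\<integral>x. \<bar>f x\<bar> \<partial>lborel)" by (rule integral_abs_bound)
  also have "\<dots> \<le> (\<integral>x. e * indicator K x \<partial>lborel)"
  proof (rule integral_mono)
    show "integrable lborel (\<lambda>x. e * indicator K x :: real)"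
      using emeasure_bounded_finite[OF compact_imp_bounded[OF assms(2)]] borel_compact[OF assms(2)]
      by (intro integrable_mult_right integrable_real_indicator) auto
    show "\<bar>f x\<bar> \<le> e * indicator K x" for x
      using assms(3)[of x] assms(4)[of x] by (auto simp: indicator_def)
  qed (use assms(1) in auto)
  also have "\<dots> = e * measure lborel K" using assms(2) by (simp add: borel_compact)
  finally show ?thesis .
qed

text \<open>The divergence theorem for compact support. The integral of a difference quotient
  vanishes by translation invariance, and the difference quotients converge uniformly to the
  derivative.\<close>

lemma integral_directional_derivative_eq_0:
  fixes f h :: "'a::euclidean_space \<Rightarrow> real"
  assumes der: "\<And>x. ((\<lambda>t. f (x + t *\<^sub>R v)) has_real_derivative h x) (at 0)"
    and f: "continuous_on UNIV f" and h: "continuous_on UNIV h"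
    and K: "compact K" "\<And>x. x \<notin> K \<Longrightarrow> f x = 0" "\<And>x. x \<notin> K \<Longrightarrow> h x = 0"
  shows "(\<integral>x. h x \<partial>lborel) = 0"
proof -
  define K' where "K' = {x + y |x y. x \<in> K \<and> y \<in> cball (0::'a) (norm v)}"
  have K': "compact K'" unfolding K'_def using K(1) by (intro compact_sums) auto
  have small: "\<bar>\<integral>x. h x \<partial>lborel\<bar> \<le> e * measure lborel K'" if e: "e > 0" for e
  proof -
    obtain d where d: "d > 0" "\<And>x y. dist x y < d \<Longrightarrow> dist (h x) (h y) < e"
      using compact_support_uniformly_continuous[OF h K(1,3) e] by metis
    define t where "t = min 1 (d / (2 * (norm v + 1)))"
    have nv: "0 < norm v + 1" using norm_ge_zero[of v] by linarith
    then have t: "0 < t" "t \<le> 1" using d(1) by (simp_all add: t_def)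
    have "t * norm v < d"
    proof -
      have "t * norm v \<le> d / (2 * (norm v + 1)) * norm v" by (intro mult_right_mono) (auto simp: t_def)
      also have "\<dots> \<le> d / (2 * (norm v + 1)) * (norm v + 1)" using d(1) nv by (intro mult_left_mono) auto
      also have "\<dots> = d / 2" using nv by (simp add: field_simps)
      also have "\<dots> < d" using d(1) by simp
      finally show ?thesis .
    qed
    have shift: "integrable lborel (\<lambda>x. f (x + t *\<^sub>R v))" "(\<integral>x. f (x + t *\<^sub>R v) \<partial>lborel) = (\<integral>x. f x \<partial>lborel)"
    proof -
      have m: "f \<in> borel_measurable borel" using f by (rule borel_measurable_continuous_onI)
      have I: "integrable (distr lborel borel ((+) (t *\<^sub>R v))) f"
        using integrable_compact_support[OF f K(1,2)] by (simp add: lborel_distr_plus)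
      show "integrable lborel (\<lambda>x. f (x + t *\<^sub>R v))"
        using integrable_distr[OF _ I] by (simp add: add.commute)
      have "(\<integral>x. f x \<partial>distr lborel borel ((+) (t *\<^sub>R v))) = (\<integral>x. f (t *\<^sub>R v + x) \<partial>lborel)"
        by (rule integral_distr) (use m in auto)
      then show "(\<integral>x. f (x + t *\<^sub>R v) \<partial>lborel) = (\<integral>x. f x \<partial>lborel)"
        by (simp add: lborel_distr_plus add.commute)
    qed
    have If: "integrable lborel f" by (rule integrable_compact_support[OF f K(1,2)])
    have Ih: "integrable lborel h" by (rule integrable_compact_support[OF h K(1,3)])
    define q where "q x = h x - (f (x + t *\<^sub>R v) - f x) / t" for x
    have Iq: "integrable lborel q" unfolding q_def using shift(1) If Ih by auto
    have "(\<integral>x. q x \<partial>lborel) = (\<integral>x. h x \<partial>lborel)"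
      unfolding q_def using shift If Ih by simp
    moreover have "\<bar>\<integral>x. q x \<partial>lborel\<bar> \<le> e * measure lborel K'"
    proof (rule abs_integral_le_bound_on_compact[OF Iq K'])
      fix x assume x: "x \<notin> K'"
      have "y \<in> K'" if "y \<in> K" for y
        unfolding K'_def using that by (intro CollectI exI[of _ y] exI[of _ 0]) auto
      moreover have "x + t *\<^sub>R v \<notin> K"
      proof
        assume "x + t *\<^sub>R v \<in> K"
        then have "x \<in> K'" unfolding K'_def using t
          by (intro CollectI exI[of _ "x + t *\<^sub>R v"] exI[of _ "- (t *\<^sub>R v)"]) (auto intro: mult_left_le_one_le)
        then show False using x by simp
      qed
      ultimately have "x \<notin> K" "x + t *\<^sub>R v \<notin> K" using x by blast+
      then show "q x = 0" by (simp add: q_def K)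
    next
      fix x
      have "\<bar>f (x + t *\<^sub>R v) - f x - t * h x\<bar> \<le> e * \<bar>t\<bar>"
      proof (rule increment_along_vector[OF der])
        fix s assume "s \<in> closed_segment 0 t"
        then have "0 \<le> s" "s \<le> t" using t by (auto simp: closed_segment_eq_real_ivl)
        then have "s * norm v \<le> t * norm v" by (intro mult_right_mono) auto
        then have "dist (x + s *\<^sub>R v) x < d" using \<open>t * norm v < d\<close> \<open>0 \<le> s\<close> by (simp add: dist_norm)
        then show "\<bar>h (x + s *\<^sub>R v) - h x\<bar> \<le> e" using d(2) by (fastforce simp: dist_real_def)
      qed
      moreover have "q x = - (f (x + t *\<^sub>R v) - f x - t * h x) / t"
        using t by (simp add: q_def field_simps)
      ultimately show "\<bar>q x\<bar> \<le> e" using t by (simp add: abs_divide divide_le_eq)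
    qed
    ultimately show ?thesis by simp
  qed
  have "\<bar>\<integral>x. h x \<partial>lborel\<bar> \<le> 0 + e" if "e > 0" for e
  proof -
    have pos: "0 < measure lborel K' + 1" using measure_nonneg[of lborel K'] by linarith
    then have "\<bar>\<integral>x. h x \<partial>lborel\<bar> \<le> e / (measure lborel K' + 1) * measure lborel K'"
      using that by (intro small) simp
    also have "\<dots> \<le> e / (measure lborel K' + 1) * (measure lborel K' + 1)"
      using that pos by (intro mult_left_mono) auto
    also have "\<dots> = e" using pos by simp
    finally show ?thesis by simp
  qed
  then have "\<bar>\<integral>x. h x \<partial>lborel\<bar> \<le> 0" by (rule field_le_epsilon)
  then show ?thesis by simp
qed

text \<open>Fubini's theorem for the region below the graph of \<open>f\<close>.\<close>

lemma layer_cake: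
  fixes f :: "'a::euclidean_space \<Rightarrow> real"
  assumes f: "f \<in> borel_measurable borel" "\<And>x. 0 \<le> f x"
  shows "(\<integral>\<^sup>+x. ennreal (f x) \<partial>lborel) = (\<integral>\<^sup>+t. indicator {0..} t * emeasure lborel {x. t < f x} \<partial>lborel)"
proof -
  have [measurable]: "f \<in> borel_measurable borel" by fact
  have "(\<integral>\<^sup>+x. ennreal (f x) \<partial>lborel) = (\<integral>\<^sup>+x. (\<integral>\<^sup>+t. indicator {0..<f x} t \<partial>lborel) \<partial>lborel)"
    using f(2) by (simp)
  also have "\<dots> = (\<integral>\<^sup>+x. (\<integral>\<^sup>+t. indicator {0..} t * indicator {x. t < f x} x \<partial>lborel) \<partial>lborel)"
    by (intro nn_integral_cong) (auto simp: indicator_def)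
  also have "\<dots> = (\<integral>\<^sup>+t. (\<integral>\<^sup>+x. indicator {0..} t * indicator {x. t < f x} x \<partial>lborel) \<partial>lborel)"
    by (rule lborel_pair.Fubini') (simp add: indicator_def)
  also have "\<dots> = (\<integral>\<^sup>+t. indicator {0..} t * emeasure lborel {x. t < f x} \<partial>lborel)"
    by (intro nn_integral_cong) (simp add: nn_integral_cmult)
  finally show ?thesis .
qed

text \<open>The functional isoperimetric inequality, for a function that reaches the height
  \<open>a\<close> on a set of positive size. Enlarging \<open>{g > t}\<close> by a ball of radius
  \<open>r\<close> stays inside \<open>{k > t}\<close> with \<open>k = g + r (|\<nabla>g| +
  \<eta>)\<close>. Each of these enlargements gains at least the isoperimetric term of the smallest
  level set; integration over \<open>t\<close> turns this into a bound on the integral of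
  \<open>|\<nabla>g|\<close>.\<close>

theorem isoperimetric_top_level:
  fixes g :: "'a::euclidean_space \<Rightarrow> real" and G :: "'a \<Rightarrow> 'a"
  assumes der: "\<And>x i. i \<in> Basis \<Longrightarrow> ((\<lambda>t. g (x + t *\<^sub>R i)) has_real_derivative G x \<bullet> i) (at 0)"
    and g: "continuous_on UNIV g" and G: "continuous_on UNIV G"
    and K: "compact K" "\<And>x. x \<notin> K \<Longrightarrow> g x = 0" "\<And>x. x \<notin> K \<Longrightarrow> G x = 0"
    and range: "\<And>x. 0 \<le> g x" "\<And>x. g x \<le> a" "0 < a" and top: "g z = a"
  shows "a * (real DIM('a) * root DIM('a) (unit_ball_vol DIM('a)) *
           root DIM('a) (measure lebesgue {x. g x = a}) ^ (DIM('a) - 1)) \<le> (\<integral>x. norm (G x) \<partial>lborel)"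
proof -
  define E where "E = {x. g x = a}"
  define c where "c = real DIM('a) * root DIM('a) (unit_ball_vol DIM('a)) * root DIM('a) (measure lebesgue E) ^ (DIM('a) - 1)"
  have c: "0 \<le> c" by (simp add: c_def unit_ball_vol_nonneg)
  \<comment> \<open>a compact set that contains all enlargements of the support by radii up to \<open>1\<close>\<close>
  define K' where "K' = {x + y |x y. x \<in> K \<and> y \<in> cball (0::'a) 1}"
  have K': "compact K'" unfolding K'_def using K(1) by (intro compact_sums) auto
  have KK': "x \<in> K'" if "y \<in> K" "norm (x - y) \<le> 1" for x y
    unfolding K'_def using that by (intro CollectI exI[of _ y] exI[of _ "x - y"]) auto
  have Ig: "integrable lborel g" by (rule integrable_compact_support[OF g K(1,2)])
  have IG: "integrable lborel (\<lambda>x. norm (G x))"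
    by (rule integrable_compact_support[OF continuous_on_norm[OF G] K(1)]) (simp add: K)
  have IK: "integrable lborel (indicat_real K')"
    using emeasure_bounded_finite[OF compact_imp_bounded[OF K']] borel_compact[OF K']
    by (intro integrable_real_indicator) auto
  have step: "a * c \<le> (\<integral>x. norm (G x) \<partial>lborel) + \<eta> * measure lborel K'" if \<eta>: "\<eta> > 0" for \<eta>
  proof -
    have "\<eta> / DIM('a) > 0" using \<eta> by simp
    then obtain d where d: "d > 0" "\<And>x y. dist x y < d \<Longrightarrow> dist (G x) (G y) < \<eta> / DIM('a)"
      using compact_support_uniformly_continuous[OF G K(1,3)] by metis
    define r where "r = min (d / 2) 1"
    have r: "0 < r" "r \<le> 1" "r < d" using d(1) by (auto simp: r_def)
    define k where "k x = g x + (r * norm (G x) + r * \<eta> * indicator K' x)" for x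
    have mg[measurable]: "g \<in> borel_measurable borel" by (rule borel_measurable_continuous_onI[OF g])
    have mG: "(\<lambda>x. norm (G x)) \<in> borel_measurable borel"
      by (intro borel_measurable_continuous_onI continuous_on_norm G)
    have mk: "k \<in> borel_measurable borel"
      unfolding k_def using mg mG borel_compact[OF K'] by measurable
    have k0: "0 \<le> k x" for x unfolding k_def using range(1)[of x] r \<eta> by (auto simp: indicator_def)
    have kout: "k x = 0" if "x \<notin> K'" for x
    proof -
      have "x \<notin> K" using KK'[of x x] that by auto
      then show ?thesis using that by (simp add: k_def K)
    qed
    have dominates: "{x. t < g x} + ball 0 r \<subseteq> {x. t < k x}" if "0 \<le> t" for t
    proof
      fix x assume "x \<in> {x. t < g x} + ball 0 r"
      then obtain y z where yz: "x = y + z" "t < g y" "norm z < r" by (auto elim: set_plus_elim)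
      have "y \<in> K" using yz(2) K(2)[of y] that by (cases "y \<in> K") auto
      then have "x \<in> K'" using KK'[of y x] yz r by auto
      have "\<bar>g (x + - z) - g x - G x \<bullet> (- z)\<bar> \<le> real DIM('a) * (\<eta> / DIM('a)) * norm (- z)"
        by (rule increment_near_gradient[OF der]) (use yz r d in \<open>auto intro!: less_imp_le d(2)\<close>)
      then have "g y \<le> g x + G x \<bullet> (- z) + \<eta> * norm z" by (simp add: yz)
      also have "\<dots> \<le> g x + norm (G x) * norm (- z) + \<eta> * norm z"
        by (intro add_mono norm_cauchy_schwarz order_refl)
      also have "\<dots> \<le> g x + norm (G x) * r + \<eta> * r"
        using yz \<eta> by (intro add_mono mult_left_mono) auto
      also have "\<dots> = k x" using \<open>x \<in> K'\<close> by (simp add: k_def algebra_simps)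
      finally show "x \<in> {x. t < k x}" using yz by auto
    qed
    have level: "emeasure lborel {x. t < g x} + ennreal (r * c) \<le> emeasure lborel {x. t < k x}"
      if t: "0 \<le> t" "t < a" for t
    proof -
      define A where "A = {x. t < g x}"
      have oA: "open A" unfolding A_def using g by (intro open_Collect_less) (auto simp: continuous_on_const)
      have "A \<subseteq> K" unfolding A_def using K(2) t by (force simp: not_less)
      then have bA: "bounded A" using K(1) by (meson bounded_subset compact_imp_bounded)
      have EA: "E \<subseteq> A" unfolding E_def A_def using t by auto
      then have neA: "A \<noteq> {}" using top by (auto simp: E_def)
      have mE: "E \<in> sets lebesgue"
      proof -
        have "closed E" unfolding E_def using g by (intro closed_Collect_eq) auto
        then show ?thesis by (intro sets_completionI_sets) simp
      qed
      have mA: "A \<in> lmeasurable" by (rule lmeasurable_open[OF bA oA])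
      have "measure lebesgue A + r * c \<le> measure lebesgue A + r * (real DIM('a) * root DIM('a) (unit_ball_vol DIM('a)) *
           root DIM('a) (measure lebesgue A) ^ (DIM('a) - 1))"
        unfolding c_def using r(1) EA mE mA
        by (intro add_left_mono mult_left_mono power_mono iffD2[OF real_root_le_iff] measure_mono_fmeasurable)
           (auto simp: unit_ball_vol_nonneg)
      also have "\<dots> \<le> measure lebesgue (A + ball 0 r)"
        by (rule measure_enlarge_ball[OF oA bA neA r(1)])
      finally have "ennreal (measure lebesgue A + r * c) \<le> ennreal (measure lebesgue (A + ball 0 r))"
        by (rule ennreal_leI)
      also have "ennreal (measure lebesgue A + r * c) = emeasure lborel A + ennreal (r * c)"
      proof -
        have "emeasure lborel A \<noteq> \<infinity>" using emeasure_bounded_finite[OF bA] by auto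
        then have "emeasure lborel A = ennreal (measure lborel A)" by (simp add: emeasure_eq_ennreal_measure)
        then show ?thesis using oA r c by (simp add: ennreal_plus)
      qed
      also have "ennreal (measure lebesgue (A + ball 0 r)) = emeasure lborel (A + ball 0 r)"
      proof -
        have o: "open (A + ball 0 r)" by (rule open_sums_set_plus[OF oA])
        have b: "bounded (A + ball 0 r)" by (rule bounded_set_plus[OF bA bounded_ball])
        have "emeasure lborel (A + ball 0 r) \<noteq> \<infinity>" using emeasure_bounded_finite[OF b] by auto
        then have "emeasure lborel (A + ball 0 r) = ennreal (measure lborel (A + ball 0 r))"
          by (simp add: emeasure_eq_ennreal_measure)
        then show ?thesis using o by simp
      qed
      also have "\<dots> \<le> emeasure lborel {x. t < k x}"
        using dominates[OF t(1)] mk by (intro emeasure_mono) (auto simp: A_def)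
      finally show ?thesis unfolding A_def .
    qed
    have "(\<integral>\<^sup>+x. ennreal (g x) \<partial>lborel) + ennreal (a * (r * c))
        = (\<integral>\<^sup>+t. indicator {0..} t * emeasure lborel {x. t < g x} \<partial>lborel) + (\<integral>\<^sup>+t. ennreal (r * c) * indicator {0..<a} t \<partial>lborel)"
      using r c range(3) by (subst layer_cake[OF mg range(1)]) (simp add: nn_integral_cmult_indicator ennreal_mult[symmetric] algebra_simps)
    also have "\<dots> = (\<integral>\<^sup>+t. indicator {0..} t * emeasure lborel {x. t < g x} + ennreal (r * c) * indicator {0..<a} t \<partial>lborel)"
    proof (rule nn_integral_add[symmetric])
      show "(\<lambda>t. indicator {0..} t * emeasure lborel {x. t < g x}) \<in> borel_measurable lborel" by measurable
      show "(\<lambda>t. ennreal (r * c) * indicator {0..<a} t) \<in> borel_measurable lborel"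
        by (intro borel_measurable_times_ennreal borel_measurable_indicator) auto
    qed
    also have "\<dots> \<le> (\<integral>\<^sup>+t. indicator {0..} t * emeasure lborel {x. t < k x} \<partial>lborel)"
    proof (rule nn_integral_mono)
      fix t :: real
      have "{x. t < g x} = {}" if "a \<le> t" using order_trans[OF range(2) that] by (auto simp: not_less)
      then show "indicator {0..} t * emeasure lborel {x. t < g x} + ennreal (r * c) * indicator {0..<a} t
          \<le> indicator {0..} t * emeasure lborel {x. t < k x}"
        using level[of t] by (cases "a \<le> t") (auto simp: indicator_def)
    qed
    also have "\<dots> = (\<integral>\<^sup>+x. ennreal (k x) \<partial>lborel)"
      by (rule layer_cake[OF mk k0, symmetric])
    also have "(\<integral>\<^sup>+x. ennreal (g x) \<partial>lborel) = ennreal (\<integral>x. g x \<partial>lborel)"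
      by (rule nn_integral_eq_integral[OF Ig]) (use range in auto)
    also have "(\<integral>\<^sup>+x. ennreal (k x) \<partial>lborel) = ennreal (\<integral>x. k x \<partial>lborel)"
      by (rule nn_integral_eq_integral) (use k0 Ig IG IK in \<open>auto simp: k_def\<close>)
    also have "(\<integral>x. k x \<partial>lborel) = (\<integral>x. g x \<partial>lborel) + (r * (\<integral>x. norm (G x) \<partial>lborel) + r * \<eta> * measure lborel K')"
      unfolding k_def using Ig IG IK by simp
    finally have *: "ennreal (\<integral>x. g x \<partial>lborel) + ennreal (a * (r * c)) \<le>
       ennreal ((\<integral>x. g x \<partial>lborel) + (r * (\<integral>x. norm (G x) \<partial>lborel) + r * \<eta> * measure lborel K'))" .
    have g0: "0 \<le> (\<integral>x. g x \<partial>lborel)" "0 \<le> (\<integral>x. norm (G x) \<partial>lborel)" using range by auto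
    have "(\<integral>x. g x \<partial>lborel) + a * (r * c) \<le> (\<integral>x. g x \<partial>lborel) + (r * (\<integral>x. norm (G x) \<partial>lborel) + r * \<eta> * measure lborel K')"
      using * g0 r c range(3) \<eta> by (simp add: ennreal_plus[symmetric] del: ennreal_plus)
    then have "r * (a * c) \<le> r * ((\<integral>x. norm (G x) \<partial>lborel) + \<eta> * measure lborel K')"
      by (simp add: algebra_simps)
    then show ?thesis using r(1) by simp
  qed
  have pos: "0 < measure lborel K' + 1" using measure_nonneg[of lborel K'] by linarith
  have "a * c \<le> (\<integral>x. norm (G x) \<partial>lborel) + e" if "e > 0" for e
  proof -
    have "a * c \<le> (\<integral>x. norm (G x) \<partial>lborel) + e / (measure lborel K' + 1) * measure lborel K'"
      using that pos by (intro step) simp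
    also have "\<dots> \<le> (\<integral>x. norm (G x) \<partial>lborel) + e / (measure lborel K' + 1) * (measure lborel K' + 1)"
      using that pos by (intro add_left_mono mult_left_mono) auto
    also have "\<dots> = (\<integral>x. norm (G x) \<partial>lborel) + e" using pos by simp
    finally show ?thesis .
  qed
  then have "a * c \<le> (\<integral>x. norm (G x) \<partial>lborel)" by (rule field_le_epsilon)
  then show ?thesis by (simp add: c_def E_def)
qed

section \<open>Talenti's inequality on a superlevel component\<close>

lemma DERIV_half_square_pos_part: "((\<lambda>t. (max 0 t)\<^sup>2 / 2) has_real_derivative max 0 t) (at (t::real))"
proof -
  consider "t > 0" | "t < 0" | "t = 0" by linarith
  then show ?thesis
  proof cases
    case 1
    have "((\<lambda>t. t\<^sup>2 / 2) has_real_derivative t) (at t)" by (auto intro!: derivative_eq_intros)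
    then have "((\<lambda>t. (max 0 t)\<^sup>2 / 2) has_real_derivative t) (at t)"
      by (rule has_field_derivative_transform_within_open[where S="{0<..}"]) (use 1 in auto)
    then show ?thesis using 1 by simp
  next
    case 2
    have "((\<lambda>t. 0) has_real_derivative 0) (at t)" by simp
    then have "((\<lambda>t. (max 0 t)\<^sup>2 / 2) has_real_derivative 0) (at t)"
      by (rule has_field_derivative_transform_within_open[where S="{..<0}"]) (use 2 in auto)
    then show ?thesis using 2 by simp
  next
    case 3
    have "((\<lambda>h. (max 0 h)\<^sup>2 / 2 / h) \<longlongrightarrow> 0) (at (0::real))"
    proof (rule Lim_null_comparison)
      show "\<forall>\<^sub>F h in at 0. norm ((max 0 h)\<^sup>2 / 2 / h) \<le> \<bar>h\<bar>"
        by (intro always_eventually allI) (auto simp: max_def power2_eq_square)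
      show "((\<lambda>h. \<bar>h\<bar>) \<longlongrightarrow> 0) (at (0::real))" by (intro tendsto_rabs_zero tendsto_ident_at)
    qed
    then show ?thesis using 3 by (simp add: DERIV_def)
  qed
qed

text \<open>A \<open>C\<^sup>1\<close> approximation of \<open>min (max (y - s) 0) (t - s)\<close>
  whose derivative is a trapezoid. The Cauchy-Schwarz step of Talenti's inequality loses nothing
  only if the derivative is close to an indicator function, so the width \<open>e\<close> of the
  ramps tends to \<open>0\<close> at the end.\<close>

lemma smooth_truncation:
  fixes s t e :: real
  assumes "s < t" "0 < e" "e < t - s"
  shows "\<exists>\<psi> w. (\<forall>y. (\<psi> has_real_derivative w y) (at y)) \<and> continuous_on UNIV w \<and> (\<forall>y. 0 \<le> w y \<and> w y \<le> 1)
    \<and> (\<forall>y\<le>s. \<psi> y = 0 \<and> w y = 0) \<and> (\<forall>y\<ge>t. \<psi> y = t - s - e \<and> w y = 0) \<and> (\<forall>y. 0 \<le> \<psi> y \<and> \<psi> y \<le> t - s - e)"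
proof -
  define Q where "Q t = (max 0 t)\<^sup>2 / 2" for t :: real
  define \<psi> where "\<psi> y = (Q (y + - s) - Q (y + (- s - e)) - Q (y + (e - t)) + Q (y + - t)) / e" for y
  define w where "w y = (max 0 (y + - s) - max 0 (y + (- s - e)) - max 0 (y + (e - t)) + max 0 (y + - t)) / e" for y
  have Q': "((\<lambda>y. Q (y + c)) has_real_derivative max 0 (y + c)) (at y)" for y c
    using DERIV_half_square_pos_part[of "y + c"] unfolding Q_def DERIV_shift .
  have der: "(\<psi> has_real_derivative w y) (at y)" for y
    unfolding \<psi>_def w_def by (intro DERIV_cdivide DERIV_add DERIV_diff Q')
  have w01: "0 \<le> w y \<and> w y \<le> 1" for y
    using assms by (auto simp: w_def max_def divide_simps)
  have low: "\<psi> y = 0 \<and> w y = 0" if "y \<le> s" for y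
    using assms that by (auto simp: w_def \<psi>_def Q_def max_def)
  have high: "\<psi> y = t - s - e \<and> w y = 0" if "y \<ge> t" for y
  proof -
    have m: "max 0 (y + - s) = y - s" "max 0 (y + (- s - e)) = y - s - e" "max 0 (y + (e - t)) = y + e - t"
      "max 0 (y + - t) = y - t" using assms that by auto
    have "\<psi> y = (((y - s)\<^sup>2 - (y - s - e)\<^sup>2 - (y + e - t)\<^sup>2 + (y - t)\<^sup>2) / 2) / e"
      unfolding \<psi>_def Q_def m by (simp add: add_divide_distrib diff_divide_distrib)
    also have "((y - s)\<^sup>2 - (y - s - e)\<^sup>2 - (y + e - t)\<^sup>2 + (y - t)\<^sup>2) / 2 = (t - s - e) * e"
      by (simp add: power2_eq_square field_simps)
    finally show ?thesis using assms(2) unfolding w_def m by simp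
  qed
  have mono: "\<psi> x \<le> \<psi> y" if "x \<le> y" for x y
    using that der w01 by (intro DERIV_nonneg_imp_nondecreasing[OF that]) blast
  have "0 \<le> \<psi> y \<and> \<psi> y \<le> t - s - e" for y
    using mono[of s y] mono[of y t] low[of y] low[of s] high[of y] high[of t] by (cases "s \<le> y"; cases "y \<le> t") auto
  moreover have "continuous_on UNIV w" unfolding w_def by (intro continuous_intros) (use assms in auto)
  ultimately show ?thesis using der w01 low high by (intro exI[of _ \<psi>] exI[of _ w]) auto
qed

definition zero_extension :: "'a set \<Rightarrow> ('a \<Rightarrow> 'b::zero) \<Rightarrow> 'a \<Rightarrow> 'b" where
  "zero_extension C f x = (if x \<in> C then f x else 0)"

lemma continuous_zero_extension:
  fixes f :: "'a::t2_space \<Rightarrow> 'b::real_normed_vector"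
  assumes "open C" "compact K" "K \<subseteq> C" "continuous_on C f" "\<And>x. x \<in> C - K \<Longrightarrow> f x = 0"
  shows "continuous_on UNIV (zero_extension C f)"
proof -
  have 1: "continuous_on C (zero_extension C f)"
    using assms(4) by (rule continuous_on_eq) (auto simp: zero_extension_def)
  have 2: "continuous_on (- K) (zero_extension C f)"
    by (rule continuous_on_eq[OF continuous_on_const[of _ 0]]) (use assms(5) in \<open>auto simp: zero_extension_def\<close>)
  have "continuous_on (C \<union> - K) (zero_extension C f)"
    using assms(1,2) 1 2 by (intro continuous_on_open_Un) (auto simp: compact_imp_closed open_Compl)
  moreover have "C \<union> - K = UNIV" using assms(3) by auto
  ultimately show ?thesis by simp
qed

text \<open>Outside \<open>C\<close> the extension vanishes in a neighbourhood, because the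
  complement of the compact set \<open>K\<close> is open.\<close>

lemma DERIV_zero_extension:
  fixes f h :: "'a::real_normed_vector \<Rightarrow> real"
  assumes C: "open C" "compact K" "K \<subseteq> C" "\<And>x. x \<in> C - K \<Longrightarrow> f x = 0"
    and der: "\<And>x. x \<in> C \<Longrightarrow> ((\<lambda>t. f (x + t *\<^sub>R v)) has_real_derivative h x) (at 0)"
  shows "((\<lambda>t. zero_extension C f (x + t *\<^sub>R v)) has_real_derivative zero_extension C h x) (at 0)"
proof -
  have lim: "((\<lambda>t. x + t *\<^sub>R v) \<longlongrightarrow> x) (nhds (0::real))"
  proof -
    have "((\<lambda>t. x + t *\<^sub>R v) \<longlongrightarrow> x + 0 *\<^sub>R v) (nhds (0::real))"
      by (intro tendsto_add tendsto_const tendsto_scaleR filterlim_ident)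
    then show ?thesis by simp
  qed
  show ?thesis
  proof (cases "x \<in> C")
    case True
    have "\<forall>\<^sub>F t in nhds 0. x + t *\<^sub>R v \<in> C" using topological_tendstoD[OF lim C(1) True] .
    then have "\<forall>\<^sub>F t in nhds 0. zero_extension C f (x + t *\<^sub>R v) = f (x + t *\<^sub>R v)"
      by eventually_elim (simp add: zero_extension_def)
    then have "((\<lambda>t. zero_extension C f (x + t *\<^sub>R v)) has_real_derivative h x) (at 0)"
      using der[OF True] by (subst DERIV_cong_ev[OF refl _ refl])
    then show ?thesis using True by (simp add: zero_extension_def)
  next
    case False
    have "open (- K)" using C(2) by (simp add: compact_imp_closed open_Compl)
    moreover have "x \<in> - K" using False C(3) by auto
    ultimately have "\<forall>\<^sub>F t in nhds 0. x + t *\<^sub>R v \<in> - K" using topological_tendstoD[OF lim] by blast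
    then have "\<forall>\<^sub>F t in nhds 0. zero_extension C f (x + t *\<^sub>R v) = 0"
      by eventually_elim (use C(4) in \<open>auto simp: zero_extension_def\<close>)
    then have "((\<lambda>t. zero_extension C f (x + t *\<^sub>R v)) has_real_derivative 0) (at 0)"
      by (subst DERIV_cong_ev[OF refl _ refl]) auto
    then show ?thesis using False by (simp add: zero_extension_def)
  qed
qed

lemma C1_on_DERIV:
  assumes "C1_on S f" "x \<in> S"
  shows "((\<lambda>t. f (x + t *\<^sub>R axis i 1)) has_real_derivative partial_deriv i f x) (at 0)"
  using assms unfolding C1_on_def partial_deriv_def by (simp add: field_differentiable_derivI)

lemma Basis_vec_axis: "b \<in> Basis \<Longrightarrow> \<exists>i. b = (axis i 1 :: real ^ 'n)"
  by (auto simp: Basis_vec_def)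

text \<open>The situation of a bounded component of \<open>{u > l}\<close>, with the boundary values
  that it has when the boundary data of the surrounding domain vanish. The volume and the mass of
  its superlevel sets are studied as functions of the level.\<close>

locale superlevel_component =
  fixes C :: "(real ^ 'n::finite) set" and u :: "real ^ 'n \<Rightarrow> real" and l lam :: real
  assumes C: "open C" "bounded C" "C \<noteq> {}"
    and u_closure: "continuous_on (closure C) u"
    and u_C2: "C2_on C u"
    and helmholtz: "\<And>x. x \<in> C \<Longrightarrow> laplacian u x + lam * u x = 0"
    and above: "\<And>x. x \<in> C \<Longrightarrow> u x > l"
    and boundary: "\<And>x. x \<in> frontier C \<Longrightarrow> u x = l"
    and l_nonneg: "0 \<le> l" and lam_pos: "0 < lam" and dim: "CARD('n) \<ge> 2"
begin

definition mu :: "real \<Rightarrow> real" where "mu s = measure lebesgue {x \<in> C. u x > s}"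
definition mass :: "real \<Rightarrow> real" where "mass s = (\<integral>x. indicator {x \<in> C. u x > s} x * u x \<partial>lborel)"
definition grad :: "real ^ 'n \<Rightarrow> real ^ 'n" where "grad x = (\<chi> i. partial_deriv i u x)"

lemma u_cont: "continuous_on C u"
  using u_closure closure_subset continuous_on_subset by blast

text \<open>On the frontier the function equals \<open>l < s\<close>, so the superlevel set is
  closed in space.\<close>

lemma compact_superlevel:
  assumes "l < s" shows "compact {x \<in> C. s \<le> u x}"
proof -
  have "{x \<in> C. s \<le> u x} = {x \<in> closure C. s \<le> u x}"
  proof -
    have "x \<in> C" if "x \<in> closure C" "s \<le> u x" for x
      using that boundary[of x] assms C(1) by (auto simp: frontier_def interior_open)
    then show ?thesis using closure_subset by auto
  qed
  moreover have "closed {x \<in> closure C. s \<le> u x}"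
    using continuous_closed_preimage[OF u_closure closed_closure closed_atLeast[of s]]
    by (simp add: vimage_def Int_def)
  ultimately show ?thesis
    using C(2) by (metis (no_types, lifting) bounded_subset compact_eq_bounded_closed mem_Collect_eq subsetI)
qed

lemma open_superlevel: "open {x \<in> C. s < u x}"
  using continuous_open_preimage[OF u_cont C(1) open_greaterThan[of s]]
  by (simp add: vimage_def Int_def)

lemma superlevel_lmeasurable: "{x \<in> C. s < u x} \<in> lmeasurable"
  by (rule lmeasurable_open[OF _ open_superlevel]) (use C(2) in \<open>auto intro: bounded_subset\<close>)

lemma bounded_u: "\<exists>M\<ge>0. \<forall>x\<in>C. \<bar>u x\<bar> \<le> M"
proof -
  have "compact (u ` closure C)"
    using u_closure C(2) by (intro compact_continuous_image) (auto simp: compact_closure)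
  then obtain M where "\<And>x. x \<in> closure C \<Longrightarrow> \<bar>u x\<bar> \<le> M"
    using compact_imp_bounded by (fastforce simp: bounded_iff)
  then show ?thesis using closure_subset by (intro exI[of _ "\<bar>M\<bar>"]) fastforce
qed

lemma integrable_superlevel:
  assumes "A \<in> sets borel" "A \<subseteq> C"
  shows "integrable lborel (\<lambda>x. indicator A x * u x)"
proof -
  obtain M where M: "\<And>x. x \<in> C \<Longrightarrow> \<bar>u x\<bar> \<le> M" "0 \<le> M" using bounded_u by blast
  have m: "(\<lambda>x. indicator A x * u x) \<in> borel_measurable borel"
  proof -
    have "(\<lambda>x. indicator C x *\<^sub>R u x) \<in> borel_measurable borel"
      using u_cont C(1) by (intro borel_measurable_continuous_on_indicator) auto
    then have "(\<lambda>x. indicator A x * (indicator C x *\<^sub>R u x)) \<in> borel_measurable borel"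
      using assms(1) by measurable
    also have "(\<lambda>x. indicator A x * (indicator C x *\<^sub>R u x)) = (\<lambda>x. indicator A x * u x)"
      using assms(2) by (auto simp: fun_eq_iff indicator_def)
    finally show ?thesis .
  qed
  have "bounded A" using assms C(2) bounded_subset by blast
  then have "integrable lborel (\<lambda>x. M * indicat_real A x)"
    using assms(1) emeasure_bounded_finite[of A] by (intro integrable_mult_right integrable_real_indicator) auto
  then show ?thesis
    by (rule Bochner_Integration.integrable_bound) (use m M assms in \<open>auto simp: indicator_def\<close>)
qed

lemma grad_cont: "continuous_on C grad"
  using u_C2 unfolding grad_def C2_on_def C1_on_def
  by (intro continuous_on_vec_lambda) blast

lemma truncation_calculus:
  assumes s: "l < s"
    and \<psi>: "\<And>y. (\<psi> has_real_derivative w y) (at y)" "continuous_on UNIV w" "\<forall>y\<le>s. \<psi> y = 0 \<and> w y = 0"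
  defines "K \<equiv> {x \<in> C. s \<le> u x}"
  shows "compact K" "K \<subseteq> C" "continuous_on C (\<lambda>x. \<psi> (u x))" "continuous_on C (\<lambda>x. w (u x))"
    "\<And>x. x \<in> C - K \<Longrightarrow> \<psi> (u x) = 0" "\<And>x. x \<in> C - K \<Longrightarrow> w (u x) = 0"
    "\<And>x i. x \<in> C \<Longrightarrow> ((\<lambda>t. \<psi> (u (x + t *\<^sub>R axis i 1))) has_real_derivative w (u x) * partial_deriv i u x) (at 0)"
proof -
  show "compact K" "K \<subseteq> C" using compact_superlevel[OF s] by (auto simp: K_def)
  have "continuous_on UNIV \<psi>" using \<psi>(1) by (meson DERIV_isCont continuous_at_imp_continuous_on)
  then show "continuous_on C (\<lambda>x. \<psi> (u x))" "continuous_on C (\<lambda>x. w (u x))"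
    using continuous_on_compose2[OF _ u_cont] \<psi>(2) by blast+
  show "\<psi> (u x) = 0" "w (u x) = 0" if "x \<in> C - K" for x
    using that \<psi>(3) by (auto simp: K_def)
  show "((\<lambda>t. \<psi> (u (x + t *\<^sub>R axis i 1))) has_real_derivative w (u x) * partial_deriv i u x) (at 0)"
    if "x \<in> C" for x i
  proof -
    have "((\<lambda>t. u (x + t *\<^sub>R axis i 1)) has_real_derivative partial_deriv i u x) (at 0)"
      using u_C2 that by (intro C1_on_DERIV) (auto simp: C2_on_def)
    then show ?thesis using DERIV_chain2[of \<psi> "w (u x)" "\<lambda>t. u (x + t *\<^sub>R axis i 1)" 0] \<psi>(1)[of "u x"] by simp
  qed
qed

text \<open>The vector field \<open>\<psi>(u) \<nabla>u\<close> has compact support in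
  \<open>C\<close>, so its divergence integrates to zero; the Laplacian is replaced by \<open>- lam
  u\<close>.\<close>

lemma energy_identity:
  assumes s: "l < s"
    and \<psi>: "\<And>y. (\<psi> has_real_derivative w y) (at y)" "continuous_on UNIV w" "\<forall>y\<le>s. \<psi> y = 0 \<and> w y = 0"
  shows "(\<integral>x. zero_extension C (\<lambda>x. w (u x) * (norm (grad x))\<^sup>2) x \<partial>lborel)
       = lam * (\<integral>x. zero_extension C (\<lambda>x. u x * \<psi> (u x)) x \<partial>lborel)"
proof -
  define K where "K = {x \<in> C. s \<le> u x}"
  note tc = truncation_calculus[OF s \<psi>, folded K_def]
  define X where "X i x = \<psi> (u x) * partial_deriv i u x" for i x
  define h where "h i x = w (u x) * (partial_deriv i u x)\<^sup>2 + \<psi> (u x) * partial_deriv i (partial_deriv i u) x" for i x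
  have C1: "C1_on C u" "C1_on C (partial_deriv i u)" for i using u_C2 by (auto simp: C2_on_def)
  have pc: "continuous_on C (partial_deriv i u)" "continuous_on C (partial_deriv i (partial_deriv i u))" for i
    using C1(1) C1(2)[of i] by (auto simp: C1_on_def)
  have hc: "continuous_on C (h i)" for i
    unfolding h_def by (intro continuous_intros tc pc)
  have h0: "h i x = 0" if "x \<in> C - K" for i x using tc(5,6)[OF that] by (simp add: h_def)
  have hext: "continuous_on UNIV (zero_extension C (h i))" for i
    by (rule continuous_zero_extension[OF C(1) tc(1,2) hc h0])
  have supp: "zero_extension C f x = 0" if "\<And>x. x \<in> C - K \<Longrightarrow> f x = 0" "x \<notin> K" for f :: "real ^ 'n \<Rightarrow> real" and x
    using that by (auto simp: zero_extension_def)
  have int0: "(\<integral>x. zero_extension C (h i) x \<partial>lborel) = 0" for i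
  proof (rule integral_directional_derivative_eq_0[where f="zero_extension C (X i)" and v="axis i 1" and K=K])
    show "((\<lambda>t. zero_extension C (X i) (x + t *\<^sub>R axis i 1)) has_real_derivative zero_extension C (h i) x) (at 0)" for x
    proof (rule DERIV_zero_extension[OF C(1) tc(1,2)])
      show "X i x = 0" if "x \<in> C - K" for x using tc(5)[OF that] by (simp add: X_def)
      show "((\<lambda>t. X i (x + t *\<^sub>R axis i 1)) has_real_derivative h i x) (at 0)" if "x \<in> C" for x
        using DERIV_mult[OF tc(7)[OF that, of i] C1_on_DERIV[OF C1(2)[of i] that, of i]]
        by (simp add: X_def h_def power2_eq_square algebra_simps)
    qed
    show "continuous_on UNIV (zero_extension C (X i))"
    proof (rule continuous_zero_extension[OF C(1) tc(1,2)])
      show "continuous_on C (X i)" unfolding X_def by (intro continuous_intros tc pc)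
    qed (simp add: X_def tc(5))
    show "zero_extension C (X i) x = 0" if "x \<notin> K" for x
      by (rule supp[OF _ that]) (simp add: X_def tc(5))
    show "zero_extension C (h i) x = 0" if "x \<notin> K" for x
      by (rule supp[OF h0 that])
  qed (use hext tc(1) in auto)
  have Ih: "integrable lborel (zero_extension C (h i))" for i
    by (rule integrable_compact_support[OF hext tc(1) supp[OF h0]])
  have I2: "integrable lborel (zero_extension C (\<lambda>x. u x * \<psi> (u x)))"
  proof (rule integrable_compact_support[OF continuous_zero_extension[OF C(1) tc(1,2)] tc(1) supp])
    show "continuous_on C (\<lambda>x. u x * \<psi> (u x))" by (intro continuous_intros tc u_cont)
  qed (simp_all add: tc(5))
  have "zero_extension C (\<lambda>x. w (u x) * (norm (grad x))\<^sup>2) x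
      = (\<Sum>i\<in>UNIV. zero_extension C (h i) x) + lam * zero_extension C (\<lambda>x. u x * \<psi> (u x)) x" for x
  proof (cases "x \<in> C")
    case True
    have "(norm (grad x))\<^sup>2 = (\<Sum>i\<in>UNIV. (partial_deriv i u x)\<^sup>2)"
      unfolding norm_vec_def L2_set_def grad_def by (simp add: sum_nonneg)
    moreover have "(\<Sum>i\<in>UNIV. partial_deriv i (partial_deriv i u) x) = - (lam * u x)"
      using helmholtz[OF True] by (simp add: laplacian_def)
    ultimately show ?thesis using True
      by (simp add: zero_extension_def h_def sum.distrib sum_distrib_left[symmetric])
  qed (simp add: zero_extension_def)
  then have "(\<integral>x. zero_extension C (\<lambda>x. w (u x) * (norm (grad x))\<^sup>2) x \<partial>lborel)
     = (\<integral>x. (\<Sum>i\<in>UNIV. zero_extension C (h i) x) + lam * zero_extension C (\<lambda>x. u x * \<psi> (u x)) x \<partial>lborel)"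
    by simp
  also have "\<dots> = (\<Sum>i\<in>UNIV. \<integral>x. zero_extension C (h i) x \<partial>lborel) + lam * (\<integral>x. zero_extension C (\<lambda>x. u x * \<psi> (u x)) x \<partial>lborel)"
    using Ih I2 by simp
  finally show ?thesis by (simp add: int0)
qed

lemma truncation_isoperimetric:
  assumes s: "l < s"
    and \<psi>: "\<And>y. (\<psi> has_real_derivative w y) (at y)" "continuous_on UNIV w" "\<forall>y\<le>s. \<psi> y = 0 \<and> w y = 0"
      "\<And>y. 0 \<le> \<psi> y" "\<And>y. \<psi> y \<le> a" "\<And>y. 0 \<le> w y"
    and a: "0 < a" "\<And>y. y \<ge> t \<Longrightarrow> \<psi> y = a" and ne: "z \<in> C" "t < u z"
  shows "a * (real CARD('n) * root CARD('n) (unit_ball_vol CARD('n)) * root CARD('n) (mu t) ^ (CARD('n) - 1))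
      \<le> (\<integral>x. zero_extension C (\<lambda>x. w (u x) * norm (grad x)) x \<partial>lborel)"
proof -
  define K where "K = {x \<in> C. s \<le> u x}"
  note tc = truncation_calculus[OF s \<psi>(1-3), folded K_def]
  define g where "g = zero_extension C (\<lambda>x. \<psi> (u x))"
  define G where "G = zero_extension C (\<lambda>x. w (u x) *\<^sub>R grad x)"
  have gc: "continuous_on UNIV g"
    unfolding g_def by (rule continuous_zero_extension[OF C(1) tc(1-3,5)])
  have "a * (real DIM(real ^ 'n) * root DIM(real ^ 'n) (unit_ball_vol DIM(real ^ 'n)) *
     root DIM(real ^ 'n) (measure lebesgue {x. g x = a}) ^ (DIM(real ^ 'n) - 1)) \<le> (\<integral>x. norm (G x) \<partial>lborel)"
  proof (rule isoperimetric_top_level[where K=K])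
    show "((\<lambda>t. g (x + t *\<^sub>R b)) has_real_derivative G x \<bullet> b) (at 0)" if b: "b \<in> Basis" for x b
    proof -
      obtain i where i: "b = axis i 1" using Basis_vec_axis[OF b] by blast
      have "((\<lambda>t. g (x + t *\<^sub>R axis i 1)) has_real_derivative zero_extension C (\<lambda>x. w (u x) * partial_deriv i u x) x) (at 0)"
        unfolding g_def by (rule DERIV_zero_extension[OF C(1) tc(1,2,5,7)])
      moreover have "G x \<bullet> axis i 1 = zero_extension C (\<lambda>x. w (u x) * partial_deriv i u x) x"
        by (simp add: G_def inner_axis zero_extension_def grad_def)
      ultimately show ?thesis by (simp only: i)
    qed
    show "continuous_on UNIV G"
      unfolding G_def
      by (rule continuous_zero_extension[OF C(1) tc(1,2)]) (auto intro!: continuous_intros tc grad_cont simp: tc(6))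
    show "g x = 0" "G x = 0" if "x \<notin> K" for x
      using that tc(5,6) by (auto simp: g_def G_def zero_extension_def)
    show "g z = a" using ne a by (simp add: g_def zero_extension_def)
    show "0 \<le> g x" "g x \<le> a" for x using \<psi>(4,5) a(1) by (auto simp: g_def zero_extension_def less_imp_le)
  qed (use gc tc(1) a in auto)
  moreover have "(\<integral>x. norm (G x) \<partial>lborel) = (\<integral>x. zero_extension C (\<lambda>x. w (u x) * norm (grad x)) x \<partial>lborel)"
    using \<psi>(6) by (intro Bochner_Integration.integral_cong) (auto simp: G_def zero_extension_def)
  moreover have "mu t \<le> measure lebesgue {x. g x = a}"
    unfolding mu_def
  proof (rule measure_mono_fmeasurable)
    show "{x \<in> C. t < u x} \<subseteq> {x. g x = a}" using a by (auto simp: g_def zero_extension_def)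
    have "closed {x. g x = a}" using gc by (intro closed_Collect_eq) auto
    moreover have "{x. g x = a} \<subseteq> C" using a(1) by (auto simp: g_def zero_extension_def split: if_splits)
    ultimately show "{x. g x = a} \<in> lmeasurable"
      using C(2) bounded_subset compact_eq_bounded_closed lmeasurable_compact by blast
    show "{x \<in> C. t < u x} \<in> sets lebesgue" using superlevel_lmeasurable by auto
  qed
  then have "a * (real CARD('n) * root CARD('n) (unit_ball_vol CARD('n)) * root CARD('n) (mu t) ^ (CARD('n) - 1))
    \<le> a * (real CARD('n) * root CARD('n) (unit_ball_vol CARD('n)) * root CARD('n) (measure lebesgue {x. g x = a}) ^ (CARD('n) - 1))"
    using a(1) by (intro mult_left_mono power_mono iffD2[OF real_root_le_iff]) (auto simp: unit_ball_vol_nonneg mu_def)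
  ultimately show ?thesis by simp
qed

text \<open>For the truncation of \<open>u\<close> between the levels \<open>s\<close> and \<open>s
  + \<delta>\<close> the isoperimetric inequality bounds the integral of the gradient from below;
  Cauchy-Schwarz bounds it from above by the volume \<open>\<mu> s - \<mu> (s + \<delta>)\<close> of
  the layer and the energy, which is at most \<open>lam \<delta> mass s\<close>.\<close>

lemma talenti_inequality:
  assumes s: "l < s" and \<delta>: "0 < \<delta>"
  shows "\<delta> * (real CARD('n) * root CARD('n) (unit_ball_vol CARD('n)) * root CARD('n) (mu (s + \<delta>)) ^ (CARD('n) - 1))\<^sup>2
       \<le> (mu s - mu (s + \<delta>)) * (lam * mass s)"
proof -
  define c where "c = real CARD('n) * root CARD('n) (unit_ball_vol CARD('n)) * root CARD('n) (mu (s + \<delta>)) ^ (CARD('n) - 1)"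
  have c0: "0 \<le> c" by (simp add: c_def unit_ball_vol_nonneg mu_def)
  have mu_mono: "mu (s + \<delta>) \<le> mu s"
    unfolding mu_def using \<delta> superlevel_lmeasurable
    by (intro measure_mono_fmeasurable) (auto simp: fmeasurableD)
  have mass0: "0 \<le> mass s"
    unfolding mass_def using above l_nonneg by (intro integral_nonneg_AE AE_I2) (auto simp: indicator_def less_imp_le intro: order_trans)
  have main: "(\<delta> - e)\<^sup>2 * c\<^sup>2 \<le> \<delta> * (mu s - mu (s + \<delta>)) * (lam * mass s)" if e: "0 < e" "e < \<delta>" for e
  proof (cases "\<exists>z\<in>C. s + \<delta> < u z")
    case False
    then have "{x \<in> C. s + \<delta> < u x} = {}" by auto
    then have "mu (s + \<delta>) = 0" by (simp only: mu_def measure_empty)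
    then have "c = 0" using dim by (simp add: c_def)
    then show ?thesis using mu_mono mass0 lam_pos \<delta> by simp
  next
    case True
    then obtain z where z: "z \<in> C" "s + \<delta> < u z" by blast
    obtain \<psi> w where P: "\<forall>y. (\<psi> has_real_derivative w y) (at y)" "continuous_on UNIV w" "\<forall>y. 0 \<le> w y \<and> w y \<le> 1"
      "\<forall>y\<le>s. \<psi> y = 0 \<and> w y = 0" "\<forall>y\<ge>s + \<delta>. \<psi> y = s + \<delta> - s - e \<and> w y = 0" "\<forall>y. 0 \<le> \<psi> y \<and> \<psi> y \<le> s + \<delta> - s - e"
      using smooth_truncation[of s "s + \<delta>" e] e \<delta> by force
    then have \<psi>: "\<And>y. (\<psi> has_real_derivative w y) (at y)" "continuous_on UNIV w"
      "\<And>y. 0 \<le> w y" "\<And>y. w y \<le> 1" "\<forall>y\<le>s. \<psi> y = 0 \<and> w y = 0"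
      "\<And>y. y \<ge> s + \<delta> \<Longrightarrow> \<psi> y = \<delta> - e" "\<And>y. y \<ge> s + \<delta> \<Longrightarrow> w y = 0" "\<And>y. 0 \<le> \<psi> y" "\<And>y. \<psi> y \<le> \<delta> - e"
      by simp_all
    define K where "K = {x \<in> C. s \<le> u x}"
    note tc = truncation_calculus[OF s \<psi>(1,2,5), folded K_def]
    define B where "B = (\<integral>x. zero_extension C (\<lambda>x. w (u x)) x \<partial>lborel)"
    define X where "X = (\<integral>x. zero_extension C (\<lambda>x. w (u x) * norm (grad x)) x \<partial>lborel)"
    define A where "A = (\<integral>x. zero_extension C (\<lambda>x. w (u x) * (norm (grad x))\<^sup>2) x \<partial>lborel)"
    have I: "integrable lborel (zero_extension C (\<lambda>x. w (u x) * f x))" if "continuous_on C f" for f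
      by (rule integrable_compact_support[OF continuous_zero_extension[OF C(1) tc(1,2)] tc(1)])
         (use that in \<open>auto intro!: continuous_intros tc simp: tc(6) zero_extension_def\<close>)
    have IB: "integrable lborel (zero_extension C (\<lambda>x. w (u x)))" using I[of "\<lambda>_. 1"] by simp
    have IX: "integrable lborel (zero_extension C (\<lambda>x. w (u x) * norm (grad x)))"
      by (intro I continuous_intros grad_cont)
    have IA: "integrable lborel (zero_extension C (\<lambda>x. w (u x) * (norm (grad x))\<^sup>2))"
      by (intro I continuous_intros grad_cont)
    \<comment> \<open>the Cauchy-Schwarz inequality with weight \<open>w(u)\<close>, as nonnegativity of a quadratic in \<open>k\<close>\<close>
    have quad: "0 \<le> A - 2 * k * X + k\<^sup>2 * B" for k
    proof -
      have "0 \<le> (\<integral>x. zero_extension C (\<lambda>x. w (u x) * (norm (grad x) - k)\<^sup>2) x \<partial>lborel)"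
        using \<psi>(3) by (intro integral_nonneg_AE AE_I2) (simp add: zero_extension_def)
      also have "\<dots> = (\<integral>x. zero_extension C (\<lambda>x. w (u x) * (norm (grad x))\<^sup>2) x
          - 2 * k * zero_extension C (\<lambda>x. w (u x) * norm (grad x)) x + k\<^sup>2 * zero_extension C (\<lambda>x. w (u x)) x \<partial>lborel)"
        by (intro Bochner_Integration.integral_cong) (auto simp: zero_extension_def power2_eq_square algebra_simps)
      also have "\<dots> = A - 2 * k * X + k\<^sup>2 * B"
        using IA IX IB by (simp add: A_def X_def B_def)
      finally show ?thesis .
    qed
    have lower: "(\<delta> - e) * c \<le> X"
      unfolding c_def X_def
      by (rule truncation_isoperimetric[OF s \<psi>(1,2,5,8,9,3)]) (use e z \<psi>(6) in auto)
    have X0: "0 \<le> X" using mult_nonneg_nonneg[of "\<delta> - e" c] lower e c0 by linarith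
    have IS: "integrable lborel (indicat_real {x \<in> C. s < u x})" "integrable lborel (indicat_real {x \<in> C. s + \<delta> < u x})"
      using C(2) by (auto intro!: integrable_real_indicator borel_open open_superlevel emeasure_bounded_finite[simplified] intro: bounded_subset)
    have B: "B \<le> mu s - mu (s + \<delta>)"
    proof -
      have "B \<le> (\<integral>x. indicat_real {x \<in> C. s < u x} x - indicat_real {x \<in> C. s + \<delta> < u x} x \<partial>lborel)"
        unfolding B_def
      proof (rule integral_mono[OF IB])
        show "zero_extension C (\<lambda>x. w (u x)) x \<le> indicat_real {x \<in> C. s < u x} x - indicat_real {x \<in> C. s + \<delta> < u x} x" for x
          using \<psi>(4)[of "u x"] \<psi>(5) \<psi>(7)[of "u x"] \<delta> by (auto simp: zero_extension_def indicator_def)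
      qed (use IS in auto)
      also have "\<dots> = mu s - mu (s + \<delta>)"
        using IS by (simp add: mu_def open_superlevel)
      finally show ?thesis .
    qed
    have A: "A \<le> lam * (\<delta> * mass s)"
    proof -
      have "A = lam * (\<integral>x. zero_extension C (\<lambda>x. u x * \<psi> (u x)) x \<partial>lborel)"
        unfolding A_def by (rule energy_identity[OF s \<psi>(1,2,5)])
      also have "(\<integral>x. zero_extension C (\<lambda>x. u x * \<psi> (u x)) x \<partial>lborel) \<le> (\<integral>x. \<delta> * (indicator {x \<in> C. s < u x} x * u x) \<partial>lborel)"
      proof (rule integral_mono)
        show "integrable lborel (zero_extension C (\<lambda>x. u x * \<psi> (u x)))"
          by (rule integrable_compact_support[OF continuous_zero_extension[OF C(1) tc(1,2)] tc(1)])
             (auto intro!: continuous_intros tc u_cont simp: tc(5) zero_extension_def)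
        show "integrable lborel (\<lambda>x. \<delta> * (indicator {x \<in> C. s < u x} x * u x))"
          by (intro integrable_mult_right integrable_superlevel borel_open open_superlevel) auto
        show "zero_extension C (\<lambda>x. u x * \<psi> (u x)) x \<le> \<delta> * (indicator {x \<in> C. s < u x} x * u x)" for x
        proof (cases "x \<in> C \<and> s < u x")
          case True
          have "u x * \<psi> (u x) \<le> u x * \<delta>"
            using True s l_nonneg \<psi>(9)[of "u x"] e by (intro mult_left_mono) auto
          then show ?thesis using True by (simp add: zero_extension_def mult.commute)
        next
          case False
          then show ?thesis using \<psi>(5) by (auto simp: zero_extension_def indicator_def)
        qed
      qed
      also have "\<dots> = \<delta> * mass s" by (simp add: mass_def)
      finally show ?thesis using lam_pos by simp
    qed
    have B0: "0 \<le> B" unfolding B_def using \<psi>(3) by (intro integral_nonneg_AE AE_I2) (simp add: zero_extension_def)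
    have "X\<^sup>2 \<le> A * B"
    proof (cases "B = 0")
      case True
      have "X = 0"
      proof (rule ccontr)
        assume "X \<noteq> 0"
        then have "2 * ((A + 1) / (2 * X)) * X = A + 1" by simp
        then show False using quad[of "(A + 1) / (2 * X)"] True by simp
      qed
      then show ?thesis using True by simp
    next
      case False
      have "0 \<le> A - X\<^sup>2 / B" using quad[of "X / B"] False by (simp add: power2_eq_square field_simps)
      then show ?thesis using False B0 by (simp add: field_simps)
    qed
    also have "\<dots> \<le> (lam * (\<delta> * mass s)) * (mu s - mu (s + \<delta>))"
      using A B B0 lam_pos \<delta> mass0 by (intro mult_mono) auto
    finally have "X\<^sup>2 \<le> \<delta> * (mu s - mu (s + \<delta>)) * (lam * mass s)" by (simp add: algebra_simps)
    moreover have "((\<delta> - e) * c)\<^sup>2 \<le> X\<^sup>2" using lower e c0 by (intro power_mono) auto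
    ultimately show ?thesis by (simp add: power_mult_distrib)
  qed
  have "((\<lambda>e. (\<delta> - e)\<^sup>2 * c\<^sup>2) \<longlongrightarrow> (\<delta> - 0)\<^sup>2 * c\<^sup>2) (at_right 0)"
    by (intro tendsto_intros)
  moreover have "\<forall>\<^sub>F e in at_right 0. (\<delta> - e)\<^sup>2 * c\<^sup>2 \<le> \<delta> * (mu s - mu (s + \<delta>)) * (lam * mass s)"
    using eventually_at_right_less[of 0] eventually_at_right[of 0 \<delta>] main \<delta>
    by (auto simp: eventually_at_right[of 0 \<delta>] intro!: exI[of _ \<delta>])
  ultimately have "(\<delta> - 0)\<^sup>2 * c\<^sup>2 \<le> \<delta> * (mu s - mu (s + \<delta>)) * (lam * mass s)"
    by (rule tendsto_upperbound) simp
  then have "\<delta> * (\<delta> * c\<^sup>2) \<le> \<delta> * ((mu s - mu (s + \<delta>)) * (lam * mass s))"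
    by (simp add: power2_eq_square algebra_simps)
  then show ?thesis using \<delta> by (simp add: c_def)
qed

end

section \<open>The Bessel series\<close>

text \<open>The hypergeometric series \<open>0F1(a; -z)\<close>. Compared with the Bessel function
  of order \<open>a - 1\<close> it is entire in \<open>z = x\<^sup>2/4\<close> and has the value
  \<open>1\<close> at \<open>0\<close>.\<close>

definition bessel_series :: "real \<Rightarrow> real \<Rightarrow> real" where
  "bessel_series a z = (\<Sum>k. (-1) ^ k / (fact k * pochhammer a k) * z ^ k)"

lemma bessel_series_summable:
  fixes z :: real
  assumes "a \<ge> 1"
  shows "summable (\<lambda>k. (-1) ^ k / (fact k * pochhammer a k) * z ^ k)"
proof (rule summable_comparison_test)
  have poch: "1 \<le> pochhammer a k" for k
  proof (induction k)
    case (Suc k)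
    have "1 * 1 \<le> pochhammer a k * (a + real k)" using Suc assms by (intro mult_mono) auto
    then show ?case by (simp add: pochhammer_Suc)
  qed simp
  have "norm ((-1) ^ k / (fact k * pochhammer a k) * z ^ k) \<le> inverse (fact k) * \<bar>z\<bar> ^ k" for k
  proof -
    have "inverse (pochhammer a k) \<le> 1" using poch[of k] by (simp add: inverse_le_1_iff)
    then have "\<bar>z\<bar> ^ k / fact k * inverse (pochhammer a k) \<le> \<bar>z\<bar> ^ k / fact k * 1"
      by (intro mult_left_mono) auto
    moreover have "norm ((-1) ^ k / (fact k * pochhammer a k) * z ^ k) = \<bar>z\<bar> ^ k / fact k * inverse (pochhammer a k)"
      using poch[of k] by (simp add: abs_mult power_abs divide_inverse mult_ac)
    ultimately show ?thesis by (simp add: divide_inverse mult.commute)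
  qed
  then show "\<exists>N. \<forall>k\<ge>N. norm ((-1) ^ k / (fact k * pochhammer a k) * z ^ k) \<le> inverse (fact k) * \<bar>z\<bar> ^ k"
    by blast
  show "summable (\<lambda>k. inverse (fact k) * \<bar>z\<bar> ^ k)" using summable_exp[of "\<bar>z\<bar>"] .
qed

lemma bessel_series_0 [simp]: "bessel_series a 0 = 1"
  unfolding bessel_series_def by (subst powser_zero) simp

lemma DERIV_bessel_series:
  assumes a: "a \<ge> 1"
  shows "(bessel_series a has_real_derivative - bessel_series (a + 1) z / a) (at z)"
proof -
  let ?c = "\<lambda>k. (-1) ^ k / (fact k * pochhammer a k)"
  have "((\<lambda>z. \<Sum>k. ?c k * z ^ k) has_real_derivative (\<Sum>k. diffs ?c k * z ^ k)) (at z)"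
    by (rule termdiffs_strong_converges_everywhere) (rule bessel_series_summable[OF a])
  moreover have "diffs ?c k * z ^ k = - (1 / a) * ((-1) ^ k / (fact k * pochhammer (a + 1) k) * z ^ k)" for k
  proof -
    have "real (Suc k) / (fact (Suc k) * pochhammer a (Suc k)) = 1 / (a * (fact k * pochhammer (a + 1) k))"
    proof -
      have "fact (Suc k) * pochhammer a (Suc k) = real (Suc k) * (a * (fact k * pochhammer (a + 1) k))"
        by (simp only: pochhammer_rec fact_Suc of_nat_mult of_nat_fact mult_ac)
      then show ?thesis by (simp del: of_nat_Suc)
    qed
    then have "(- 1) ^ Suc k * z ^ k * (real (Suc k) / (fact (Suc k) * pochhammer a (Suc k)))
        = (- 1) ^ Suc k * z ^ k * (1 / (a * (fact k * pochhammer (a + 1) k)))" by (simp only:)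
    then show ?thesis by (simp add: diffs_def mult_ac)
  qed
  moreover have "(\<Sum>k. - (1 / a) * ((-1) ^ k / (fact k * pochhammer (a + 1) k) * z ^ k))
      = - (1 / a) * (\<Sum>k. (-1) ^ k / (fact k * pochhammer (a + 1) k) * z ^ k)"
    by (rule suminf_mult) (rule bessel_series_summable, use a in simp)
  ultimately show ?thesis by (simp add: bessel_series_def[abs_def])
qed

lemma isCont_bessel_series: "a \<ge> 1 \<Longrightarrow> isCont (bessel_series a) z"
  using DERIV_bessel_series DERIV_isCont by blast

text \<open>The differential equation \<open>z y'' + a y' + y = 0\<close> of the series, with the
  derivatives expressed by the series for \<open>a + 1\<close> and \<open>a + 2\<close>. It holds
  because \<open>pochhammer a (k + 1)\<close> is both \<open>a pochhammer (a + 1) k\<close> and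
  \<open>pochhammer a k (a + k)\<close>.\<close>

lemma bessel_series_contiguous:
  assumes a: "a \<ge> 1"
  shows "a * (a + 1) * (bessel_series (a + 1) z - bessel_series a z) = z * bessel_series (a + 2) z"
proof -
  let ?t = "\<lambda>a k. (-1) ^ k / (fact k * pochhammer a k) * z ^ k"
  have S: "summable (?t a)" "summable (?t (a + 1))" "summable (?t (a + 2))"
    by (rule bessel_series_summable, use a in simp)+
  have coeff: "a * (a + 1) * (?t (a + 1) (Suc k) - ?t a (Suc k)) = z * ?t (a + 2) k" for k
  proof -
    have p: "pochhammer (a + 2) k > 0" using a by (intro pochhammer_pos) auto
    have e1: "pochhammer a (Suc k) = a * pochhammer (a + 1) k" by (rule pochhammer_rec)
    have e2: "pochhammer (a + 1) (Suc k) = (a + 1) * pochhammer (a + 2) k"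
      using pochhammer_rec[of "a + 1" k] by (simp add: add.assoc)
    have e3: "pochhammer (a + 1) k * (a + 1 + real k) = (a + 1) * pochhammer (a + 2) k"
      using e2 by (simp add: pochhammer_Suc)
    have p1: "pochhammer (a + 1) k > 0" using a by (intro pochhammer_pos) auto
    have ex: "a * (a + 1) * (1 / ((n * f) * (P * (a + n))) - 1 / ((n * f) * (a * P))) = - ((a + 1) / (f * (P * (a + n))))"
      if "n > 0" "f > 0" "P > 0" for n f P :: real
    proof -
      have "a + n > 0" using a that by linarith
      then have "1 / ((n * f) * (a * P)) = (a + n) / ((n * f) * (P * (a + n)) * a)"
        using a that by (simp add: mult_ac)
      moreover have "1 / ((n * f) * (P * (a + n))) = a / ((n * f) * (P * (a + n)) * a)"
        using a that by (simp add: mult_ac)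
      ultimately have "1 / ((n * f) * (P * (a + n))) - 1 / ((n * f) * (a * P)) = - n / ((n * f) * (P * (a + n)) * a)"
        by (simp only: diff_divide_distrib[symmetric]) simp
      then show ?thesis using a that \<open>a + n > 0\<close> by (simp add: mult_ac)
    qed
    have "a * (a + 1) * (1 / (fact (Suc k) * pochhammer (a + 1) (Suc k)) - 1 / (fact (Suc k) * pochhammer a (Suc k)))
       = - (1 / (fact k * pochhammer (a + 2) k))"
    proof -
      have e4: "pochhammer (a + 1) (Suc k) = pochhammer (a + 1) k * (a + real (Suc k))"
        unfolding e2 e3[symmetric] by (simp add: algebra_simps)
      have "a * (a + 1) * (1 / (fact (Suc k) * pochhammer (a + 1) (Suc k)) - 1 / (fact (Suc k) * pochhammer a (Suc k)))
        = - ((a + 1) / (fact k * pochhammer (a + 1) (Suc k)))"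
        using ex[of "real (Suc k)" "fact k" "pochhammer (a + 1) k"] p1
        unfolding e1 e4 fact_Suc by (simp del: of_nat_Suc)
      then show ?thesis unfolding e2 using a by simp
    qed
    then have "(-1) ^ Suc k * z ^ Suc k * (a * (a + 1) * (1 / (fact (Suc k) * pochhammer (a + 1) (Suc k)) - 1 / (fact (Suc k) * pochhammer a (Suc k))))
       = (-1) ^ Suc k * z ^ Suc k * (- (1 / (fact k * pochhammer (a + 2) k)))" by (simp only:)
    moreover have "a * (a + 1) * (?t (a + 1) (Suc k) - ?t a (Suc k)) =
       (-1) ^ Suc k * z ^ Suc k * (a * (a + 1) * (1 / (fact (Suc k) * pochhammer (a + 1) (Suc k)) - 1 / (fact (Suc k) * pochhammer a (Suc k))))"
    proof -
      have "A * (e / X * w - e / Y * w) = e * w * (A * (1 / X - 1 / Y))" for A e X Y w :: real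
        by (simp add: right_diff_distrib mult_ac)
      then show ?thesis .
    qed
    moreover have "(-1) ^ Suc k * z ^ Suc k * (- (1 / (fact k * pochhammer (a + 2) k))) = z * ?t (a + 2) k"
      by simp
    ultimately show ?thesis by (simp only:)
  qed
  define d where "d k = ?t (a + 1) k - ?t a k" for k
  have Sd: "summable d" unfolding d_def by (rule summable_diff[OF S(2,1)])
  have "bessel_series (a + 1) z - bessel_series a z = (\<Sum>k. d k)"
    unfolding bessel_series_def d_def by (rule suminf_diff[OF S(2,1)])
  also have "\<dots> = (\<Sum>k. d (Suc k))"
  proof -
    have "d 0 = 0" by (simp add: d_def)
    then show ?thesis using suminf_split_head[OF Sd] by (simp only: diff_0_right)
  qed
  also have "a * (a + 1) * \<dots> = (\<Sum>k. a * (a + 1) * d (Suc k))"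
    using Sd by (intro suminf_mult[symmetric]) (simp only: summable_Suc_iff)
  also have "\<dots> = (\<Sum>k. z * ?t (a + 2) k)"
    unfolding d_def coeff ..
  also have "\<dots> = z * bessel_series (a + 2) z"
    unfolding bessel_series_def by (rule suminf_mult[OF S(3)])
  finally show ?thesis .
qed

text \<open>In the variable \<open>x\<close> proportional to the volume of a ball, \<open>z = k x
  powr (1/a)\<close> is proportional to the squared radius. The first formula says that \<open>W x =
  x bessel_series (a + 1) z\<close> is the mass of the radial solution in the ball of volume
  \<open>x\<close>; the second is the equation for \<open>W''\<close>.\<close>

lemma DERIV_powr_bessel_series:
  assumes a: "a \<ge> 1" and k: "k > 0" and x: "x > 0"
  shows "((\<lambda>x. x * bessel_series (a + 1) (k * x powr (1 / a))) has_real_derivative bessel_series a (k * x powr (1 / a))) (at x)"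
    and "((\<lambda>x. bessel_series a (k * x powr (1 / a))) has_real_derivative
          - k / a\<^sup>2 * x powr (1 / a - 2) * (x * bessel_series (a + 1) (k * x powr (1 / a)))) (at x)"
proof -
  let ?z = "k * x powr (1 / a)"
  have dz: "((\<lambda>x. k * x powr (1 / a)) has_real_derivative k * (1 / a * x powr (1 / a - 1))) (at x)"
    using has_real_derivative_powr[OF x, of "1 / a"] by (rule DERIV_cmult)
  have D: "((\<lambda>x. bessel_series b (k * x powr (1 / a))) has_real_derivative
      - bessel_series (b + 1) ?z / b * (k * (1 / a * x powr (1 / a - 1)))) (at x)" if "b \<ge> 1" for b
    using DERIV_chain2[OF DERIV_bessel_series[OF that] dz] .
  have px: "x * x powr (1 / a - 1) = x powr (1 / a)" "x powr (1 / a - 2) * x = x powr (1 / a - 1)"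
    using x by (simp_all add: powr_diff powr_numeral power2_eq_square)
  have "((\<lambda>x. x * bessel_series (a + 1) (k * x powr (1 / a))) has_real_derivative
      1 * bessel_series (a + 1) ?z + - bessel_series (a + 1 + 1) ?z / (a + 1) * (k * (1 / a * x powr (1 / a - 1))) * x) (at x)"
    using a by (intro DERIV_mult DERIV_ident D) simp
  moreover have "1 * bessel_series (a + 1) ?z + - bessel_series (a + 1 + 1) ?z / (a + 1) * (k * (1 / a * x powr (1 / a - 1))) * x
      = bessel_series (a + 1) ?z - ?z * bessel_series (a + 2) ?z / (a * (a + 1))"
    using a px(1)[symmetric] by (simp add: field_simps add.assoc)
  moreover have "\<dots> = bessel_series a ?z"
    unfolding bessel_series_contiguous[OF a, symmetric] using a by simp
  ultimately show "((\<lambda>x. x * bessel_series (a + 1) (k * x powr (1 / a))) has_real_derivative bessel_series a ?z) (at x)"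
    by simp
  have "- bessel_series (a + 1) ?z / a * (k * (1 / a * x powr (1 / a - 1)))
      = - k / a\<^sup>2 * x powr (1 / a - 2) * (x * bessel_series (a + 1) ?z)"
    unfolding px(2)[symmetric] by (simp add: power2_eq_square)
  then show "((\<lambda>x. bessel_series a (k * x powr (1 / a))) has_real_derivative
          - k / a\<^sup>2 * x powr (1 / a - 2) * (x * bessel_series (a + 1) ?z)) (at x)"
    using D[OF a] by simp
qed

lemma continuous_on_bessel_series_powr:
  assumes "b \<ge> 1" "a \<ge> 1"
  shows "continuous_on {0..s} (\<lambda>x. bessel_series b (k * x powr (1 / a)))"
proof -
  have p: "continuous_on {0..s} (\<lambda>x. k * x powr (1 / a))"
    using assms by (intro continuous_on_mult continuous_on_const continuous_on_powr') (auto intro: continuous_intros)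
  have "continuous_on UNIV (bessel_series b)"
    using isCont_bessel_series[OF assms(1)] by (intro continuous_at_imp_continuous_on) auto
  then show ?thesis by (rule continuous_on_compose2[OF _ p]) auto
qed

text \<open>The derivative of \<open>x bessel_series (a + 1) (x powr (1/a))\<close> is the positive
  function \<open>bessel_series a (x powr (1/a))\<close>.\<close>

lemma bessel_series_Suc_pos:
  assumes a: "a \<ge> 1" and z: "0 < z" and pos: "\<And>y. 0 \<le> y \<Longrightarrow> y < z \<Longrightarrow> 0 < bessel_series a y"
  shows "0 < bessel_series (a + 1) z"
proof -
  let ?W = "\<lambda>x. x * bessel_series (a + 1) (1 * x powr (1 / a))"
  define s where "s = z powr a"
  have s: "0 < s" "s powr (1 / a) = z" using z a by (auto simp: s_def powr_powr)
  have "?W 0 < ?W s"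
  proof (rule DERIV_pos_imp_increasing_open[OF s(1)])
    fix x assume x: "0 < x" "x < s"
    have "x powr (1 / a) < z" using x a s(2)[symmetric] by (simp add: powr_less_mono2)
    then show "\<exists>y. DERIV ?W x :> y \<and> 0 < y"
      using DERIV_powr_bessel_series(1)[OF a zero_less_one x(1)] pos[of "x powr (1 / a)"]
      by (intro exI[of _ "bessel_series a (1 * x powr (1 / a))"]) auto
  next
    show "continuous_on {0..s} ?W"
      using a by (intro continuous_on_mult continuous_on_id continuous_on_bessel_series_powr) auto
  qed
  then show ?thesis using s by (simp add: zero_less_mult_iff)
qed

text \<open>If the series had no zero, the logarithmic derivative \<open>g\<close> of \<open>r
  \<mapsto> bessel_series a (r\<^sup>2)\<close>, with reversed sign, would satisfy the Riccati
  equation \<open>g' = 4 + g\<^sup>2 - (2a - 1) g / r\<close> on the whole half line. For \<open>r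
  \<ge> 2a\<close> this makes \<open>arctan g\<close> grow with slope at least \<open>1/2\<close>,
  which is impossible for a function bounded by \<open>pi/2\<close>.\<close>

lemma bessel_series_has_zero:
  assumes a: "a \<ge> 1"
  shows "\<exists>z>0. bessel_series a z = 0"
proof (rule ccontr)
  assume no: "\<not> ?thesis"
  have pos: "0 < bessel_series a z" if "0 \<le> z" for z
  proof (rule ccontr)
    assume "\<not> 0 < bessel_series a z"
    then have "\<exists>x\<ge>0. x \<le> z \<and> bessel_series a x = 0"
      using that a isCont_bessel_series by (intro IVT2) auto
    then show False using no by (metis bessel_series_0 le_less zero_neq_one)
  qed
  have pos1: "0 < bessel_series (a + 1) z" if "0 \<le> z" for z
    using bessel_series_Suc_pos[OF a, of z] pos that by (cases "z = 0") auto
  define p where "p r = bessel_series (a + 1) (r\<^sup>2)" for r :: real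
  define q where "q r = bessel_series a (r\<^sup>2)" for r :: real
  define g where "g r = 2 * r / a * p r / q r" for r
  have pq: "0 < p r" "0 < q r" for r unfolding p_def q_def by (auto intro: pos pos1)
  have Dp: "(p has_real_derivative - (2 * a * (p r - q r) / r)) (at r)" if "r > 0" for r
  proof -
    have D: "(p has_real_derivative - bessel_series (a + 1 + 1) (r\<^sup>2) / (a + 1) * (2 * r)) (at r)"
      unfolding p_def using a by (intro DERIV_chain2[OF DERIV_bessel_series]) (auto intro!: derivative_eq_intros)
    define d where "d = p r - q r"
    have "r\<^sup>2 * bessel_series (a + 1 + 1) (r\<^sup>2) = a * (a + 1) * d"
      using bessel_series_contiguous[OF a, of "r\<^sup>2"] by (simp add: p_def q_def d_def add.assoc)
    then have "bessel_series (a + 1 + 1) (r\<^sup>2) = a * (a + 1) * d / r\<^sup>2"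
      using that by (simp add: eq_divide_eq mult.commute)
    then have "bessel_series (a + 1 + 1) (r\<^sup>2) / (a + 1) = a * d / r\<^sup>2" using a by simp
    then have "- bessel_series (a + 1 + 1) (r\<^sup>2) / (a + 1) * (2 * r) = - (2 * a * d / r)"
      using that by (simp add: power2_eq_square)
    then show ?thesis using D unfolding d_def by (simp only:)
  qed
  have Dq: "(q has_real_derivative - p r / a * (2 * r)) (at r)" for r
    unfolding q_def p_def using a by (intro DERIV_chain2[OF DERIV_bessel_series]) (auto intro!: derivative_eq_intros)
  have Dg: "(g has_real_derivative 4 + (g r)\<^sup>2 - (2 * a - 1) * (g r / r)) (at r)" if r: "r > 0" for r
  proof -
    have "((\<lambda>r. 2 * r / a * p r / q r) has_real_derivative
       ((2 / a * p r + - (2 * a * (p r - q r) / r) * (2 * r / a)) * q r - 2 * r / a * p r * (- p r / a * (2 * r))) / (q r * q r)) (at r)"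
    proof (rule DERIV_divide[OF DERIV_mult[OF _ Dp[OF r]] Dq])
      show "((\<lambda>r. 2 * r / a) has_real_derivative 2 / a) (at r)" using a by (auto intro!: derivative_eq_intros)
    qed (use pq(2)[of r] in simp)
    moreover have "((2 / a * p r + - (2 * a * (p r - q r) / r) * (2 * r / a)) * q r - 2 * r / a * p r * (- p r / a * (2 * r))) / (q r * q r)
       = 4 + (g r)\<^sup>2 - (2 * a - 1) * (g r / r)"
    proof -
      define y where "y = p r / q r"
      have y: "p r = y * q r" using pq(2)[of r] by (simp add: y_def)
      have 1: "- (2 * a * (p r - q r) / r) * (2 * r / a) = 4 * (q r - p r)"
        using r a by simp
      have 2: "2 * r / a * p r * (- p r / a * (2 * r)) = - (2 * r / a * y)\<^sup>2 * (q r * q r)"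
        by (simp add: y power2_eq_square)
      have 3: "(2 / a * p r + 4 * (q r - p r)) * q r = (2 / a * y + 4 * (1 - y)) * (q r * q r)"
        by (simp add: y algebra_simps)
      have gy: "g r = 2 * r / a * y" by (simp add: g_def y_def)
      have "g r / r = 2 / a * y" using r by (simp add: gy)
      have 4: "(2 * a - 1) * (2 / a * y) = 4 * y - 2 / a * y"
        using a by (simp add: left_diff_distrib diff_divide_distrib)
      have "((2 / a * p r + - (2 * a * (p r - q r) / r) * (2 * r / a)) * q r - 2 * r / a * p r * (- p r / a * (2 * r)))
          = ((2 / a * y + 4 * (1 - y)) + (g r)\<^sup>2) * (q r * q r)"
        unfolding 1 2 3 gy by (simp add: ring_distribs)
      then show ?thesis
        unfolding \<open>g r / r = 2 / a * y\<close> 4 using pq(2)[of r] by simp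
    qed
    ultimately show ?thesis by (simp add: g_def[abs_def])
  qed
  have "arctan (g (2 * a)) + 5 \<le> arctan (g (2 * a + 10))"
  proof -
    have "arctan (g (2 * a)) - 1 / 2 * (2 * a) \<le> arctan (g (2 * a + 10)) - 1 / 2 * (2 * a + 10)"
    proof (rule DERIV_nonneg_imp_nondecreasing[where f="\<lambda>r. arctan (g r) - 1 / 2 * r"])
      fix r assume r: "2 * a \<le> r" "r \<le> 2 * a + 10"
      then have r0: "r > 0" using a by linarith
      have g0: "0 \<le> g r" using r0 a pq[of r] by (simp add: g_def less_imp_le)
      have "(2 * a - 1) / r * g r \<le> 1 * g r"
        using r r0 g0 by (intro mult_right_mono) auto
      then have *: "(2 * a - 1) * (g r / r) \<le> g r" by simp
      have "0 \<le> (g r - 1)\<^sup>2" by simp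
      then have sq: "2 * g r \<le> 1 + (g r)\<^sup>2" by (simp add: power2_diff)
      define b where "b = (2 * a - 1) * (g r / r)"
      have "b \<le> g r" using * by (simp only: b_def)
      moreover have "(1 + G) / 2 \<le> 4 + G - b" if "2 * x \<le> 1 + G" "b \<le> x" for x G :: real
        using that by (simp add: field_simps)
      ultimately have "(1 + (g r)\<^sup>2) / 2 \<le> 4 + (g r)\<^sup>2 - b" using sq by blast
      then have "(1 + (g r)\<^sup>2) / 2 \<le> 4 + (g r)\<^sup>2 - (2 * a - 1) * (g r / r)" by (simp only: b_def)
      moreover have "1 + (g r)\<^sup>2 > 0" by (simp add: add_pos_nonneg)
      ultimately have "1 / 2 \<le> inverse (1 + (g r)\<^sup>2) * (4 + (g r)\<^sup>2 - (2 * a - 1) * (g r / r))"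
        by (simp add: divide_simps mult.commute)
      moreover have "((\<lambda>r. arctan (g r) - 1 / 2 * r) has_real_derivative
          inverse (1 + (g r)\<^sup>2) * (4 + (g r)\<^sup>2 - (2 * a - 1) * (g r / r)) - 1 / 2) (at r)"
        by (rule DERIV_diff[OF DERIV_chain2[OF DERIV_arctan Dg[OF r0]] DERIV_cmult_Id])
      ultimately show "\<exists>y. DERIV (\<lambda>r. arctan (g r) - 1 / 2 * r) r :> y \<and> 0 \<le> y" by force
    qed simp
    then show ?thesis by (simp add: field_simps)
  qed
  then show False using arctan_lbound[of "g (2 * a)"] arctan_ubound[of "g (2 * a + 10)"] pi_less_4 by linarith
qed

lemma bessel_series_first_zero:
  assumes a: "a \<ge> 1"
  shows "\<exists>z1>0. bessel_series a z1 = 0 \<and> (\<forall>z. 0 \<le> z \<and> z < z1 \<longrightarrow> 0 < bessel_series a z)"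
proof -
  obtain Z where Z: "Z > 0" "bessel_series a Z = 0" using bessel_series_has_zero[OF a] by blast
  define S where "S = {z \<in> {0..Z}. bessel_series a z = 0}"
  have cont: "continuous_on UNIV (bessel_series a)"
    using isCont_bessel_series[OF a] by (intro continuous_at_imp_continuous_on) auto
  have "closed {z. bessel_series a z = 0}" using cont by (intro closed_Collect_eq) auto
  then have "compact ({0..Z} \<inter> {z. bessel_series a z = 0})" by (intro compact_Int_closed) auto
  then have "compact S" by (simp add: S_def Int_def)
  moreover have "Z \<in> S" using Z by (simp add: S_def)
  ultimately obtain z1 where z1: "z1 \<in> S" "\<And>z. z \<in> S \<Longrightarrow> z1 \<le> z"
    using compact_attains_inf[of S] by blast
  have "z1 \<noteq> 0" using z1(1) bessel_series_0[of a] by (auto simp: S_def)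
  then have "z1 > 0" using z1(1) by (auto simp: S_def)
  moreover have "0 < bessel_series a z" if z: "0 \<le> z" "z < z1" for z
  proof (rule ccontr)
    assume "\<not> 0 < bessel_series a z"
    then have "\<exists>x\<ge>0. x \<le> z \<and> bessel_series a x = 0"
      using z a isCont_bessel_series by (intro IVT2) auto
    then obtain x where x: "0 \<le> x" "x \<le> z" "bessel_series a x = 0" by blast
    then have "x \<in> S" using z z1(1) by (auto simp: S_def)
    then show False using z1(2)[of x] x z by auto
  qed
  ultimately show ?thesis using z1(1) by (auto simp: S_def)
qed

section \<open>The level parameter\<close>

lemma Bessel_J_eq_series:
  assumes m: "m \<ge> 2" and x: "x > 0"
  shows "Bessel_J (nu m) x = (x / 2) powr nu m / Gamma (nu m + 1) * bessel_series (real m / 2) (x\<^sup>2 / 4)"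
proof -
  define a where "a = real m / 2"
  have a: "a \<ge> 1" "nu m + 1 = a" using m by (auto simp: a_def nu_def field_simps)
  have G: "Gamma a > 0" using a by (intro Gamma_real_pos) auto
  have coeff: "(-1) ^ k / (fact k * Gamma (real k + nu m + 1)) * (x / 2) powr (2 * real k + nu m)
     = ((x / 2) powr nu m / Gamma a) * ((-1) ^ k / (fact k * pochhammer a k) * (x\<^sup>2 / 4) ^ k)" for k
  proof -
    have "a \<notin> \<int>\<^sub>\<le>\<^sub>0" using a by (auto elim!: nonpos_Ints_cases)
    then have "pochhammer a k = Gamma (a + real k) / Gamma a" by (rule pochhammer_Gamma)
    then have "Gamma (a + real k) = pochhammer a k * Gamma a" using G by simp
    moreover have "real k + nu m + 1 = a + real k" using a(2) by simp
    ultimately have "Gamma (real k + nu m + 1) = pochhammer a k * Gamma a" by (simp only:)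
    moreover have "(x / 2) powr (2 * real k + nu m) = (x\<^sup>2 / 4) ^ k * (x / 2) powr nu m"
    proof -
      have "(x / 2) powr (2 * real k) = (x / 2) ^ (2 * k)"
        using x powr_realpow[of "x / 2" "2 * k"] by simp
      also have "\<dots> = (x\<^sup>2 / 4) ^ k" by (simp add: power_mult power_divide)
      finally show ?thesis by (simp add: powr_add)
    qed
    ultimately show ?thesis by (simp add: mult_ac)
  qed
  show ?thesis
    unfolding Bessel_J_def coeff bessel_series_def a(2) a_def[symmetric]
    by (rule suminf_mult[OF bessel_series_summable[OF a(1)]])
qed

text \<open>The first zero of the series is attained, so the infimum in the definition of
  \<open>Bessel_J_zero1\<close> is a minimum.\<close>

lemma Bessel_J_zero1_series:
  assumes m: "m \<ge> 2"
  defines "j \<equiv> Bessel_J_zero1 (nu m)"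
  shows "0 < j" "bessel_series (real m / 2) (j\<^sup>2 / 4) = 0"
    "\<And>z. 0 \<le> z \<Longrightarrow> z < j\<^sup>2 / 4 \<Longrightarrow> 0 < bessel_series (real m / 2) z"
proof -
  define a where "a = real m / 2"
  have a: "a \<ge> 1" "nu m + 1 = a" using m by (auto simp: a_def nu_def field_simps)
  have G: "Gamma a > 0" using a by (intro Gamma_real_pos) auto
  obtain z1 where z1: "z1 > 0" "bessel_series a z1 = 0" "\<And>z. 0 \<le> z \<Longrightarrow> z < z1 \<Longrightarrow> 0 < bessel_series a z"
    using bessel_series_first_zero[OF a(1)] by blast
  have J0: "Bessel_J (nu m) x = 0 \<longleftrightarrow> bessel_series a (x\<^sup>2 / 4) = 0" if "x > 0" for x
    using Bessel_J_eq_series[OF m that] that G a(2) by (simp add: a_def)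
  have "j = 2 * sqrt z1"
    unfolding j_def Bessel_J_zero1_def
  proof (rule cInf_eq_minimum)
    show "2 * sqrt z1 \<in> {x. 0 < x \<and> Bessel_J (nu m) x = 0}"
      using z1(1,2) J0[of "2 * sqrt z1"] by (simp add: power_mult_distrib)
    fix x assume "x \<in> {x. 0 < x \<and> Bessel_J (nu m) x = 0}"
    then have x: "0 < x" "bessel_series a (x\<^sup>2 / 4) = 0" using J0 by auto
    then have "z1 \<le> x\<^sup>2 / 4" using z1(3)[of "x\<^sup>2 / 4"] by fastforce
    then have "sqrt z1 \<le> sqrt ((x / 2)\<^sup>2)" by (simp add: power_divide)
    then show "2 * sqrt z1 \<le> x" using x(1) by simp
  qed
  then have j: "j\<^sup>2 / 4 = z1" "0 < j" using z1(1) by (auto simp: power_mult_distrib)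
  show "0 < j" "bessel_series (real m / 2) (j\<^sup>2 / 4) = 0"
    "\<And>z. 0 \<le> z \<Longrightarrow> z < j\<^sup>2 / 4 \<Longrightarrow> 0 < bessel_series (real m / 2) z"
    using z1 unfolding j(1) a_def[symmetric] by (auto simp: j)
qed

lemma bessel_series_strict_decreasing:
  assumes m: "m \<ge> 2" and xy: "0 \<le> x" "x < y" "y \<le> (Bessel_J_zero1 (nu m))\<^sup>2 / 4"
  shows "bessel_series (real m / 2) y < bessel_series (real m / 2) x"
proof (rule DERIV_neg_imp_decreasing_open[OF xy(2), where f="bessel_series (real m / 2)"])
  have a: "real m / 2 \<ge> 1" using m by simp
  show "continuous_on {x..y} (bessel_series (real m / 2))"
    using isCont_bessel_series[OF a] by (intro continuous_at_imp_continuous_on) auto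
  fix z assume z: "x < z" "z < y"
  have "0 < bessel_series (real m / 2 + 1) z"
    by (rule bessel_series_Suc_pos[OF a]) (use z xy Bessel_J_zero1_series(3)[OF m] in auto)
  then show "\<exists>d. (bessel_series (real m / 2) has_real_derivative d) (at z) \<and> d < 0"
    using DERIV_bessel_series[OF a, of z] a by (intro exI[of _ "- bessel_series (real m / 2 + 1) z / (real m / 2)"]) auto
qed

lemma is_level_beta_iff:
  assumes m: "m \<ge> 2"
  shows "is_level_beta m \<theta> \<beta> \<longleftrightarrow>
    0 < \<beta> \<and> \<beta> < (Bessel_J_zero1 (nu m))\<^sup>2 / 2 \<and> bessel_series (real m / 2) (\<beta> / 2) = \<theta>"
proof -
  have "q_moment m \<beta> = inverse (bessel_series (real m / 2) (\<beta> / 2))" if \<beta>: "0 < \<beta>"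
  proof -
    define b where "b = sqrt (2 * \<beta>)"
    have b: "0 < b" "b\<^sup>2 / 4 = \<beta> / 2" using \<beta> by (auto simp: b_def)
    have G: "Gamma (nu m + 1) > 0" using m by (intro Gamma_real_pos) (auto simp: nu_def field_simps)
    have p: "(b / 2) powr nu m > 0" using b by simp
    have "q_moment m \<beta> = (b / 2) powr nu m / (Gamma (nu m + 1) * Bessel_J (nu m) b)"
      using \<beta> by (simp add: q_moment_def b_def)
    also have "Gamma (nu m + 1) * Bessel_J (nu m) b = (b / 2) powr nu m * bessel_series (real m / 2) (\<beta> / 2)"
    proof -
      have gen: "g * (P / g * S) = P * S" if "g > 0" for g P S :: real using that by simp
      show ?thesis unfolding Bessel_J_eq_series[OF m b(1)] b(2) by (rule gen[OF G])
    qed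
    also have "(b / 2) powr nu m / ((b / 2) powr nu m * bessel_series (real m / 2) (\<beta> / 2)) = inverse (bessel_series (real m / 2) (\<beta> / 2))"
    proof -
      have cancel: "P / (P * S) = inverse S" if "P > 0" for P S :: real using that by (simp add: divide_inverse)
      show ?thesis by (rule cancel[OF p])
    qed
    finally show ?thesis .
  qed
  then show ?thesis unfolding is_level_beta_def by auto
qed

lemma ex1_level_beta:
  assumes m: "m \<ge> 2" and \<theta>: "0 < \<theta>" "\<theta> < 1"
  shows "\<exists>!\<beta>. is_level_beta m \<theta> \<beta>"
proof -
  let ?j = "Bessel_J_zero1 (nu m)" and ?L = "bessel_series (real m / 2)"
  note z = Bessel_J_zero1_series[OF m]
  have "\<exists>x\<ge>0. x \<le> ?j\<^sup>2 / 4 \<and> ?L x = \<theta>"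
    using z(1,2) \<theta> isCont_bessel_series[of "real m / 2"] m by (intro IVT2) auto
  then obtain x where x: "0 \<le> x" "x \<le> ?j\<^sup>2 / 4" "?L x = \<theta>" by blast
  have "x \<noteq> 0" using x(3) \<theta> by auto
  moreover have "x \<noteq> ?j\<^sup>2 / 4"
  proof
    assume "x = ?j\<^sup>2 / 4"
    then have "\<theta> = 0" using x(3) z(2) by (simp only:)
    then show False using \<theta> by simp
  qed
  ultimately have "is_level_beta m \<theta> (2 * x)"
    unfolding is_level_beta_iff[OF m] using x by auto
  moreover have "\<beta> = \<beta>'" if "is_level_beta m \<theta> \<beta>" "is_level_beta m \<theta> \<beta>'" for \<beta> \<beta>'
    using that bessel_series_strict_decreasing[OF m, of "\<beta> / 2" "\<beta>' / 2"]
      bessel_series_strict_decreasing[OF m, of "\<beta>' / 2" "\<beta> / 2"]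
    unfolding is_level_beta_iff[OF m] by (cases \<beta> \<beta>' rule: linorder_cases) auto
  ultimately show ?thesis by blast
qed

lemma level_beta_solves:
  assumes "m \<ge> 2" "0 < \<theta>" "\<theta> < 1"
  shows "0 < level_beta m \<theta>" "level_beta m \<theta> < (Bessel_J_zero1 (nu m))\<^sup>2 / 2"
    "bessel_series (real m / 2) (level_beta m \<theta> / 2) = \<theta>"
proof -
  have "is_level_beta m \<theta> (level_beta m \<theta>)"
    unfolding level_beta_def by (rule theI'[OF ex1_level_beta[OF assms]])
  then show "0 < level_beta m \<theta>" "level_beta m \<theta> < (Bessel_J_zero1 (nu m))\<^sup>2 / 2"
    "bessel_series (real m / 2) (level_beta m \<theta> / 2) = \<theta>"
    unfolding is_level_beta_iff[OF assms(1)] by auto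
qed

lemma level_beta_tendsto_zero_level:
  assumes m: "m \<ge> 2"
  shows "(level_beta m \<longlongrightarrow> (Bessel_J_zero1 (nu m))\<^sup>2 / 2) (at_right 0)"
proof (rule order_tendstoI)
  let ?j = "Bessel_J_zero1 (nu m)" and ?L = "bessel_series (real m / 2)"
  note z = Bessel_J_zero1_series[OF m]
  have range: "\<forall>\<^sub>F \<theta> in at_right 0. 0 < \<theta> \<and> \<theta> < (1::real)"
    unfolding eventually_at_right_field by (intro exI[of _ 1]) auto
  show "\<forall>\<^sub>F \<theta> in at_right 0. level_beta m \<theta> < b" if "?j\<^sup>2 / 2 < b" for b
    using range by eventually_elim (use level_beta_solves(2)[OF m] that in force)
  show "\<forall>\<^sub>F \<theta> in at_right 0. b < level_beta m \<theta>" if b: "b < ?j\<^sup>2 / 2" for b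
  proof -
    define c where "c = max b 0"
    have c: "0 \<le> c" "b \<le> c" "c / 2 < ?j\<^sup>2 / 4" using b z(1) by (auto simp: c_def max_def)
    have p: "0 < ?L (c / 2)" using z(3)[of "c / 2"] c by auto
    have "\<forall>\<^sub>F \<theta> in at_right 0. \<theta> < ?L (c / 2)"
      unfolding eventually_at_right_field by (intro exI[of _ "?L (c / 2)"]) (use p in auto)
    with range show ?thesis
    proof eventually_elim
      case (elim \<theta>)
      note L = level_beta_solves[OF m, of \<theta>]
      have "\<not> level_beta m \<theta> \<le> c"
      proof
        assume "level_beta m \<theta> \<le> c"
        then have "level_beta m \<theta> / 2 = c / 2 \<or> level_beta m \<theta> / 2 < c / 2" by auto
        then show False
          using bessel_series_strict_decreasing[OF m, of "level_beta m \<theta> / 2" "c / 2"] L elim c by auto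
      qed
      then show ?case using c by auto
    qed
  qed
qed

text \<open>Taylor's formula of second order at \<open>0\<close>, by integrating a bound on the
  second derivative twice.\<close>

lemma bessel_series_quadratic_remainder:
  assumes a: "a \<ge> 1" and Z: "Z > 0"
  shows "\<exists>K>0. \<forall>z. 0 \<le> z \<and> z \<le> Z \<longrightarrow> \<bar>bessel_series a z - 1 + z / a\<bar> \<le> K * z\<^sup>2"
proof -
  have "continuous_on {0..Z} (bessel_series (a + 1 + 1))"
    using isCont_bessel_series[of "a + 1 + 1"] a by (intro continuous_at_imp_continuous_on) auto
  then have "bounded (bessel_series (a + 1 + 1) ` {0..Z})"
    by (intro compact_imp_bounded compact_continuous_image) auto
  then obtain K where K: "K > 0" "\<And>z. 0 \<le> z \<Longrightarrow> z \<le> Z \<Longrightarrow> \<bar>bessel_series (a + 1 + 1) z\<bar> \<le> K"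
    by (auto simp: bounded_pos)
  have first: "\<bar>bessel_series (a + 1) z - 1\<bar> \<le> K * z" if "0 \<le> z" "z \<le> Z" for z
  proof -
    have "norm (bessel_series (a + 1) z - bessel_series (a + 1) 0) \<le> K * norm (z - 0)"
    proof (rule field_differentiable_bound[where S="{0..z}"])
      show "(bessel_series (a + 1) has_field_derivative - bessel_series (a + 1 + 1) y / (a + 1)) (at y within {0..z})" for y
        using DERIV_bessel_series[of "a + 1" y] a by (auto intro: DERIV_subset)
      fix y assume "y \<in> {0..z}"
      then have "\<bar>bessel_series (a + 1 + 1) y\<bar> \<le> K" using K(2)[of y] that by auto
      also have "K \<le> K * (a + 1)" using K(1) a by simp
      finally show "norm (- bessel_series (a + 1 + 1) y / (a + 1)) \<le> K"
        using a by (simp add: divide_le_eq)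
    qed (use that in auto)
    then show ?thesis using that by simp
  qed
  have "\<bar>bessel_series a z - 1 + z / a\<bar> \<le> K * z\<^sup>2" if z: "0 \<le> z" "z \<le> Z" for z
  proof -
    have "norm ((bessel_series a z - 1 + z / a) - (bessel_series a 0 - 1 + 0 / a)) \<le> (K * z) * norm (z - 0)"
    proof (rule field_differentiable_bound[where S="{0..z}" and f="\<lambda>z. bessel_series a z - 1 + z / a"])
      show "((\<lambda>z. bessel_series a z - 1 + z / a) has_field_derivative - bessel_series (a + 1) y / a - 0 + 1 / a) (at y within {0..z})" for y
        using a by (intro DERIV_add DERIV_diff DERIV_subset[OF DERIV_bessel_series] DERIV_const DERIV_cdivide DERIV_ident) auto
      fix y assume y: "y \<in> {0..z}"
      have "- bessel_series (a + 1) y / a - 0 + 1 / a = - (bessel_series (a + 1) y - 1) / a"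
        by (simp add: diff_divide_distrib)
      then have "norm (- bessel_series (a + 1) y / a - 0 + 1 / a) = \<bar>bessel_series (a + 1) y - 1\<bar> / a"
        using a by (simp only: real_norm_def abs_divide abs_minus_cancel abs_of_pos)
      also have "\<dots> \<le> (K * y) / 1"
        using first[of y] y z a K(1) by (intro frac_le) auto
      also have "\<dots> \<le> K * z" using y K(1) by simp
      finally show "norm (- bessel_series (a + 1) y / a - 0 + 1 / a) \<le> K * z" .
    qed (use z in auto)
    then show ?thesis using z by (simp add: power2_eq_square mult.assoc)
  qed
  then show ?thesis using K(1) by blast
qed

text \<open>The function \<open>z = \<beta>/2\<close> inverts \<open>\<theta> = 1 - z/a +
  O(z\<^sup>2)\<close>. For \<open>\<theta>\<close> close to \<open>1\<close> the quadratic term is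
  at most half of the linear one, so \<open>z\<close> is at most \<open>2 a (1 - \<theta>)\<close>,
  and the remainder is quadratic in \<open>1 - \<theta>\<close>.\<close>

lemma level_beta_expansion:
  assumes m: "m \<ge> 2"
  shows "(\<lambda>\<theta>. level_beta m \<theta> - real m * (1 - \<theta>)) \<in> O[at_left 1](\<lambda>\<theta>. (1 - \<theta>)\<^sup>2)"
proof -
  define a where "a = real m / 2"
  have a: "a \<ge> 1" using m by (simp add: a_def)
  define Z where "Z = (Bessel_J_zero1 (nu m))\<^sup>2 / 4"
  have Z: "Z > 0" using Bessel_J_zero1_series(1)[OF m] by (simp add: Z_def)
  obtain K where K: "K > 0" "\<And>z. 0 \<le> z \<Longrightarrow> z \<le> Z \<Longrightarrow> \<bar>bessel_series a z - 1 + z / a\<bar> \<le> K * z\<^sup>2"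
    using bessel_series_quadratic_remainder[OF a Z] by blast
  \<comment> \<open>below \<open>1 / (2 a K)\<close> the remainder \<open>K z\<^sup>2\<close> is at most half of the linear term \<open>z / a\<close>\<close>
  define d where "d = min Z (1 / (2 * a * K))"
  have d: "0 < d" "d \<le> Z" "d \<le> 1 / (2 * a * K)" using Z a K by (auto simp: d_def)
  have "bessel_series a d < 1"
    using bessel_series_strict_decreasing[OF m, of 0 d] d by (simp add: a_def Z_def)
  then have "\<forall>\<^sub>F \<theta> in at_left 1. max 0 (bessel_series a d) < \<theta> \<and> \<theta> < 1"
    unfolding eventually_at_left_field by (intro exI[of _ "max 0 (bessel_series a d)"]) auto
  then have "\<forall>\<^sub>F \<theta> in at_left 1. norm (level_beta m \<theta> - real m * (1 - \<theta>)) \<le> (8 * a ^ 3 * K) * norm ((1 - \<theta>)\<^sup>2)"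
  proof eventually_elim
    case (elim \<theta>)
    define z where "z = level_beta m \<theta> / 2"
    have z: "0 < z" "z < Z" "bessel_series a z = \<theta>"
      using level_beta_solves[OF m, of \<theta>] elim by (auto simp: z_def Z_def a_def)
    have "z < d"
    proof (rule ccontr)
      assume "\<not> z < d"
      then have "z = d \<or> d < z" by auto
      then show False
        using bessel_series_strict_decreasing[OF m, of d z] z elim d by (auto simp: a_def Z_def)
    qed
    have R: "\<bar>\<theta> - 1 + z / a\<bar> \<le> K * z\<^sup>2" using K(2)[of z] z by simp
    have "K * z\<^sup>2 = (K * z) * z" by (simp add: power2_eq_square)
    also have "\<dots> \<le> (1 / (2 * a)) * z"
    proof (intro mult_right_mono)
      have "K * z \<le> K * (1 / (2 * a * K))" using \<open>z < d\<close> d K by (intro mult_left_mono) auto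
      then show "K * z \<le> 1 / (2 * a)" using K by simp
    qed (use z in auto)
    finally have "z / a - z / (2 * a) \<le> 1 - \<theta>" using R by simp
    then have "z \<le> 2 * a * (1 - \<theta>)" using a by (simp add: field_simps)
    then have "z\<^sup>2 \<le> (2 * a * (1 - \<theta>))\<^sup>2" using z by (intro power_mono) auto
    then have sq: "K * z\<^sup>2 \<le> K * (4 * a\<^sup>2 * (1 - \<theta>)\<^sup>2)" using K by (simp add: power_mult_distrib)
    have "level_beta m \<theta> - real m * (1 - \<theta>) = 2 * a * (\<theta> - 1 + z / a)"
      using a by (simp add: z_def a_def field_simps)
    then have "norm (level_beta m \<theta> - real m * (1 - \<theta>)) = 2 * a * \<bar>\<theta> - 1 + z / a\<bar>"
      using a by (simp add: abs_mult)
    also have "\<dots> \<le> 2 * a * (K * (4 * a\<^sup>2 * (1 - \<theta>)\<^sup>2))"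
      using R sq a by (intro mult_left_mono) auto
    also have "\<dots> = (8 * a ^ 3 * K) * norm ((1 - \<theta>)\<^sup>2)"
      by (simp add: power3_eq_cube power2_eq_square)
    finally show ?case .
  qed
  then show ?thesis by (rule bigoI)
qed

section \<open>Comparison with the radial solution\<close>

text \<open>Monotonicity from a one-sided derivative bound. The second condition excludes upward
  jumps on the left. Downward jumps are allowed, so nothing needs to be known about the measure of
  level sets when this is applied to functions of the level.\<close>

lemma nonincreasing_from_right_estimate:
  fixes f :: "real \<Rightarrow> real"
  assumes ab: "a \<le> b"
    and right: "\<And>x e. a \<le> x \<Longrightarrow> x < b \<Longrightarrow> e > 0 \<Longrightarrow> \<forall>\<^sub>F h in at_right 0. f (x + h) \<le> f x + e * h"
    and left: "\<And>x e. a < x \<Longrightarrow> x \<le> b \<Longrightarrow> e > 0 \<Longrightarrow> \<exists>d>0. \<forall>y. a \<le> y \<and> y < x \<and> x < y + d \<longrightarrow> f x \<le> f y + e"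
  shows "f b \<le> f a"
proof (rule field_le_epsilon)
  fix e' :: real assume e': "e' > 0"
  define e where "e = e' / (b - a + 1)"
  have e: "e > 0" "e * (b - a) \<le> e'"
    using e' ab by (auto simp: e_def divide_simps algebra_simps)
  define S where "S = {x \<in> {a..b}. \<forall>y\<in>{a..x}. f y \<le> f a + e * (y - a)}"
  have aS: "a \<in> S" using ab by (auto simp: S_def)
  have bS: "bdd_above S" by (auto simp: S_def intro!: bdd_aboveI[of _ b])
  define c where "c = Sup S"
  have ac: "a \<le> c" unfolding c_def by (rule cSup_upper[OF aS bS])
  have cb: "c \<le> b" unfolding c_def using aS by (intro cSup_least) (auto simp: S_def)
  have below: "f y \<le> f a + e * (y - a)" if y: "a \<le> y" "y < c" for y
  proof -
    obtain x where "x \<in> S" "y < x" using y(2) less_cSupD[of S y] aS unfolding c_def by blast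
    then show ?thesis using y by (auto simp: S_def)
  qed
  have at_c: "f c \<le> f a + e * (c - a)"
  proof (cases "c = a")
    case False
    show ?thesis
    proof (rule field_le_epsilon)
      fix e2 :: real assume "e2 > 0"
      then obtain d where d: "d > 0" "\<And>y. a \<le> y \<Longrightarrow> y < c \<Longrightarrow> c < y + d \<Longrightarrow> f c \<le> f y + e2"
        using left[of c e2] False ac cb by auto
      define y where "y = max a (c - d / 2)"
      have y: "a \<le> y" "y < c" "c < y + d" using d(1) False ac by (auto simp: y_def)
      have "f c \<le> f y + e2" by (rule d(2)[OF y])
      also have "f y \<le> f a + e * (y - a)" using below y by blast
      also have "e * (y - a) \<le> e * (c - a)" using y e by (intro mult_left_mono) auto
      finally show "f c \<le> f a + e * (c - a) + e2" by simp
    qed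
  qed simp
  have "c = b"
  proof (rule ccontr)
    assume "c \<noteq> b"
    then have "c < b" using cb by simp
    then have "\<forall>\<^sub>F h in at_right 0. f (c + h) \<le> f c + e * h" by (intro right ac e(1))
    then obtain d where d: "d > 0" "\<And>h. 0 < h \<Longrightarrow> h < d \<Longrightarrow> f (c + h) \<le> f c + e * h"
      unfolding eventually_at_right_field by auto
    define x where "x = min b (c + d / 2)"
    have x: "c < x" "x \<le> b" "x < c + d" using d(1) \<open>c < b\<close> by (auto simp: x_def)
    have "x \<in> S"
      unfolding S_def
    proof (intro CollectI conjI ballI)
      show "x \<in> {a..b}" using x ac by auto
      fix y assume y: "y \<in> {a..x}"
      show "f y \<le> f a + e * (y - a)"
      proof (cases "y \<le> c")
        case True
        then show ?thesis using below at_c y by (cases "y = c") auto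
      next
        case False
        have "f (c + (y - c)) \<le> f c + e * (y - c)" using False y x by (intro d) auto
        then show ?thesis using at_c by (simp add: algebra_simps)
      qed
    qed
    then have "x \<le> c" unfolding c_def by (intro cSup_upper bS)
    then show False using x by simp
  qed
  then show "f b \<le> f a + e'" using at_c e by simp
qed

text \<open>The comparison of a rearranged solution with the radial one, for \<open>w = W'\<close>.
  Talenti's inequality for \<open>\<mu>\<close> and the equation for \<open>W\<close> make the
  Wronskian \<open>P\<close> nonincreasing in the level. At levels close to the maximum
  \<open>P\<close> is bounded below by a quantity that tends to \<open>0\<close>, so it is
  nonnegative; this in turn makes \<open>Q = H / W(\<mu>)\<close> nonincreasing. As \<open>Q
  s\<close> is at least \<open>s\<close>, it is at least \<open>M\<close> everywhere.\<close>

lemma sturm_comparison: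
  fixes \<mu> H W w :: "real \<Rightarrow> real"
  assumes l: "0 \<le> l" and b: "b > 0" and p: "p \<ge> 0"
    and mono: "\<And>s t. l < s \<Longrightarrow> s \<le> t \<Longrightarrow> t < M \<Longrightarrow> \<mu> t \<le> \<mu> s"
    and range: "\<And>s. l < s \<Longrightarrow> s < M \<Longrightarrow> 0 < \<mu> s \<and> \<mu> s \<le> V"
    and H: "\<And>s t. l < s \<Longrightarrow> s \<le> t \<Longrightarrow> t < M \<Longrightarrow> s * (\<mu> s - \<mu> t) \<le> H s - H t \<and> H s - H t \<le> t * (\<mu> s - \<mu> t)"
    and H_bounds: "\<And>s. l < s \<Longrightarrow> s < M \<Longrightarrow> s * \<mu> s \<le> H s \<and> H s \<le> M * \<mu> s"
    and rc: "\<And>s. l < s \<Longrightarrow> s < M \<Longrightarrow> ((\<lambda>h. \<mu> (s + h)) \<longlongrightarrow> \<mu> s) (at_right 0)"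
    and talenti: "\<And>s h. l < s \<Longrightarrow> 0 < h \<Longrightarrow> s + h < M \<Longrightarrow> h * \<mu> (s + h) powr p \<le> (\<mu> s - \<mu> (s + h)) * (b * H s)"
    and w: "\<And>x. 0 \<le> x \<Longrightarrow> x \<le> V \<Longrightarrow> 0 < w x \<and> w x \<le> 1"
    and W0: "W 0 = 0"
    and W: "\<And>x y. 0 \<le> x \<Longrightarrow> x \<le> y \<Longrightarrow> y \<le> V \<Longrightarrow> (y - x) * w y \<le> W y - W x \<and> W y - W x \<le> (y - x) * w x"
    and ode: "\<And>x y. 0 < x \<Longrightarrow> x \<le> y \<Longrightarrow> y \<le> V \<Longrightarrow> b * (y - x) * W x \<le> (w x - w y) * y powr p"
    and t: "l < t" "t < M"
  shows "M * w (\<mu> t) \<le> t"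
proof -
  have w_mono: "w y \<le> w x" if "0 \<le> x" "x \<le> y" "y \<le> V" for x y
    using W[OF that] that by (cases "x = y") (auto dest: order_trans simp: mult_le_cancel_left_pos)
  have W_lower: "x * w x \<le> W x" and W_upper: "W x \<le> x" if "0 \<le> x" "x \<le> V" for x
  proof -
    show "x * w x \<le> W x" using W[of 0 x] that W0 by simp
    have "x * w 0 \<le> x * 1" using that w[of 0] by (intro mult_left_mono) auto
    then show "W x \<le> x" using W[of 0 x] that W0 by simp
  qed
  have W_pos: "0 < W x" if "0 < x" "x \<le> V" for x
    using W_lower[of x] w[of x] that by (smt (verit) mult_pos_pos)
  have W_mono: "W x \<le> W y" if "0 \<le> x" "x \<le> y" "y \<le> V" for x y
  proof -
    have "0 \<le> (y - x) * w y" using that w[of y] by (intro mult_nonneg_nonneg) auto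
    then show ?thesis using W[OF that] by linarith
  qed
  have H_pos: "0 < H s" if "l < s" "s < M" for s
    using H_bounds[OF that] range[OF that] l that by (smt (verit) mult_pos_pos)
  \<comment> \<open>the Wronskian of the rearranged and the radial mass function\<close>
  define P where "P s = s * W (\<mu> s) - H s * w (\<mu> s)" for s
  have P_step: "P (s + h) \<le> P s + h * (W (\<mu> (s + h)) + (\<mu> s - \<mu> (s + h)) * w (\<mu> s))
        - H (s + h) * (w (\<mu> (s + h)) - w (\<mu> s))"
    if s: "l < s" "0 < h" "s + h < M" for s h
  proof -
    define m1 m2 where "m1 = \<mu> s" and "m2 = \<mu> (s + h)"
    have m: "0 < m2" "m2 \<le> m1" "m1 \<le> V"
      using mono[of s "s + h"] range[of s] range[of "s + h"] s l by (auto simp: m1_def m2_def)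
    have "s * ((m1 - m2) * w m1) \<le> s * (W m1 - W m2)"
      using W[of m2 m1] m s l by (intro mult_left_mono) auto
    moreover have "(H s - H (s + h)) * w m1 \<le> ((s + h) * (m1 - m2)) * w m1"
      using H[of s "s + h"] s w[of m1] m by (intro mult_right_mono) (auto simp: m1_def m2_def)
    ultimately show ?thesis
      unfolding P_def m1_def[symmetric] m2_def[symmetric] by (simp add: algebra_simps)
  qed
  have P_anti: "P t' \<le> P s" if st: "l < s" "s \<le> t'" "t' < M" for s t'
  proof (rule nonincreasing_from_right_estimate[OF st(2)])
    fix x e :: real assume x: "s < x" "x \<le> t'" and e: "e > 0"
    have V: "0 < V" using range[of s] st by auto
    show "\<exists>d>0. \<forall>y. s \<le> y \<and> y < x \<and> x < y + d \<longrightarrow> P x \<le> P y + e"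
    proof (intro exI[of _ "e / (2 * V)"] conjI allI impI)
      show "0 < e / (2 * V)" using e V by simp
      fix y assume y: "s \<le> y \<and> y < x \<and> x < y + e / (2 * V)"
      define h where "h = x - y"
      have h: "0 < h" "y + h = x" "h * (2 * V) \<le> e" "l < y" "x < M"
        using y V x st by (auto simp: h_def field_simps)
      define m1 m2 where "m1 = \<mu> y" and "m2 = \<mu> x"
      have m: "0 < m2" "m2 \<le> m1" "m1 \<le> V"
        using mono[of y x] range[of y] range[of x] h y by (auto simp: m1_def m2_def)
      have "P x \<le> P y + h * (W m2 + (m1 - m2) * w m1) - H x * (w m2 - w m1)"
        using P_step[of y h] h by (simp add: m1_def m2_def)
      moreover have "0 \<le> H x * (w m2 - w m1)"
        using H_pos[of x] w_mono[of m2 m1] m h y by (intro mult_nonneg_nonneg) auto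
      moreover have "(m1 - m2) * w m1 \<le> (m1 - m2) * 1" using m w[of m1] by (intro mult_left_mono) auto
      then have "W m2 + (m1 - m2) * w m1 \<le> 2 * V" using W_upper[of m2] m by simp
      then have "h * (W m2 + (m1 - m2) * w m1) \<le> h * (2 * V)" using h by (intro mult_left_mono) auto
      ultimately show "P x \<le> P y + e" using h by linarith
    qed
  next
    fix x e :: real assume x: "s \<le> x" "x < t'" and e: "e > 0"
    have lx: "l < x" "x < M" using x st by auto
    define m1 where "m1 = \<mu> x"
    have m1: "0 < m1" "m1 \<le> V" using range[OF lx] by (auto simp: m1_def)
    have lim_mu: "((\<lambda>h. \<mu> (x + h)) \<longlongrightarrow> m1) (at_right 0)" using rc[OF lx] by (simp add: m1_def)
    have near: "\<forall>\<^sub>F h in at_right 0. 0 < h \<and> x + h < M"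
      unfolding eventually_at_right_field using lx by (intro exI[of _ "M - x"]) auto
    have lim_H: "((\<lambda>h. H (x + h)) \<longlongrightarrow> H x) (at_right 0)"
    proof (rule tendsto_sandwich[where f="\<lambda>h. H x - (x + h) * (m1 - \<mu> (x + h))" and h="\<lambda>_. H x"])
      have "((\<lambda>h. H x - (x + h) * (m1 - \<mu> (x + h))) \<longlongrightarrow> H x - (x + 0) * (m1 - m1)) (at_right 0)"
        by (intro tendsto_intros lim_mu)
      then show "((\<lambda>h. H x - (x + h) * (m1 - \<mu> (x + h))) \<longlongrightarrow> H x) (at_right 0)" by simp
      show "\<forall>\<^sub>F h in at_right 0. H x - (x + h) * (m1 - \<mu> (x + h)) \<le> H (x + h)"
        using near
      proof eventually_elim
        case (elim h)
        have "H x - H (x + h) \<le> (x + h) * (\<mu> x - \<mu> (x + h))" using H[of x "x + h"] elim lx by simp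
        then show ?case unfolding m1_def by linarith
      qed
      show "\<forall>\<^sub>F h in at_right 0. H (x + h) \<le> H x"
        using near
      proof eventually_elim
        case (elim h)
        have "0 \<le> x * (\<mu> x - \<mu> (x + h))" using mono[of x "x + h"] elim lx l by (intro mult_nonneg_nonneg) auto
        then show ?case using H[of x "x + h"] elim lx by auto
      qed
    qed simp
    have "((\<lambda>h. V * (1 - H (x + h) / H x * (\<mu> (x + h) / m1) powr p) + (m1 - \<mu> (x + h)))
        \<longlongrightarrow> V * (1 - H x / H x * (m1 / m1) powr p) + (m1 - m1)) (at_right 0)"
      using H_pos[OF lx] m1 by (intro tendsto_intros lim_mu lim_H) auto
    moreover have "V * (1 - H x / H x * (m1 / m1) powr p) + (m1 - m1) = 0" using H_pos[OF lx] m1 by simp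
    ultimately have "\<forall>\<^sub>F h in at_right 0. V * (1 - H (x + h) / H x * (\<mu> (x + h) / m1) powr p) + (m1 - \<mu> (x + h)) < e"
      using e order_tendstoD(2) by fastforce
    with near show "\<forall>\<^sub>F h in at_right 0. P (x + h) \<le> P x + e * h"
    proof eventually_elim
      case (elim h)
      define m2 where "m2 = \<mu> (x + h)"
      have m: "0 < m2" "m2 \<le> m1"
        using mono[of x "x + h"] range[of "x + h"] elim lx by (auto simp: m1_def m2_def)
      have H2: "0 < H (x + h)" using H_pos[of "x + h"] elim lx by auto
      have H12: "H (x + h) \<le> H x"
      proof -
        have "0 \<le> x * (\<mu> x - \<mu> (x + h))" using mono[of x "x + h"] elim lx l by (intro mult_nonneg_nonneg) auto
        then show ?thesis using H[of x "x + h"] elim lx by auto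
      qed
      have p1: "m1 powr p > 0" using m1 by simp
      have "h * m2 powr p * W m2 \<le> (m1 - m2) * (b * H x) * W m2"
        using talenti[of x h] elim lx W_pos[of m2] m m1 by (intro mult_right_mono) (auto simp: m1_def m2_def)
      also have "\<dots> = H x * (b * (m1 - m2) * W m2)" by simp
      also have "\<dots> \<le> H x * ((w m2 - w m1) * m1 powr p)"
        using ode[of m2 m1] m m1 H_pos[OF lx] by (intro mult_left_mono) auto
      finally have "h * W m2 * (m2 / m1) powr p / H x \<le> w m2 - w m1"
        using p1 H_pos[OF lx] m m1 by (simp add: powr_divide divide_simps mult_ac)
      then have "H (x + h) * (h * W m2 * (m2 / m1) powr p / H x) \<le> H (x + h) * (w m2 - w m1)"
        using H2 by (intro mult_left_mono) auto
      moreover define r where "r = H (x + h) / H x * (m2 / m1) powr p"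
      have "H (x + h) * (h * W m2 * (m2 / m1) powr p / H x) = h * W m2 * r" by (simp add: r_def)
      ultimately have "P (x + h) \<le> P x + h * (W m2 + (m1 - m2) * w m1) - h * W m2 * r"
        using P_step[of x h] elim lx by (simp add: m1_def m2_def)
      also have "\<dots> = P x + h * (W m2 * (1 - r) + (m1 - m2) * w m1)" by (simp add: algebra_simps)
      also have "\<dots> \<le> P x + h * (V * (1 - r) + (m1 - m2))"
      proof -
        have "(m2 / m1) powr p \<le> 1" using m m1 p by (intro powr_le1) auto
        moreover have "H (x + h) / H x \<le> 1" using H12 H_pos[OF lx] by simp
        ultimately have "r \<le> 1 * 1"
          unfolding r_def using H2 H_pos[OF lx] by (intro mult_mono) auto
        then have "W m2 * (1 - r) \<le> V * (1 - r)"
          using W_upper[of m2] m m1 by (intro mult_right_mono) auto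
        moreover have "(m1 - m2) * w m1 \<le> (m1 - m2) * 1" using m m1 w[of m1] by (intro mult_left_mono) auto
        ultimately have "W m2 * (1 - r) + (m1 - m2) * w m1 \<le> V * (1 - r) + (m1 - m2)" by simp
        then show ?thesis using elim by simp
      qed
      also have "\<dots> \<le> P x + h * e"
        using elim by (intro add_left_mono mult_left_mono) (auto simp: r_def m2_def)
      finally show ?case by (simp add: mult.commute)
    qed
  qed
  have P_nonneg: "0 \<le> P s" if s: "l < s" "s < M" for s
  proof -
    have V: "0 < V" using range[of s] s by auto
    have "- ((M - s') * V) \<le> P s" if s': "s \<le> s'" "s' < M" for s'
    proof -
      define m where "m = \<mu> s'"
      have m: "0 < m" "m \<le> V" using range[of s'] s s' by (auto simp: m_def)
      have "s' * (m * w m) \<le> s' * W m" using W_lower[of m] m s s' l by (intro mult_left_mono) auto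
      moreover have "H s' * w m \<le> (M * m) * w m"
        using H_bounds[of s'] s s' w[of m] m by (intro mult_right_mono) (auto simp: m_def)
      ultimately have "- ((M - s') * (m * w m)) \<le> P s'"
        unfolding P_def m_def[symmetric] by (simp add: algebra_simps)
      moreover have "m * w m \<le> V * 1" using m w[of m] by (intro mult_mono) auto
      then have "(M - s') * (m * w m) \<le> (M - s') * V" using s' by (intro mult_left_mono) auto
      ultimately show ?thesis using P_anti[of s s'] s s' by linarith
    qed
    then have ev: "\<forall>\<^sub>F s' in at_left M. - ((M - s') * V) \<le> P s"
      unfolding eventually_at_left_field using s by (intro exI[of _ s]) auto
    have "((\<lambda>s'. - ((M - s') * V)) \<longlongrightarrow> - ((M - M) * V)) (at_left M)" by (intro tendsto_intros)
    then have "- ((M - M) * V) \<le> P s" using ev by (rule tendsto_upperbound) simp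
    then show ?thesis by simp
  qed
  define Q where "Q s = H s / W (\<mu> s)" for s
  have Q_step: "Q (s + h) \<le> Q s + h * ((\<mu> s - \<mu> (s + h)) / W (\<mu> s))" if s: "l < s" "0 < h" "s + h < M" for s h
  proof -
    define m1 m2 where "m1 = \<mu> s" and "m2 = \<mu> (s + h)"
    have m: "0 < m2" "m2 \<le> m1" "m1 \<le> V"
      using mono[of s "s + h"] range[of s] range[of "s + h"] s by (auto simp: m1_def m2_def)
    have Wp: "0 < W m1" "0 < W m2" using W_pos m by auto
    have "H (s + h) * W m1 \<le> H (s + h) * (W m2 + (m1 - m2) * w m2)"
      using W[of m2 m1] m H_pos[of "s + h"] s by (intro mult_left_mono) auto
    moreover have "(H (s + h) + s * (m1 - m2)) * W m2 \<le> H s * W m2"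
      using H[of s "s + h"] s Wp by (intro mult_right_mono) (auto simp: m1_def m2_def)
    moreover have "(m1 - m2) * (H (s + h) * w m2) \<le> (m1 - m2) * ((s + h) * W m2)"
      using P_nonneg[of "s + h"] s m by (intro mult_left_mono) (auto simp: P_def m2_def)
    ultimately have "H (s + h) * W m1 \<le> H s * W m2 + h * (m1 - m2) * W m2"
      by (simp add: algebra_simps)
    then have "H (s + h) * W m1 / (W m1 * W m2) \<le> (H s * W m2 + h * (m1 - m2) * W m2) / (W m1 * W m2)"
      using Wp by (intro divide_right_mono) auto
    then show ?thesis
      unfolding Q_def m1_def[symmetric] m2_def[symmetric] using Wp by (simp add: add_divide_distrib)
  qed
  have Q_anti: "Q t' \<le> Q s" if st: "l < s" "s \<le> t'" "t' < M" for s t'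
  proof (rule nonincreasing_from_right_estimate[OF st(2)])
    fix x e :: real assume x: "s < x" "x \<le> t'" and e: "e > 0"
    define c where "c = V / W (\<mu> t')"
    have V: "0 < V" using range[of s] st by auto
    have Wt: "0 < W (\<mu> t')" using range[of t'] st by (intro W_pos) auto
    then have c: "0 < c" using V by (simp add: c_def)
    show "\<exists>d>0. \<forall>y. s \<le> y \<and> y < x \<and> x < y + d \<longrightarrow> Q x \<le> Q y + e"
    proof (intro exI[of _ "e / c"] conjI allI impI)
      show "0 < e / c" using e c by simp
      fix y assume y: "s \<le> y \<and> y < x \<and> x < y + e / c"
      define h where "h = x - y"
      have h: "0 < h" "y + h = x" "h * c \<le> e" "l < y" "x < M"
        using y c x st by (auto simp: h_def field_simps)
      have "(\<mu> y - \<mu> x) / W (\<mu> y) \<le> c"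
        unfolding c_def using range[of y] range[of x] range[of t'] mono[of y t'] h x y st Wt
        by (intro frac_le W_mono) auto
      then have "h * ((\<mu> y - \<mu> x) / W (\<mu> y)) \<le> h * c" using h by (intro mult_left_mono) auto
      then show "Q x \<le> Q y + e" using Q_step[of y h] h by simp
    qed
  next
    fix x e :: real assume x: "s \<le> x" "x < t'" and e: "e > 0"
    have lx: "l < x" "x < M" using x st by auto
    have near: "\<forall>\<^sub>F h in at_right 0. 0 < h \<and> x + h < M"
      unfolding eventually_at_right_field using lx by (intro exI[of _ "M - x"]) auto
    have Wx: "0 < W (\<mu> x)" using range[OF lx] by (intro W_pos) auto
    have "((\<lambda>h. (\<mu> x - \<mu> (x + h)) / W (\<mu> x)) \<longlongrightarrow> (\<mu> x - \<mu> x) / W (\<mu> x)) (at_right 0)"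
      using Wx by (intro tendsto_intros rc lx) auto
    then have "\<forall>\<^sub>F h in at_right 0. (\<mu> x - \<mu> (x + h)) / W (\<mu> x) < e"
      using e by (intro order_tendstoD) auto
    with near show "\<forall>\<^sub>F h in at_right 0. Q (x + h) \<le> Q x + e * h"
    proof eventually_elim
      case (elim h)
      have "h * ((\<mu> x - \<mu> (x + h)) / W (\<mu> x)) \<le> h * e" using elim by (intro mult_left_mono) auto
      then show ?case using Q_step[of x h] elim lx by (simp add: mult.commute)
    qed
  qed
  define m where "m = \<mu> t"
  have m: "0 < m" "m \<le> V" "0 < W m" using range[OF t] W_pos by (auto simp: m_def)
  have "s' \<le> Q t" if s': "t \<le> s'" "s' < M" for s'
  proof -
    have m': "0 < \<mu> s'" "\<mu> s' \<le> V" using range[of s'] t s' by auto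
    have "s' * W (\<mu> s') \<le> s' * \<mu> s'" using W_upper[of "\<mu> s'"] m' t s' l by (intro mult_left_mono) auto
    also have "\<dots> \<le> H s'" using H_bounds[of s'] t s' by auto
    finally have "s' \<le> Q s'" using W_pos[OF m'] by (simp add: Q_def le_divide_eq)
    then show ?thesis using Q_anti[of t s'] t s' by linarith
  qed
  then have ev: "\<forall>\<^sub>F s' in at_left M. s' \<le> Q t"
    unfolding eventually_at_left_field using t by (intro exI[of _ t]) auto
  have "((\<lambda>s'. s') \<longlongrightarrow> M) (at_left M)" by (intro tendsto_intros)
  then have "M \<le> Q t" using ev by (rule tendsto_upperbound) simp
  then have "M * W m * w m \<le> H t * w m"
    using m w[of m] by (intro mult_right_mono) (auto simp: Q_def m_def le_divide_eq)
  also have "\<dots> \<le> t * W m" using P_nonneg[OF t] by (simp add: P_def m_def)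
  finally have "W m * (M * w m) \<le> W m * t" by (simp add: mult_ac)
  then show ?thesis using m by (simp add: m_def)
qed

context superlevel_component
begin

text \<open>For the ball of volume \<open>x\<close> and radius \<open>r\<close>, \<open>kappa x powr
  (2/m)\<close> is \<open>lam r\<^sup>2/4\<close>, the argument of the series at the
  boundary.\<close>

definition kappa :: real where "kappa = lam / (4 * (root CARD('n) (unit_ball_vol CARD('n)))\<^sup>2)"

lemma root_ball_pos: "0 < root CARD('n) (unit_ball_vol (real CARD('n)))"
  by (intro real_root_gt_zero) (auto simp: unit_ball_vol_pos)

lemma kappa_pos: "kappa > 0"
  unfolding kappa_def using lam_pos root_ball_pos by (intro divide_pos_pos mult_pos_pos zero_less_power) auto

lemma mu_mono: "s \<le> t \<Longrightarrow> mu t \<le> mu s"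
  unfolding mu_def using superlevel_lmeasurable
  by (intro measure_mono_fmeasurable) (auto simp: fmeasurableD)

lemma mu_le: "mu s \<le> measure lebesgue C"
  unfolding mu_def using superlevel_lmeasurable lmeasurable_open[OF C(2,1)]
  by (intro measure_mono_fmeasurable) (auto simp: fmeasurableD)

lemma mu_pos:
  assumes "x \<in> C" "s < u x" shows "0 < mu s"
  unfolding mu_def using assms C(2) by (intro measure_open_pos open_superlevel) (auto intro: bounded_subset)

text \<open>The sets \<open>{u > s + h}\<close> increase to \<open>{u > s}\<close> as
  \<open>h\<close> decreases to \<open>0\<close>.\<close>

lemma mu_right_continuous: "((\<lambda>h. mu (s + h)) \<longlongrightarrow> mu s) (at_right 0)"
proof (rule tendsto_at_right_sequentially[OF zero_less_one])
  fix S :: "nat \<Rightarrow> real" assume S: "\<And>n. 0 < S n" "decseq S" "S \<longlonglongrightarrow> 0"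
  have "(\<lambda>n. measure lebesgue {x \<in> C. s + S n < u x}) \<longlonglongrightarrow> measure lebesgue (\<Union>n. {x \<in> C. s + S n < u x})"
  proof (rule measure_nested_Union[OF superlevel_lmeasurable])
    show "measure lebesgue {x \<in> C. s + S n < u x} \<le> measure lebesgue C" for n
      using mu_le by (simp add: mu_def)
    show "{x \<in> C. s + S n < u x} \<subseteq> {x \<in> C. s + S (Suc n) < u x}" for n
      using decseqD[OF S(2), of n "Suc n"] by auto
  qed
  moreover have "(\<Union>n. {x \<in> C. s + S n < u x}) = {x \<in> C. s < u x}"
  proof (intro equalityI subsetI)
    fix x assume x: "x \<in> {x \<in> C. s < u x}"
    then have "\<forall>\<^sub>F n in sequentially. S n < u x - s" using S(3) by (intro order_tendstoD) auto
    then obtain n where "S n < u x - s" by (auto simp: eventually_sequentially)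
    then have "x \<in> {x \<in> C. s + S n < u x}" using x by simp
    then show "x \<in> (\<Union>n. {x \<in> C. s + S n < u x})" by blast
  next
    fix x assume "x \<in> (\<Union>n. {x \<in> C. s + S n < u x})"
    then obtain n where "x \<in> C" "s + S n < u x" by blast
    then show "x \<in> {x \<in> C. s < u x}" using S(1)[of n] by simp
  qed
  ultimately show "(\<lambda>n. mu (s + S n)) \<longlonglongrightarrow> mu s" by (simp add: mu_def)
qed

lemma layer_integrals:
  "integrable lborel (indicat_real {x \<in> C. s < u x})" "(\<integral>x. indicat_real {x \<in> C. s < u x} x \<partial>lborel) = mu s"
  "integrable lborel (\<lambda>x. indicat_real {x \<in> C. s < u x} x * u x)"
proof -
  have "bounded {x \<in> C. s < u x}" using C(2) by (auto intro: bounded_subset)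
  then show "integrable lborel (indicat_real {x \<in> C. s < u x})"
    using emeasure_bounded_finite by (intro integrable_real_indicator) (auto simp: open_superlevel)
  show "(\<integral>x. indicat_real {x \<in> C. s < u x} x \<partial>lborel) = mu s" by (simp add: mu_def open_superlevel)
  show "integrable lborel (\<lambda>x. indicat_real {x \<in> C. s < u x} x * u x)"
    by (intro integrable_superlevel) (auto simp: open_superlevel)
qed

lemma mass_increment:
  assumes "s \<le> t"
  shows "s * (mu s - mu t) \<le> mass s - mass t" "mass s - mass t \<le> t * (mu s - mu t)"
proof -
  note I = layer_integrals
  let ?i = "\<lambda>s. indicat_real {x \<in> C. s < u x}"
  have mu: "c * (mu s - mu t) = (\<integral>x. c * (?i s x - ?i t x) \<partial>lborel)" for c
    using I(1)[of s] I(1)[of t] I(2)[of s] I(2)[of t] by simp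
  have mass: "mass s - mass t = (\<integral>x. ?i s x * u x - ?i t x * u x \<partial>lborel)"
    unfolding mass_def using I(3)[of s] I(3)[of t] by simp
  show "s * (mu s - mu t) \<le> mass s - mass t"
    unfolding mu mass
    by (intro integral_mono integrable_mult_right Bochner_Integration.integrable_diff I(1) I(3))
       (use assms in \<open>auto simp: indicator_def\<close>)
  show "mass s - mass t \<le> t * (mu s - mu t)"
    unfolding mu mass
    by (intro integral_mono integrable_mult_right Bochner_Integration.integrable_diff I(1) I(3))
       (use assms in \<open>auto simp: indicator_def\<close>)
qed

lemma mass_bounds:
  assumes M: "\<And>x. x \<in> C \<Longrightarrow> u x \<le> M"
  shows "s * mu s \<le> mass s" "mass s \<le> M * mu s"
proof -
  note I = layer_integrals[of s]
  have mu: "c * mu s = (\<integral>x. c * indicat_real {x \<in> C. s < u x} x \<partial>lborel)" for c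
    using I(1,2) by simp
  show "s * mu s \<le> mass s"
    unfolding mu mass_def
    by (intro integral_mono integrable_mult_right I(1) I(3)) (auto simp: indicator_def)
  show "mass s \<le> M * mu s"
    unfolding mu mass_def
    by (intro integral_mono integrable_mult_right I(1) I(3)) (use M in \<open>auto simp: indicator_def\<close>)
qed

text \<open>Talenti's inequality with the constants of the differential equation for
  \<open>W\<close>.\<close>

lemma talenti_powr:
  assumes "l < s" "0 < h" "0 < mu (s + h)"
  shows "h * mu (s + h) powr (2 - 1 / (real CARD('n) / 2))
       \<le> (mu s - mu (s + h)) * (kappa / (real CARD('n) / 2)\<^sup>2 * mass s)"
proof -
  let ?m = "real CARD('n)" and ?r = "root CARD('n) (unit_ball_vol CARD('n))"
  define q where "q = (?m * ?r)\<^sup>2"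
  have q: "q > 0" unfolding q_def using dim root_ball_pos by (intro zero_less_power mult_pos_pos) auto
  have "(root CARD('n) (mu (s + h)) ^ (CARD('n) - 1))\<^sup>2 = mu (s + h) powr (2 - 1 / (?m / 2))"
  proof -
    have "(root CARD('n) (mu (s + h)) ^ (CARD('n) - 1))\<^sup>2 = (mu (s + h) powr (1 / ?m)) ^ (2 * (CARD('n) - 1))"
      using assms(3) dim by (simp add: root_powr_inverse power_mult[symmetric] mult.commute)
    also have "\<dots> = mu (s + h) powr (1 / ?m * real (2 * (CARD('n) - 1)))"
      using assms(3) by (simp add: powr_realpow[symmetric] powr_powr del: of_nat_mult)
    also have "1 / ?m * real (2 * (CARD('n) - 1)) = 2 - 1 / (?m / 2)"
      using dim by (simp add: of_nat_diff field_simps)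
    finally show ?thesis .
  qed
  then have "q * (h * mu (s + h) powr (2 - 1 / (?m / 2))) \<le> (mu s - mu (s + h)) * (lam * mass s)"
    using talenti_inequality[OF assms(1,2)] by (simp add: q_def power_mult_distrib mult_ac)
  also have "\<dots> = q * ((mu s - mu (s + h)) * (kappa / (?m / 2)\<^sup>2 * mass s))"
  proof -
    have "lam = q * (kappa / (?m / 2)\<^sup>2)"
    proof -
      have "lam = (m * r)\<^sup>2 * (lam / (4 * r\<^sup>2) / (m / 2)\<^sup>2)" if "m \<noteq> 0" "r \<noteq> 0" for m r
        using that by (simp add: power_mult_distrib power_divide)
      from this[of ?m ?r] show ?thesis
        using dim root_ball_pos by (simp only: q_def kappa_def)
    qed
    moreover have "A * (lam * B) = q * (A * (K * B))" if "lam = q * K" for A B K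
      unfolding that by (simp only: mult_ac)
    ultimately show ?thesis by blast
  qed
  finally show ?thesis by (rule mult_left_le_imp_le) (rule q)
qed

text \<open>The comparison holds at every level above \<open>l\<close>; the profile decreases in the
  volume, so \<open>\<mu> t\<close> can be replaced by the volume of the component before the level
  tends to \<open>l\<close>.\<close>

theorem max_le_profile:
  assumes x0: "x0 \<in> C" "\<And>x. x \<in> C \<Longrightarrow> u x \<le> u x0"
    and small: "kappa * measure lebesgue C powr (1 / (real CARD('n) / 2)) < (Bessel_J_zero1 (nu CARD('n)))\<^sup>2 / 4"
  shows "u x0 * bessel_series (real CARD('n) / 2) (kappa * measure lebesgue C powr (1 / (real CARD('n) / 2))) \<le> l"
proof -
  define a where "a = real CARD('n) / 2"
  define V where "V = measure lebesgue C"
  define w where "w x = bessel_series a (kappa * x powr (1 / a))" for x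
  define W where "W x = x * bessel_series (a + 1) (kappa * x powr (1 / a))" for x
  have a: "a \<ge> 1" using dim by (simp add: a_def)
  have V: "0 < V" unfolding V_def by (rule measure_open_pos[OF C])
  have arg: "kappa * x powr (1 / a) \<le> kappa * y powr (1 / a)" if "0 \<le> x" "x \<le> y" for x y
    using that kappa_pos a by (intro mult_left_mono powr_mono2) auto
  have argV: "kappa * x powr (1 / a) < (Bessel_J_zero1 (nu CARD('n)))\<^sup>2 / 4" if "0 \<le> x" "x \<le> V" for x
    using arg[OF that] small by (simp add: a_def V_def)
  have arg0: "0 \<le> kappa * x powr (1 / a)" for x using kappa_pos by simp
  have w_anti: "w y \<le> w x" if xy: "0 \<le> x" "x \<le> y" "y \<le> V" for x y
  proof (cases "kappa * x powr (1 / a) = kappa * y powr (1 / a)")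
    case True
    then show ?thesis by (simp only: w_def)
  next
    case False
    then have "kappa * x powr (1 / a) < kappa * y powr (1 / a)" using arg[OF xy(1,2)] by linarith
    then show ?thesis
      unfolding w_def a_def
      using bessel_series_strict_decreasing[OF dim, of "kappa * x powr (1 / a)" "kappa * y powr (1 / a)"] arg0 argV[of y] xy
      by (simp add: a_def less_imp_le)
  qed
  have w0: "w 0 = 1" by (simp add: w_def)
  have w01: "0 < w x \<and> w x \<le> 1" if "0 \<le> x" "x \<le> V" for x
    using Bessel_J_zero1_series(3)[OF dim, of "kappa * x powr (1 / a)"] arg0 argV[OF that] w_anti[of 0 x] that w0
    by (simp add: w_def a_def)
  have DW: "(W has_real_derivative w x) (at x)"
    and Dw: "(w has_real_derivative - kappa / a\<^sup>2 * x powr (1 / a - 2) * W x) (at x)" if "0 < x" for x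
    using DERIV_powr_bessel_series[OF a kappa_pos that] unfolding W_def w_def .
  have contW: "continuous_on {0..V} W"
    unfolding W_def using a by (intro continuous_on_mult continuous_on_id continuous_on_bessel_series_powr) auto
  have mvtW: "\<exists>z>x. z < y \<and> W y - W x = (y - x) * w z" if "0 \<le> x" "x < y" "y \<le> V" for x y
  proof -
    have "\<exists>d z. x < z \<and> z < y \<and> DERIV W z :> d \<and> W y - W x = (y - x) * d"
    proof (rule MVT[OF that(2)])
      show "continuous_on {x..y} W" using contW by (rule continuous_on_subset) (use that in auto)
      show "W differentiable at z" if "x < z" "z < y" for z
        using DW[of z] that \<open>0 \<le> x\<close> by (auto simp: real_differentiable_def)
    qed
    then obtain d z where z: "x < z" "z < y" "DERIV W z :> d" "W y - W x = (y - x) * d" by blast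
    then have "d = w z" using DERIV_unique[OF z(3) DW] that by simp
    then show ?thesis using z by blast
  qed
  have W_incr: "(y - x) * w y \<le> W y - W x \<and> W y - W x \<le> (y - x) * w x" if xy: "0 \<le> x" "x \<le> y" "y \<le> V" for x y
  proof (cases "x = y")
    case False
    then obtain z where z: "x < z" "z < y" "W y - W x = (y - x) * w z" using mvtW[of x y] xy by auto
    have "(y - x) * w y \<le> (y - x) * w z" "(y - x) * w z \<le> (y - x) * w x"
      using z xy w_anti[of z y] w_anti[of x z] by (auto intro!: mult_left_mono)
    then show ?thesis using z by simp
  qed simp
  have W_mono: "W x \<le> W y" if "0 \<le> x" "x \<le> y" "y \<le> V" for x y
  proof -
    have "0 \<le> (y - x) * w y" using that w01[of y] by (intro mult_nonneg_nonneg) auto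
    then show ?thesis using W_incr[OF that] by linarith
  qed
  have W0: "W 0 = 0" by (simp add: W_def)
  have ode: "kappa / a\<^sup>2 * (y - x) * W x \<le> (w x - w y) * y powr (2 - 1 / a)" if xy: "0 < x" "x \<le> y" "y \<le> V" for x y
  proof (cases "x = y")
    case False
    then have "x < y" using xy by simp
    have "\<exists>d z. x < z \<and> z < y \<and> DERIV w z :> d \<and> w y - w x = (y - x) * d"
    proof (rule MVT[OF \<open>x < y\<close>])
      show "continuous_on {x..y} w"
        by (intro continuous_at_imp_continuous_on ballI DERIV_isCont[OF Dw]) (use xy in auto)
      show "w differentiable at z" if "x < z" "z < y" for z
        using Dw[of z] that xy by (auto simp: real_differentiable_def)
    qed
    then obtain d z where z: "x < z" "z < y" "DERIV w z :> d" "w y - w x = (y - x) * d" by blast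
    have d: "d = - kappa / a\<^sup>2 * z powr (1 / a - 2) * W z"
      using DERIV_unique[OF z(3) Dw] z xy by simp
    have "0 \<le> W x" using W_mono[of 0 x] W0 xy by simp
    have "1 / a \<le> 1" using a by simp
    have "1 = z powr (1 / a - 2) * z powr (2 - 1 / a)" using z xy by (simp add: powr_add[symmetric])
    also have "\<dots> \<le> z powr (1 / a - 2) * y powr (2 - 1 / a)"
      using z xy \<open>1 / a \<le> 1\<close> by (intro mult_left_mono powr_mono2) auto
    finally have p: "1 \<le> z powr (1 / a - 2) * y powr (2 - 1 / a)" .
    have "kappa / a\<^sup>2 * (y - x) * W x \<le> kappa / a\<^sup>2 * (y - x) * W z"
      using W_mono[of x z] z xy kappa_pos by (intro mult_left_mono) auto
    also have "\<dots> = kappa / a\<^sup>2 * (y - x) * W z * 1" by simp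
    also have "\<dots> \<le> kappa / a\<^sup>2 * (y - x) * W z * (z powr (1 / a - 2) * y powr (2 - 1 / a))"
      using p kappa_pos z xy W_mono[of 0 z] W0 by (intro mult_left_mono) auto
    also have "\<dots> = - ((y - x) * d) * y powr (2 - 1 / a)"
      unfolding d by (simp add: algebra_simps)
    also have "\<dots> = (w x - w y) * y powr (2 - 1 / a)" unfolding z(4)[symmetric] by simp
    finally show ?thesis .
  qed simp
  have main: "u x0 * w V \<le> t" if t: "l < t" "t < u x0" for t
  proof -
    have "u x0 * w (mu t) \<le> t"
    proof (rule sturm_comparison[where \<mu>=mu and H=mass and W=W and w=w and V=V and M="u x0" and l=l and p="2 - 1 / a" and b="kappa / a\<^sup>2"])
      show "0 \<le> l" "0 < kappa / a\<^sup>2" "l < t" "t < u x0" "0 \<le> 2 - 1 / a"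
        using l_nonneg kappa_pos a t by (auto simp: field_simps)
      show "0 < mu s \<and> mu s \<le> V" if "l < s" "s < u x0" for s
        using mu_pos[OF x0(1) that(2)] mu_le by (simp add: V_def)
      show "h * mu (s + h) powr (2 - 1 / a) \<le> (mu s - mu (s + h)) * (kappa / a\<^sup>2 * mass s)"
        if "l < s" "0 < h" "s + h < u x0" for s h
        unfolding a_def by (rule talenti_powr[OF that(1,2) mu_pos[OF x0(1) that(3)]])
    qed (use mu_mono mass_increment mass_bounds[OF x0(2)] mu_right_continuous w01 W0 W_incr ode in auto)
    moreover have "u x0 * w V \<le> u x0 * w (mu t)"
      using w_anti[of "mu t" V] mu_le[of t] mu_pos[OF x0(1) t(2)] above[OF x0(1)] l_nonneg
      by (intro mult_left_mono) (auto simp: V_def)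
    ultimately show ?thesis by linarith
  qed
  have "l < u x0" using above[OF x0(1)] .
  then have "\<forall>\<^sub>F t in at_right l. u x0 * w V \<le> t"
    unfolding eventually_at_right_field using main by blast
  moreover have "((\<lambda>t. t) \<longlongrightarrow> l) (at_right l)" by (intro tendsto_intros)
  ultimately have "u x0 * w V \<le> l" by (intro tendsto_lowerbound) auto
  then show ?thesis by (simp add: w_def V_def a_def)
qed

end

section \<open>The volume bound\<close>

context superlevel_component
begin

lemma max_attained: "\<exists>x\<in>C. \<forall>y\<in>C. u y \<le> u x"
proof -
  obtain y where y: "y \<in> C" using C(3) by blast
  define K where "K = {x \<in> C. u y \<le> u x}"
  have "compact K" unfolding K_def by (rule compact_superlevel[OF above[OF y]])
  moreover have "K \<noteq> {}" using y by (auto simp: K_def)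
  moreover have "continuous_on K u" by (rule continuous_on_subset[OF u_cont]) (auto simp: K_def)
  ultimately obtain x where x: "x \<in> K" "\<And>z. z \<in> K \<Longrightarrow> u z \<le> u x"
    using continuous_attains_sup[of K u] by blast
  have "u z \<le> u x" if "z \<in> C" for z
  proof (cases "z \<in> K")
    case False
    then have "u z < u y" using that by (auto simp: K_def)
    also have "u y \<le> u x" using x(1) by (simp add: K_def)
    finally show ?thesis by simp
  qed (rule x(2))
  then show ?thesis using x(1) by (auto simp: K_def)
qed

end

text \<open>Both branches of the definition of the bound are one formula in the root
  \<open>z\<close> of \<open>bessel_series a z = \<theta>\<close>; at \<open>\<theta> = 0\<close>
  the root is the first zero.\<close>

lemma level_volume_bound_eq:
  assumes m: "CARD('n::finite) \<ge> 2" and \<theta>: "0 \<le> \<theta>" "\<theta> < 1"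
  shows "\<exists>z. 0 < z \<and> z \<le> (Bessel_J_zero1 (nu CARD('n)))\<^sup>2 / 4 \<and> bessel_series (real CARD('n) / 2) z = \<theta>
    \<and> level_volume_bound TYPE('n) lam \<theta> = unit_ball_vol (real CARD('n)) * (4 * z / lam) powr (real CARD('n) / 2)"
proof -
  define z where "z = (if \<theta> = 0 then (Bessel_J_zero1 (nu CARD('n)))\<^sup>2 / 2 else level_beta CARD('n) \<theta>) / 2"
  have "0 < z \<and> z \<le> (Bessel_J_zero1 (nu CARD('n)))\<^sup>2 / 4 \<and> bessel_series (real CARD('n) / 2) z = \<theta>"
  proof (cases "\<theta> = 0")
    case True
    then show ?thesis using Bessel_J_zero1_series(1,2)[OF m] by (simp add: z_def)
  next
    case False
    then show ?thesis using level_beta_solves[OF m, of \<theta>] \<theta> by (simp add: z_def)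
  qed
  moreover have "level_volume_bound TYPE('n) lam \<theta> = unit_ball_vol (real CARD('n)) * (4 * z / lam) powr (real CARD('n) / 2)"
    unfolding level_volume_bound_def z_def by (simp add: content_ball)
  ultimately show ?thesis by blast
qed

context superlevel_component
begin

text \<open>If the volume were smaller, the radial profile at it would exceed \<open>l / u
  x0\<close>, against the previous comparison.\<close>

theorem volume_bound:
  assumes x0: "x0 \<in> C" "\<And>x. x \<in> C \<Longrightarrow> u x \<le> u x0"
  shows "level_volume_bound TYPE('n) lam (l / u x0) \<le> measure lebesgue C"
proof (rule ccontr)
  assume neg: "\<not> ?thesis"
  define a where "a = real CARD('n) / 2"
  have a: "a \<ge> 1" using dim by (simp add: a_def)
  have up: "0 < u x0" "l < u x0" using above[OF x0(1)] l_nonneg by auto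
  have "0 \<le> l / u x0" "l / u x0 < 1" using up l_nonneg by auto
  then obtain z where z: "0 < z" "z \<le> (Bessel_J_zero1 (nu CARD('n)))\<^sup>2 / 4" "bessel_series a z = l / u x0"
      "level_volume_bound TYPE('n) lam (l / u x0) = unit_ball_vol (real CARD('n)) * (4 * z / lam) powr a"
    using level_volume_bound_eq[OF dim, of "l / u x0" lam] unfolding a_def by blast
  define r where "r = root CARD('n) (unit_ball_vol (real CARD('n)))"
  have r: "r > 0" using root_ball_pos by (simp only: r_def)
  define V where "V = measure lebesgue C"
  have V: "0 \<le> V" by (simp add: V_def)
  have "unit_ball_vol (real CARD('n)) powr (1 / a) = r\<^sup>2"
  proof -
    have "unit_ball_vol (real CARD('n)) = r ^ CARD('n)" unfolding r_def by (simp add: real_root_pow_pos2)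
    also have "\<dots> = r powr (2 * a)" using r by (simp add: powr_realpow[symmetric] a_def)
    finally have "unit_ball_vol (real CARD('n)) powr (1 / a) = r powr (2 * a * (1 / a))" by (simp only: powr_powr)
    also have "2 * a * (1 / a) = real 2" using a by simp
    finally show ?thesis using powr_realpow[OF r, of 2] by simp
  qed
  moreover have "((4 * z / lam) powr a) powr (1 / a) = 4 * z / lam"
    using z lam_pos a by (simp add: powr_powr)
  ultimately have Bz: "level_volume_bound TYPE('n) lam (l / u x0) powr (1 / a) = r\<^sup>2 * (4 * z / lam)"
    unfolding z(4) using z lam_pos by (subst powr_mult) auto
  have "kappa * V powr (1 / a) < kappa * level_volume_bound TYPE('n) lam (l / u x0) powr (1 / a)"
    using neg V a kappa_pos by (intro mult_strict_left_mono powr_less_mono2) (auto simp: V_def)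
  also have "\<dots> = z" unfolding Bz kappa_def r_def[symmetric] using r lam_pos by simp
  finally have less: "kappa * V powr (1 / a) < z" .
  have "u x0 * bessel_series a (kappa * V powr (1 / a)) \<le> l"
    using max_le_profile[OF x0] less z(2) unfolding a_def V_def by linarith
  then have "bessel_series a (kappa * V powr (1 / a)) \<le> bessel_series a z"
    using up unfolding z(3) by (simp add: le_divide_eq mult.commute)
  moreover have "bessel_series a z < bessel_series a (kappa * V powr (1 / a))"
    unfolding a_def by (rule bessel_series_strict_decreasing[OF dim]) (use less z kappa_pos in \<open>auto simp: a_def\<close>)
  ultimately show False by simp
qed

end

lemma C2_on_subset: "C2_on S f \<Longrightarrow> T \<subseteq> S \<Longrightarrow> C2_on T f"
  unfolding C2_on_def C1_on_def by (meson continuous_on_subset subsetD)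

text \<open>On the frontier of a component the function equals \<open>l\<close>: inside
  \<open>\<Omega>\<close> a larger value would enlarge the component, and on the frontier of
  \<open>\<Omega>\<close> the boundary value \<open>0\<close> forces \<open>l = 0\<close>.\<close>

lemma component_superlevel_component:
  fixes \<Omega> :: "(real ^ 'n::finite) set"
  assumes "CARD('n) \<ge> 2" "lam > 0" "open \<Omega>" "dirichlet_helmholtz lam \<Omega> \<phi>" "0 \<le> l"
    and comp: "C \<in> components {x \<in> \<Omega>. \<phi> x > l}" and "bounded C"
  shows "superlevel_component C \<phi> l lam"
proof -
  define S where "S = {x \<in> \<Omega>. \<phi> x > l}"
  note comp = comp[folded S_def]
  have c2: "C2_on \<Omega> \<phi>" and cl: "continuous_on (closure \<Omega>) \<phi>"
    and pde: "\<forall>x\<in>\<Omega>. laplacian \<phi> x + lam * \<phi> x = 0" and bd: "\<forall>x\<in>frontier \<Omega>. \<phi> x = 0"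
    using assms(4) unfolding dirichlet_helmholtz_def by auto
  have cont: "continuous_on \<Omega> \<phi>" using cl closure_subset continuous_on_subset by blast
  have S: "open S"
    using continuous_open_preimage[OF cont assms(3) open_greaterThan[of l]] by (simp add: S_def vimage_def Int_def)
  have CS: "C \<subseteq> S" by (rule in_components_subset[OF comp])
  have C\<Omega>: "C \<subseteq> \<Omega>" using CS by (auto simp: S_def)
  have oC: "open C" by (rule open_components[OF S comp])
  have clC: "closure C \<subseteq> closure \<Omega>" by (rule closure_mono[OF C\<Omega>])
  have contC: "continuous_on (closure C) \<phi>" by (rule continuous_on_subset[OF cl clC])
  have bdry: "\<phi> x = l" if x: "x \<in> frontier C" for x
  proof -
    have xC: "x \<in> closure C" "x \<notin> C" using x oC by (auto simp: frontier_def interior_open)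
    have ge: "l \<le> \<phi> x"
    proof -
      have "closure C \<subseteq> {y \<in> closure C. l \<le> \<phi> y}"
      proof (rule closure_minimal)
        show "C \<subseteq> {y \<in> closure C. l \<le> \<phi> y}" using CS closure_subset by (force simp: S_def)
        show "closed {y \<in> closure C. l \<le> \<phi> y}"
          using continuous_closed_preimage[OF contC closed_closure closed_atLeast[of l]] by (simp add: vimage_def Int_def)
      qed
      then show ?thesis using xC by auto
    qed
    show ?thesis
    proof (cases "x \<in> \<Omega>")
      case True
      show ?thesis
      proof (rule ccontr)
        assume "\<phi> x \<noteq> l"
        then have "x \<in> S" using ge True by (simp add: S_def)
        have "connected (insert x C)"
          by (rule connected_intermediate_closure[OF in_components_connected[OF comp]]) (use xC closure_subset in auto)
        moreover have "insert x C \<subseteq> S" using CS \<open>x \<in> S\<close> by simp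
        moreover have "C \<inter> insert x C \<noteq> {}" using in_components_nonempty[OF comp] by auto
        ultimately have "insert x C \<subseteq> C" using components_maximal[OF comp] by blast
        then show False using xC by auto
      qed
    next
      case False
      then have "x \<in> frontier \<Omega>" using xC clC assms(3) by (auto simp: frontier_def interior_open)
      then have "\<phi> x = 0" using bd by blast
      then show ?thesis using ge assms(5) by simp
    qed
  qed
  show ?thesis
  proof
    show "C \<noteq> {}" by (rule in_components_nonempty[OF comp])
    show "C2_on C \<phi>" by (rule C2_on_subset[OF c2 C\<Omega>])
    show "laplacian \<phi> x + lam * \<phi> x = 0" if "x \<in> C" for x using pde that C\<Omega> by blast
    show "l < \<phi> x" if "x \<in> C" for x using that CS by (auto simp: S_def)
  qed (use oC contC bdry assms in auto)
qed

lemma C1_on_lincomb: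
  assumes "C1_on S f" "C1_on S g"
  shows "C1_on S (\<lambda>x. p * f x + q * g x)"
    "\<And>x. x \<in> S \<Longrightarrow> partial_deriv i (\<lambda>x. p * f x + q * g x) x = p * partial_deriv i f x + q * partial_deriv i g x"
proof -
  have D: "((\<lambda>t. p * f (x + t *\<^sub>R axis i 1) + q * g (x + t *\<^sub>R axis i 1)) has_real_derivative
      p * partial_deriv i f x + q * partial_deriv i g x) (at 0)" if "x \<in> S" for x i
    by (intro DERIV_add DERIV_cmult C1_on_DERIV[OF assms(1) that] C1_on_DERIV[OF assms(2) that])
  show eq: "partial_deriv i (\<lambda>x. p * f x + q * g x) x = p * partial_deriv i f x + q * partial_deriv i g x" if "x \<in> S" for x i
    unfolding partial_deriv_def[of i "\<lambda>x. p * f x + q * g x"] by (rule DERIV_imp_deriv[OF D[OF that]])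
  have c: "continuous_on S f" "continuous_on S g" "continuous_on S (partial_deriv i f)" "continuous_on S (partial_deriv i g)" for i
    using assms by (auto simp: C1_on_def)
  have "continuous_on S (partial_deriv i (\<lambda>x. p * f x + q * g x))" for i
  proof -
    have "continuous_on S (\<lambda>x. p * partial_deriv i f x + q * partial_deriv i g x)"
      by (intro continuous_on_add continuous_on_mult continuous_on_const c)
    then show ?thesis by (rule continuous_on_eq) (simp add: eq)
  qed
  moreover have "continuous_on S (\<lambda>x. p * f x + q * g x)"
    by (intro continuous_on_add continuous_on_mult continuous_on_const c)
  ultimately show "C1_on S (\<lambda>x. p * f x + q * g x)"
    unfolding C1_on_def using D field_differentiable_def by blast
qed

lemma C1_on_cong:
  assumes S: "open S" and f: "C1_on S f" and eq: "\<And>x. x \<in> S \<Longrightarrow> g x = f x"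
  shows "C1_on S g" "\<And>x. x \<in> S \<Longrightarrow> partial_deriv i g x = partial_deriv i f x"
proof -
  have D: "((\<lambda>t. g (x + t *\<^sub>R axis i 1)) has_real_derivative partial_deriv i f x) (at 0)" if "x \<in> S" for x i
  proof -
    have "((\<lambda>t. x + t *\<^sub>R axis i 1) \<longlongrightarrow> x + 0 *\<^sub>R axis i 1) (nhds (0::real))"
      by (intro tendsto_add tendsto_const tendsto_scaleR filterlim_ident)
    then have "\<forall>\<^sub>F t in nhds 0. x + t *\<^sub>R axis i 1 \<in> S"
      using S that by (intro topological_tendstoD) auto
    then have "\<forall>\<^sub>F t in nhds 0. g (x + t *\<^sub>R axis i 1) = f (x + t *\<^sub>R axis i 1)"
      by eventually_elim (rule eq)
    then show ?thesis
      using C1_on_DERIV[OF f that, of i] by (subst DERIV_cong_ev[OF refl _ refl])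
  qed
  show pe: "partial_deriv i g x = partial_deriv i f x" if "x \<in> S" for x i
    unfolding partial_deriv_def[of i g] by (rule DERIV_imp_deriv[OF D[OF that]])
  have cf: "continuous_on S f" "continuous_on S (partial_deriv i f)" for i
    using f by (auto simp: C1_on_def)
  have "continuous_on S g" by (rule continuous_on_eq[OF cf(1)]) (simp add: eq)
  moreover have "continuous_on S (partial_deriv i g)" for i
    by (rule continuous_on_eq[OF cf(2)]) (simp add: pe)
  ultimately show "C1_on S g" unfolding C1_on_def using D field_differentiable_def by blast
qed

lemma C2_on_lincomb:
  fixes f g :: "real ^ 'n::finite \<Rightarrow> real"
  assumes S: "open S" and f: "C2_on S f" and g: "C2_on S g"
  shows "C2_on S (\<lambda>x. p * f x + q * g x)"
    "\<And>x. x \<in> S \<Longrightarrow> laplacian (\<lambda>x. p * f x + q * g x) x = p * laplacian f x + q * laplacian g x"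
proof -
  have 1: "C1_on S f" "C1_on S g" "C1_on S (partial_deriv i f)" "C1_on S (partial_deriv i g)" for i
    using f g by (auto simp: C2_on_def)
  let ?h = "\<lambda>x. p * f x + q * g x"
  have e: "partial_deriv i ?h x = p * partial_deriv i f x + q * partial_deriv i g x" if "x \<in> S" for x i
    by (rule C1_on_lincomb(2)[OF 1(1,2) that])
  have c1: "C1_on S (partial_deriv i ?h)" for i
    by (rule C1_on_cong(1)[OF S C1_on_lincomb(1)[OF 1(3)[of i] 1(4)[of i]] e])
  then show "C2_on S ?h" unfolding C2_on_def using C1_on_lincomb(1)[OF 1(1,2)] by blast
  have "partial_deriv i (partial_deriv i ?h) x
      = p * partial_deriv i (partial_deriv i f) x + q * partial_deriv i (partial_deriv i g) x" if "x \<in> S" for x i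
    using C1_on_cong(2)[OF S C1_on_lincomb(1)[OF 1(3)[of i] 1(4)[of i]] e that, of i]
      C1_on_lincomb(2)[OF 1(3)[of i] 1(4)[of i] that, of i] by simp
  then show "laplacian ?h x = p * laplacian f x + q * laplacian g x" if "x \<in> S" for x
    using that by (simp add: laplacian_def sum.distrib sum_distrib_left)
qed

lemma dirichlet_helmholtz_lincomb:
  assumes "open \<Omega>" "dirichlet_helmholtz lam \<Omega> f" "dirichlet_helmholtz lam \<Omega> g"
  shows "dirichlet_helmholtz lam \<Omega> (\<lambda>x. p * f x + q * g x)"
proof -
  have c: "C2_on \<Omega> f" "C2_on \<Omega> g" "continuous_on (closure \<Omega>) f" "continuous_on (closure \<Omega>) g"
    using assms(2,3) by (auto simp: dirichlet_helmholtz_def)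
  have "laplacian (\<lambda>x. p * f x + q * g x) x + lam * (p * f x + q * g x) = 0" if x: "x \<in> \<Omega>" for x
  proof -
    have "laplacian f x = - lam * f x" "laplacian g x = - lam * g x"
      using assms(2,3) x by (auto simp: dirichlet_helmholtz_def add_eq_0_iff2)
    then show ?thesis using C2_on_lincomb(2)[OF assms(1) c(1,2) x, of p q] by (simp add: algebra_simps)
  qed
  moreover have "continuous_on (closure \<Omega>) (\<lambda>x. p * f x + q * g x)"
    by (intro continuous_on_add continuous_on_mult continuous_on_const c)
  ultimately show ?thesis
    using assms C2_on_lincomb(1)[OF assms(1) c(1,2)] by (auto simp: dirichlet_helmholtz_def)
qed

text \<open>The second derivative test along each coordinate axis.\<close>

lemma laplacian_nonpos_at_max:
  fixes w :: "real ^ 'n::finite \<Rightarrow> real"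
  assumes S: "open S" "x \<in> S" and w: "C2_on S w" and max: "\<And>y. y \<in> S \<Longrightarrow> w y \<le> w x"
  shows "laplacian w x \<le> 0"
  unfolding laplacian_def
proof (rule sum_nonpos)
  fix i :: 'n
  let ?g = "\<lambda>t. w (x + t *\<^sub>R axis i 1)" and ?g' = "\<lambda>t. partial_deriv i w (x + t *\<^sub>R axis i 1)"
  have 1: "C1_on S w" "C1_on S (partial_deriv i w)" using w by (auto simp: C2_on_def)
  obtain e where e: "e > 0" "ball x e \<subseteq> S" using S open_contains_ball by blast
  have inS: "x + t *\<^sub>R axis i 1 \<in> S" if "\<bar>t\<bar> < e" for t
    using e that by (intro subsetD[OF e(2)]) (simp add: dist_norm)
  have Dg: "(?g has_real_derivative ?g' t) (at t)" if "\<bar>t\<bar> < e" for t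
  proof -
    have "((\<lambda>s. w (x + (s + t) *\<^sub>R axis i 1)) has_real_derivative ?g' t) (at 0)"
      using C1_on_DERIV[OF 1(1) inS[OF that], of i] by (simp add: algebra_simps)
    then show ?thesis using DERIV_shift[of ?g "?g' t" 0 t] by simp
  qed
  have Dg': "(?g' has_real_derivative partial_deriv i (partial_deriv i w) x) (at 0)"
    by (rule C1_on_DERIV[OF 1(2) S(2)])
  have g0: "?g' 0 = 0"
    using DERIV_local_max[OF Dg[of 0] e(1)] e(1) max inS S(2) by auto
  show "partial_deriv i (partial_deriv i w) x \<le> 0"
  proof (rule ccontr)
    assume "\<not> ?thesis"
    then obtain d where d: "d > 0" "\<And>h. h > 0 \<Longrightarrow> h < d \<Longrightarrow> ?g' 0 < ?g' (0 + h)"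
      using DERIV_pos_inc_right[OF Dg'] by auto
    define t where "t = min d e / 2"
    have t: "0 < t" "t < d" "t < e" using d(1) e(1) by (auto simp: t_def)
    have "?g 0 < ?g t"
    proof (rule DERIV_pos_imp_increasing_open[OF t(1), where f="?g"])
      show "continuous_on {0..t} ?g"
        by (intro continuous_at_imp_continuous_on ballI DERIV_isCont[OF Dg]) (use t in auto)
      show "\<exists>y. (?g has_real_derivative y) (at s) \<and> 0 < y" if s: "0 < s" "s < t" for s
        using Dg[of s] d(2)[of s] g0 s t by (intro exI[of _ "?g' s"]) auto
    qed
    then show False using max[OF inS[of t]] t by simp
  qed
qed

section \<open>Radial solutions on balls\<close>

definition radial_helmholtz :: "real \<Rightarrow> real ^ 'n::finite \<Rightarrow> real" where
  "radial_helmholtz lam x = bessel_series (real CARD('n) / 2) (lam * (norm x)\<^sup>2 / 4)"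

lemma DERIV_radial_bessel_series:
  fixes x :: "real ^ 'n::finite"
  assumes "b \<ge> 1"
  shows "((\<lambda>t. bessel_series b (lam * (norm (x + t *\<^sub>R axis i 1))\<^sup>2 / 4)) has_real_derivative
     - bessel_series (b + 1) (lam * (norm x)\<^sup>2 / 4) / b * (lam * x $ i / 2)) (at 0)"
proof -
  have n: "(norm (x + t *\<^sub>R axis i 1))\<^sup>2 = (norm x)\<^sup>2 + 2 * t * x $ i + t\<^sup>2" for t
    unfolding power2_norm_eq_inner
    by (simp add: inner_add_left inner_add_right inner_axis inner_axis' inner_axis_axis power2_eq_square algebra_simps)
  have "((\<lambda>t. lam * (norm (x + t *\<^sub>R axis i 1))\<^sup>2 / 4) has_real_derivative lam * x $ i / 2) (at 0)"
    unfolding n by (auto intro!: derivative_eq_intros)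
  then have "((\<lambda>t. bessel_series b (lam * (norm (x + t *\<^sub>R axis i 1))\<^sup>2 / 4)) has_real_derivative
     - bessel_series (b + 1) (lam * (norm (x + 0 *\<^sub>R axis i 1))\<^sup>2 / 4) / b * (lam * x $ i / 2)) (at 0)"
    by (rule DERIV_chain2[OF DERIV_bessel_series[OF assms]])
  then show ?thesis by simp
qed

lemma continuous_radial_bessel_series:
  fixes S :: "(real ^ 'n::finite) set"
  assumes "b \<ge> 1"
  shows "continuous_on S (\<lambda>x. bessel_series b (lam * (norm x)\<^sup>2 / 4))"
proof -
  have "continuous_on UNIV (bessel_series b)"
    using isCont_bessel_series[OF assms] by (intro continuous_at_imp_continuous_on) auto
  moreover have "continuous_on S (\<lambda>x. lam * (norm x)\<^sup>2 / 4)" by (intro continuous_intros) auto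
  ultimately show ?thesis by (rule continuous_on_compose2) auto
qed

text \<open>The Laplacian of a function of the squared norm reduces the equation to the contiguous
  relation of the series.\<close>

lemma radial_helmholtz_C2:
  assumes m: "CARD('n::finite) \<ge> 2"
  shows "C2_on UNIV (radial_helmholtz lam :: real ^ 'n \<Rightarrow> real)"
    and "laplacian (radial_helmholtz lam) (x :: real ^ 'n) + lam * radial_helmholtz lam x = 0"
proof -
  define a where "a = real CARD('n) / 2"
  have a: "a \<ge> 1" using m by (simp add: a_def)
  define B where "B b x = bessel_series b (lam * (norm x)\<^sup>2 / 4)" for b and x :: "real ^ 'n"
  have rB: "radial_helmholtz lam = B a" by (simp add: radial_helmholtz_def B_def a_def fun_eq_iff)
  have DB: "((\<lambda>t. B b (x + t *\<^sub>R axis i 1)) has_real_derivative - B (b + 1) x / b * (lam * x $ i / 2)) (at 0)"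
    if "b \<ge> 1" for b x i
    unfolding B_def by (rule DERIV_radial_bessel_series[OF that])
  have cB: "continuous_on UNIV (B b)" if "b \<ge> 1" for b
    unfolding B_def by (rule continuous_radial_bessel_series[OF that])
  have p1: "partial_deriv i (B a) = (\<lambda>x. - (lam / (2 * a)) * (x $ i * B (a + 1) x))" for i
  proof
    show "partial_deriv i (B a) x = - (lam / (2 * a)) * (x $ i * B (a + 1) x)" for x
      unfolding partial_deriv_def using DERIV_imp_deriv[OF DB[OF a, of x i]] by (simp add: mult_ac)
  qed
  have Dj: "((\<lambda>t. - (lam / (2 * a)) * ((x + t *\<^sub>R axis j 1) $ i * B (a + 1) (x + t *\<^sub>R axis j 1))) has_real_derivative
      - (lam / (2 * a)) * ((if i = j then 1 else 0) * B (a + 1) x + (- B (a + 2) x / (a + 1) * (lam * x $ j / 2)) * x $ i)) (at 0)" for i j x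
  proof -
    have "((\<lambda>t. (x + t *\<^sub>R axis j 1) $ i) has_real_derivative (if i = j then 1 else 0)) (at 0)"
      by (auto intro!: derivative_eq_intros simp: axis_def)
    from DERIV_cmult[OF DERIV_mult[OF this DB[of "a + 1" x j]], of "- (lam / (2 * a))"]
    show ?thesis using a by (simp add: add.assoc axis_def)
  qed
  have p2: "partial_deriv j (partial_deriv i (B a)) = (\<lambda>x. - (lam / (2 * a)) * ((if i = j then 1 else 0) * B (a + 1) x + (- B (a + 2) x / (a + 1) * (lam * x $ j / 2)) * x $ i))" for i j
    unfolding p1 partial_deriv_def[of j] by (rule ext, rule DERIV_imp_deriv[OF Dj])
  have comp: "continuous_on UNIV (\<lambda>x :: real ^ 'n. x $ i)" for i by (intro continuous_intros)
  have c1: "continuous_on UNIV (\<lambda>x. - (lam / (2 * a)) * (x $ i * B (a + 1) x))" for i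
    using a by (intro continuous_on_mult continuous_on_const comp cB) auto
  have c2: "continuous_on UNIV (\<lambda>x. - (lam / (2 * a)) * ((if i = j then 1 else 0) * B (a + 1) x + (- B (a + 2) x / (a + 1) * (lam * x $ j / 2)) * x $ i))" for i j
    using a by (intro continuous_on_mult continuous_on_add continuous_on_divide continuous_on_minus continuous_on_const comp cB) auto
  have "C1_on UNIV (B a)"
    unfolding C1_on_def p1 using cB[OF a] c1 DB[OF a] field_differentiable_def by blast
  moreover have "C1_on UNIV (partial_deriv i (B a))" for i
    unfolding C1_on_def p2 unfolding p1 using c1 c2 Dj field_differentiable_def by blast
  ultimately show "C2_on UNIV (radial_helmholtz lam :: real ^ 'n \<Rightarrow> real)"
    unfolding rB C2_on_def by blast
  define z where "z = lam * (norm x)\<^sup>2 / 4"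
  have "laplacian (B a) x = (\<Sum>i\<in>UNIV. - (lam / (2 * a)) * B (a + 1) x + lam\<^sup>2 / (4 * a * (a + 1)) * B (a + 2) x * (x $ i)\<^sup>2)"
    unfolding laplacian_def p2 using a by (intro sum.cong refl) (simp add: power2_eq_square algebra_simps)
  also have "\<dots> = - (lam / (2 * a)) * B (a + 1) x * (2 * a) + lam\<^sup>2 / (4 * a * (a + 1)) * B (a + 2) x * (norm x)\<^sup>2"
  proof -
    have "(norm x)\<^sup>2 = (\<Sum>i\<in>UNIV. (x $ i)\<^sup>2)" unfolding norm_vec_def L2_set_def by (simp add: sum_nonneg)
    moreover have "(\<Sum>i\<in>(UNIV :: 'n set). c) = c * (2 * a)" for c :: real by (simp add: a_def)
    ultimately show ?thesis by (simp only: sum.distrib sum_distrib_left[symmetric])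
  qed
  also have "\<dots> = - lam * B (a + 1) x + lam / (a * (a + 1)) * (z * B (a + 2) x)"
    using a by (simp add: z_def power2_eq_square mult_ac)
  also have "z * B (a + 2) x = a * (a + 1) * (B (a + 1) x - B a x)"
    unfolding B_def z_def by (rule bessel_series_contiguous[OF a, symmetric])
  also have "- lam * B (a + 1) x + lam / (a * (a + 1)) * (a * (a + 1) * (B (a + 1) x - B a x)) = - lam * B a x"
  proof -
    have cancel: "c / k * (k * D) = c * D" if "k \<noteq> 0" for c k D :: real using that by simp
    have "a * (a + 1) \<noteq> 0" using a by simp
    from cancel[OF this, of lam "B (a + 1) x - B a x"] show ?thesis by (simp only:) (simp add: right_diff_distrib)
  qed
  finally show "laplacian (radial_helmholtz lam) x + lam * radial_helmholtz lam x = 0"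
    unfolding rB by simp
qed

lemma open_strict_superlevel:
  fixes f :: "'a::topological_space \<Rightarrow> real"
  assumes "open S" "continuous_on S f"
  shows "open {x \<in> S. c < f x}"
  using continuous_open_preimage[OF assms(2,1) open_greaterThan[of c]] by (simp add: vimage_def Int_def)

lemma radial_helmholtz_0 [simp]: "radial_helmholtz lam 0 = 1"
  by (simp add: radial_helmholtz_def)

lemma radial_helmholtz_pos:
  fixes x :: "real ^ 'n::finite"
  assumes "CARD('n) \<ge> 2" "lam \<ge> 0" "lam * (norm x)\<^sup>2 < (Bessel_J_zero1 (nu CARD('n)))\<^sup>2"
  shows "0 < radial_helmholtz lam x"
  unfolding radial_helmholtz_def using assms by (intro Bessel_J_zero1_series(3)) auto

lemma continuous_radial_helmholtz:
  assumes "CARD('n::finite) \<ge> 2"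
  shows "continuous_on S (radial_helmholtz lam :: real ^ 'n \<Rightarrow> real)"
proof -
  have "(1::real) \<le> real CARD('n) / 2" using assms by simp
  from continuous_radial_bessel_series[OF this, where 'n='n and S=S and lam=lam]
  show ?thesis by (simp add: radial_helmholtz_def[abs_def])
qed

text \<open>The eigenvalue \<open>lam\<close> is placed strictly between \<open>\<mu>\<close> and
  the first eigenvalue of the ball, so the radial solution \<open>\<Phi>\<close> for
  \<open>lam\<close> is positive on the closed ball. At a positive maximum \<open>k\<close> of
  \<open>u / \<Phi>\<close> the difference \<open>u - k \<Phi>\<close> has a maximum, but its
  Laplacian there is \<open>k \<Phi> (lam - \<mu>) > 0\<close>.\<close>

lemma dirichlet_nonpos_below_first_zero:
  fixes u :: "real ^ 'n::finite \<Rightarrow> real"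
  assumes m: "CARD('n) \<ge> 2" and r: "r > 0" and u: "dirichlet_helmholtz \<mu> (ball 0 r) u"
    and \<mu>: "\<mu> * r\<^sup>2 < (Bessel_J_zero1 (nu CARD('n)))\<^sup>2" and x1: "x1 \<in> ball 0 r"
  shows "u x1 \<le> 0"
proof (rule ccontr)
  assume "\<not> u x1 \<le> 0"
  then have x1pos: "0 < u x1" by simp
  define j where "j = Bessel_J_zero1 (nu CARD('n))"
  have j: "0 < j" unfolding j_def by (rule Bessel_J_zero1_series(1)[OF m])
  define lam where "lam = (max \<mu> 0 + (j / r)\<^sup>2) / 2"
  have top: "max \<mu> 0 < (j / r)\<^sup>2"
    using \<mu> j r by (auto simp: j_def[symmetric] power_divide field_simps)
  have "\<mu> \<le> max \<mu> 0" "0 \<le> max \<mu> 0" "0 < (j / r)\<^sup>2" using j r by auto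
  moreover have "\<mu> < (X + P) / 2 \<and> 0 < (X + P) / 2 \<and> (X + P) / 2 < P"
    if "\<mu> \<le> X" "0 \<le> X" "0 < P" "X < P" for X P using that by auto
  ultimately have lam: "\<mu> < lam" "0 < lam" "lam < (j / r)\<^sup>2" using top unfolding lam_def by blast+
  have "lam * r\<^sup>2 < (j / r)\<^sup>2 * r\<^sup>2" using lam(3) r by (intro mult_strict_right_mono) auto
  then have lam_r: "lam * r\<^sup>2 < j\<^sup>2" using r by (simp add: power_divide)
  define \<Phi> :: "real ^ 'n \<Rightarrow> real" where "\<Phi> = radial_helmholtz lam"
  have \<Phi>pos: "0 < \<Phi> x" if "x \<in> cball 0 r" for x
  proof -
    have "lam * (norm x)\<^sup>2 \<le> lam * r\<^sup>2" using that lam(2) by (intro mult_left_mono power_mono) auto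
    then have "lam * (norm x)\<^sup>2 < (Bessel_J_zero1 (nu CARD('n)))\<^sup>2" using lam_r unfolding j_def by linarith
    then show ?thesis unfolding \<Phi>_def using lam(2) by (intro radial_helmholtz_pos[OF m]) auto
  qed
  have cl: "closure (ball (0 :: real ^ 'n) r) = cball 0 r" using r by simp
  have uc: "continuous_on (cball 0 r) u" and u2: "C2_on (ball 0 r) u"
    and up: "\<forall>x\<in>ball 0 r. laplacian u x + \<mu> * u x = 0" and ub: "\<forall>x\<in>sphere 0 r. u x = 0"
    using u r unfolding dirichlet_helmholtz_def cl by (auto simp: frontier_ball)
  have \<Phi>c: "continuous_on (cball 0 r) \<Phi>" unfolding \<Phi>_def by (rule continuous_radial_helmholtz[OF m])
  have "continuous_on (cball 0 r) (\<lambda>x. u x / \<Phi> x)"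
    by (rule continuous_on_divide[OF uc \<Phi>c]) (use \<Phi>pos in force)
  then obtain x0 where x0: "x0 \<in> cball 0 r" "\<And>x. x \<in> cball 0 r \<Longrightarrow> u x / \<Phi> x \<le> u x0 / \<Phi> x0"
    using continuous_attains_sup[OF compact_cball, of 0 r "\<lambda>x. u x / \<Phi> x"] r by auto
  define k where "k = u x0 / \<Phi> x0"
  have x1c: "x1 \<in> cball 0 r" using x1 by simp
  have "0 < u x1 / \<Phi> x1" using x1pos \<Phi>pos[OF x1c] by simp
  then have k: "0 < k" using x0(2)[OF x1c] by (simp add: k_def)
  then have "u x0 \<noteq> 0" by (auto simp: k_def)
  then have x0b: "x0 \<in> ball 0 r" using ub x0(1) by (cases "norm x0 = r") auto
  define w where "w = (\<lambda>x. 1 * u x + (- k) * \<Phi> x)"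
  have \<Phi>2: "C2_on (ball 0 r) \<Phi>"
    unfolding \<Phi>_def by (rule C2_on_subset[OF radial_helmholtz_C2(1)[OF m]]) simp
  note L = C2_on_lincomb[OF open_ball u2 \<Phi>2, where p=1 and q="- k", folded w_def]
  have w0: "w x0 = 0" using \<Phi>pos[OF x0(1)] by (simp add: w_def k_def)
  have "laplacian w x0 \<le> 0"
  proof (rule laplacian_nonpos_at_max[OF open_ball x0b L(1)])
    fix y :: "real ^ 'n" assume "y \<in> ball 0 r"
    then have y: "y \<in> cball 0 r" by simp
    have "u y / \<Phi> y \<le> k" using x0(2)[OF y] by (simp add: k_def)
    then have "u y \<le> k * \<Phi> y" using \<Phi>pos[OF y] by (simp add: divide_le_eq)
    then show "w y \<le> w x0" unfolding w0 by (simp add: w_def)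
  qed
  moreover have "laplacian w x0 = k * \<Phi> x0 * (lam - \<mu>)"
  proof -
    have "laplacian u x0 = - \<mu> * u x0" using up x0b by (auto simp: add_eq_0_iff2)
    moreover have "laplacian \<Phi> x0 = - lam * \<Phi> x0"
      using radial_helmholtz_C2(2)[OF m, of lam x0] by (simp add: \<Phi>_def add_eq_0_iff2)
    moreover have "u x0 = k * \<Phi> x0" using w0 by (simp add: w_def)
    ultimately show ?thesis using L(2)[OF x0b] by (simp add: algebra_simps)
  qed
  moreover have "0 < k * \<Phi> x0 * (lam - \<mu>)" using k \<Phi>pos[OF x0(1)] lam(1) by simp
  ultimately show False by simp
qed

lemma dirichlet_eq_0_below_first_zero:
  fixes u :: "real ^ 'n::finite \<Rightarrow> real"
  assumes m: "CARD('n) \<ge> 2" and r: "r > 0" and u: "dirichlet_helmholtz \<mu> (ball 0 r) u"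
    and \<mu>: "\<mu> * r\<^sup>2 < (Bessel_J_zero1 (nu CARD('n)))\<^sup>2" and x: "x \<in> ball 0 r"
  shows "u x = 0"
proof -
  have "u x \<le> 0" by (rule dirichlet_nonpos_below_first_zero[OF m r u \<mu> x])
  moreover have "(-1) * u x + 0 * u x \<le> 0"
    by (rule dirichlet_nonpos_below_first_zero[OF m r dirichlet_helmholtz_lincomb[OF open_ball u u] \<mu> x])
  ultimately show ?thesis by simp
qed

lemma radial_helmholtz_dirichlet:
  assumes m: "CARD('n::finite) \<ge> 2" and R: "R > 0" "lam * R\<^sup>2 = (Bessel_J_zero1 (nu CARD('n)))\<^sup>2"
  shows "dirichlet_helmholtz lam (ball 0 R) (radial_helmholtz lam :: real ^ 'n \<Rightarrow> real)"
  unfolding dirichlet_helmholtz_def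
proof (intro conjI ballI)
  show "C2_on (ball 0 R) (radial_helmholtz lam :: real ^ 'n \<Rightarrow> real)"
    by (rule C2_on_subset[OF radial_helmholtz_C2(1)[OF m]]) simp
  show "continuous_on (closure (ball 0 R)) (radial_helmholtz lam :: real ^ 'n \<Rightarrow> real)"
    by (rule continuous_radial_helmholtz[OF m])
  fix x :: "real ^ 'n"
  show "laplacian (radial_helmholtz lam) x + lam * radial_helmholtz lam x = 0"
    by (rule radial_helmholtz_C2(2)[OF m])
  assume "x \<in> frontier (ball 0 R)"
  then have "norm x = R" using R(1) by (simp add: frontier_ball)
  then show "radial_helmholtz lam x = 0"
    using Bessel_J_zero1_series(2)[OF m] R(2) by (simp add: radial_helmholtz_def)
qed

text \<open>The superlevel sets of the radial solution inside the first nodal ball are balls, and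
  their volume attains the bound.\<close>

lemma radial_helmholtz_levels:
  assumes m: "CARD('n::finite) \<ge> 2" and lam: "lam > 0" and \<theta>: "0 \<le> \<theta>" "\<theta> < 1"
  defines "R \<equiv> Bessel_J_zero1 (nu CARD('n)) / sqrt lam"
  shows "\<exists>\<rho>. 0 < \<rho> \<and> \<rho> \<le> R \<and> (\<forall>x :: real ^ 'n. norm x \<le> R \<longrightarrow> \<theta> < radial_helmholtz lam x \<longleftrightarrow> norm x < \<rho>) \<and>
    (\<forall>x :: real ^ 'n. norm x = \<rho> \<longrightarrow> radial_helmholtz lam x = \<theta>) \<and>
    measure lebesgue (ball (0 :: real ^ 'n) \<rho>) = level_volume_bound TYPE('n) lam \<theta>"
proof -
  define j where "j = Bessel_J_zero1 (nu CARD('n))"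
  have j: "0 < j" unfolding j_def by (rule Bessel_J_zero1_series(1)[OF m])
  obtain z where z: "0 < z" "z \<le> j\<^sup>2 / 4" "bessel_series (real CARD('n) / 2) z = \<theta>"
      "level_volume_bound TYPE('n) lam \<theta> = unit_ball_vol (real CARD('n)) * (4 * z / lam) powr (real CARD('n) / 2)"
    using level_volume_bound_eq[OF m \<theta>, of lam] unfolding j_def by blast
  define \<rho> where "\<rho> = sqrt (4 * z / lam)"
  have \<rho>: "0 < \<rho>" "lam * \<rho>\<^sup>2 / 4 = z" using z lam by (auto simp: \<rho>_def)
  have R: "0 < R" "lam * R\<^sup>2 / 4 = j\<^sup>2 / 4" using j lam by (auto simp: R_def j_def[symmetric] power_divide)
  have cmp: "lam * s\<^sup>2 / 4 < lam * t\<^sup>2 / 4" if "0 \<le> s" "s < t" for s t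
    using that lam power_strict_mono[of s t 2] by simp
  have "\<rho> \<le> R"
  proof (rule ccontr)
    assume "\<not> \<rho> \<le> R"
    then show False using cmp[of R \<rho>] R z \<rho> by simp
  qed
  moreover have "\<theta> < radial_helmholtz lam x \<longleftrightarrow> norm x < \<rho>" if x: "norm x \<le> R" for x :: "real ^ 'n"
  proof -
    have xz: "lam * (norm x)\<^sup>2 / 4 \<le> j\<^sup>2 / 4" using cmp[of "norm x" R] x R by (cases "norm x = R") auto
    consider "norm x < \<rho>" | "norm x = \<rho>" | "\<rho> < norm x" by linarith
    then show ?thesis
    proof cases
      case 1
      then have "bessel_series (real CARD('n) / 2) z < bessel_series (real CARD('n) / 2) (lam * (norm x)\<^sup>2 / 4)"
        using cmp[of "norm x" \<rho>] \<rho> z lam by (intro bessel_series_strict_decreasing[OF m]) (auto simp: j_def)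
      then show ?thesis using 1 z(3) by (simp add: radial_helmholtz_def)
    next
      case 2
      then show ?thesis using z(3) \<rho> by (simp add: radial_helmholtz_def)
    next
      case 3
      then have "bessel_series (real CARD('n) / 2) (lam * (norm x)\<^sup>2 / 4) < bessel_series (real CARD('n) / 2) z"
        using cmp[of \<rho> "norm x"] \<rho> z xz by (intro bessel_series_strict_decreasing[OF m]) (auto simp: j_def)
      then show ?thesis using 3 z(3) by (simp add: radial_helmholtz_def)
    qed
  qed
  moreover have "radial_helmholtz lam x = \<theta>" if "norm x = \<rho>" for x :: "real ^ 'n"
    using that \<rho> z(3) by (simp add: radial_helmholtz_def)
  moreover have "measure lebesgue (ball (0 :: real ^ 'n) \<rho>) = level_volume_bound TYPE('n) lam \<theta>"
  proof -
    have "(4 * z / lam) powr (real CARD('n) / 2) = ((4 * z / lam) powr (1 / 2)) powr real CARD('n)"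
      by (simp add: powr_powr)
    also have "\<dots> = \<rho> ^ CARD('n)"
      using z lam \<rho>(1) by (simp add: \<rho>_def powr_half_sqrt powr_realpow)
    finally show ?thesis using \<rho>(1) by (simp add: z(4) content_ball)
  qed
  ultimately show ?thesis using \<rho>(1) by blast
qed

text \<open>On a sphere both functions are constant, so some multiple of the explicit solution
  agrees with \<open>\<phi>\<close> there. The difference is a Dirichlet solution on a ball smaller
  than the first nodal ball and hence vanishes.\<close>

lemma regular_radial_helmholtz_unique:
  fixes \<phi> :: "real ^ 'n::finite \<Rightarrow> real"
  assumes m: "CARD('n) \<ge> 2" and lam: "lam > 0" and \<phi>: "regular_radial_helmholtz lam \<phi>"
    and x: "norm x \<le> Bessel_J_zero1 (nu CARD('n)) / sqrt lam"
  shows "\<phi> x = \<phi> 0 * radial_helmholtz lam x"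
proof -
  define j where "j = Bessel_J_zero1 (nu CARD('n))"
  define R where "R = j / sqrt lam"
  have j: "0 < j" unfolding j_def by (rule Bessel_J_zero1_series(1)[OF m])
  have R: "0 < R" "lam * R\<^sup>2 = j\<^sup>2" using j lam by (auto simp: R_def power_divide)
  let ?F = "radial_helmholtz lam :: real ^ 'n \<Rightarrow> real"
  have \<phi>2: "C2_on UNIV \<phi>" and pde: "\<And>x. laplacian \<phi> x + lam * \<phi> x = 0" and rad: "\<And>x y. norm x = norm y \<Longrightarrow> \<phi> x = \<phi> y"
    using \<phi> unfolding regular_radial_helmholtz_def by blast+
  have \<phi>c: "continuous_on S \<phi>" for S
    using \<phi>2 by (auto simp: C2_on_def C1_on_def intro: continuous_on_subset)
  have inside: "\<phi> y = \<phi> 0 * ?F y" if y: "norm y < R" for y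
  proof -
    define r where "r = (norm y + R) / 2"
    have r: "0 < r" "norm y < r" "r < R" 
    proof -
      have "0 < (n + R) / 2 \<and> n < (n + R) / 2 \<and> (n + R) / 2 < R" if "0 \<le> n" "n < R" for n
        using that by auto
      from this[OF norm_ge_zero y] show "0 < r" "norm y < r" "r < R" unfolding r_def by blast+
    qed
    have lr: "lam * r\<^sup>2 < j\<^sup>2"
      using power_strict_mono[of r R 2] r lam unfolding R(2)[symmetric] by simp
    obtain e :: "real ^ 'n" where e: "norm e = r"
      using vector_choose_size[of r] r by auto
    have Fe: "0 < ?F e" using lr lam e by (intro radial_helmholtz_pos[OF m]) (auto simp: j_def)
    define k where "k = \<phi> e / ?F e"
    define v where "v = (\<lambda>x. 1 * \<phi> x + (- k) * ?F x)"
    note L = C2_on_lincomb[OF open_UNIV \<phi>2 radial_helmholtz_C2(1)[OF m, of lam], where p=1 and q="- k", folded v_def]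
    have "dirichlet_helmholtz lam (ball 0 r) v"
      unfolding dirichlet_helmholtz_def
    proof (intro conjI ballI)
      show "C2_on (ball 0 r) v" by (rule C2_on_subset[OF L(1)]) simp
      show "continuous_on (closure (ball 0 r)) v"
        unfolding v_def
        by (intro continuous_on_add continuous_on_mult continuous_on_const \<phi>c continuous_radial_helmholtz[OF m])
      show "laplacian v x + lam * v x = 0" for x
        using L(2)[of x] pde[of x] radial_helmholtz_C2(2)[OF m, of lam x]
        by (simp add: v_def add_eq_0_iff2 algebra_simps)
      show "v x = 0" if "x \<in> frontier (ball 0 r)" for x
      proof -
        have "norm x = r" using that r by (simp add: frontier_ball)
        then have "\<phi> x = \<phi> e" "?F x = ?F e" using rad[of x e] e by (auto simp: radial_helmholtz_def)
        then show ?thesis using Fe by (simp add: v_def k_def)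
      qed
    qed
    then have "v x = 0" if "x \<in> ball 0 r" for x
      using dirichlet_eq_0_below_first_zero[OF m r(1) _ _ that] lr by (simp add: j_def)
    from this[of y] this[of 0] show ?thesis using r by (simp add: v_def)
  qed
  have "x \<in> closure (ball 0 R)" using x R(1) by (simp add: R_def j_def)
  then have "1 * \<phi> x + (- \<phi> 0) * ?F x = 0"
  proof (rule continuous_constant_on_closure[rotated 2])
    show "continuous_on (closure (ball 0 R)) (\<lambda>x. 1 * \<phi> x + (- \<phi> 0) * ?F x)"
      by (intro continuous_on_add continuous_on_mult continuous_on_const \<phi>c continuous_radial_helmholtz[OF m])
    show "1 * \<phi> x + (- \<phi> 0) * ?F x = 0" if "x \<in> ball 0 R" for x
      using inside[of x] that by simp
  qed
  then show ?thesis by simp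
qed

text \<open>The volume bound at level zero for a component of the positive set: that component fills
  the ball up to a null set.\<close>

lemma positive_part_volume:
  fixes v :: "real ^ 'n::finite \<Rightarrow> real"
  assumes m: "CARD('n) \<ge> 2" and lam: "lam > 0" and R: "R > 0" "lam * R\<^sup>2 = (Bessel_J_zero1 (nu CARD('n)))\<^sup>2"
    and v: "dirichlet_helmholtz lam (ball 0 R) v" and p: "p \<in> ball 0 R" "v p > 0"
  shows "measure lebesgue (ball (0 :: real ^ 'n) R) \<le> measure lebesgue {x \<in> ball 0 R. v x > 0}"
proof -
  let ?S = "{x \<in> ball 0 R. v x > 0}"
  define C where "C = connected_component_set ?S p"
  have pC: "p \<in> C" and comp: "C \<in> components ?S"
    using p by (auto simp: C_def components_def connected_component_refl)
  have CS: "C \<subseteq> ?S" by (rule in_components_subset[OF comp])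
  have bC: "bounded C" by (rule bounded_subset[OF bounded_ball[of 0 R]]) (use CS in auto)
  interpret superlevel_component C v 0 lam
    by (rule component_superlevel_component[OF m lam open_ball v order_refl comp bC])
  obtain x0 where x0: "x0 \<in> C" "\<And>x. x \<in> C \<Longrightarrow> v x \<le> v x0" using max_attained by blast
  have b: "level_volume_bound TYPE('n) lam 0 \<le> measure lebesgue C"
    using volume_bound[OF x0] by simp
  have RR: "R = Bessel_J_zero1 (nu CARD('n)) / sqrt lam"
  proof -
    have "sqrt (lam * R\<^sup>2) = sqrt ((Bessel_J_zero1 (nu CARD('n)))\<^sup>2)" by (simp only: R(2))
    then show ?thesis using lam R(1) Bessel_J_zero1_series(1)[OF m] by (simp add: real_sqrt_mult field_simps)
  qed
  have "(Bessel_J_zero1 (nu CARD('n)))\<^sup>2 / lam = R\<^sup>2" using R(2) lam by (simp add: field_simps)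
  then have "level_volume_bound TYPE('n) lam 0 = unit_ball_vol (real CARD('n)) * (R\<^sup>2) powr (real CARD('n) / 2)"
    by (simp add: level_volume_bound_def content_ball)
  also have "(R\<^sup>2) powr (real CARD('n) / 2) = R ^ CARD('n)"
    using R(1) by (simp add: powr_powr powr_realpow[symmetric] powr_numeral[symmetric] del: powr_numeral)
  also have "unit_ball_vol (real CARD('n)) * R ^ CARD('n) = measure lebesgue (ball (0 :: real ^ 'n) R)"
    using R(1) by (simp add: content_ball)
  finally have "measure lebesgue (ball (0 :: real ^ 'n) R) \<le> measure lebesgue C" using b by simp
  also have "\<dots> \<le> measure lebesgue ?S"
  proof (rule measure_mono_fmeasurable[OF CS])
    show "C \<in> sets lebesgue" using C(1) by simp
    have "continuous_on (ball 0 R) v" using v by (auto simp: dirichlet_helmholtz_def C2_on_def C1_on_def)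
    then have "open ?S" by (rule open_strict_superlevel[OF open_ball])
    then show "?S \<in> lmeasurable"
      by (intro lmeasurable_open bounded_subset[OF bounded_ball[of 0 R]]) auto
  qed
  finally show ?thesis .
qed

text \<open>If \<open>u / F\<close> took two different values, a combination \<open>u - k F\<close>
  with \<open>k\<close> between them would change sign. Its positive and its negative set would be
  disjoint, and each of full volume.\<close>

lemma first_eigenfunction_radial:
  fixes u :: "real ^ 'n::finite \<Rightarrow> real"
  assumes m: "CARD('n) \<ge> 2" and lam: "lam > 0" and R: "R > 0"
    and u: "first_dirichlet_eigenfunction (ball 0 R) lam u"
  shows "R = Bessel_J_zero1 (nu CARD('n)) / sqrt lam" "\<And>x. x \<in> ball 0 R \<Longrightarrow> u x = u 0 * radial_helmholtz lam x"
proof -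
  define j where "j = Bessel_J_zero1 (nu CARD('n))"
  have j: "0 < j" unfolding j_def by (rule Bessel_J_zero1_series(1)[OF m])
  have ud: "dirichlet_helmholtz lam (ball 0 R) u" and un: "\<exists>x\<in>ball 0 R. u x \<noteq> 0"
    and least: "\<And>\<mu> (v :: real ^ 'n \<Rightarrow> real). dirichlet_helmholtz \<mu> (ball 0 R) v \<Longrightarrow> \<exists>x\<in>ball 0 R. v x \<noteq> 0 \<Longrightarrow> lam \<le> \<mu>"
    using u unfolding first_dirichlet_eigenfunction_def by blast+
  have ge: "j\<^sup>2 \<le> lam * R\<^sup>2"
    using dirichlet_eq_0_below_first_zero[OF m R ud] un unfolding j_def by (meson not_le)
  have "(j / R)\<^sup>2 * R\<^sup>2 = j\<^sup>2" using R by (simp add: power_divide)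
  then have "dirichlet_helmholtz ((j / R)\<^sup>2) (ball 0 R) (radial_helmholtz ((j / R)\<^sup>2) :: real ^ 'n \<Rightarrow> real)"
    unfolding j_def by (rule radial_helmholtz_dirichlet[OF m R])
  then have "lam \<le> (j / R)\<^sup>2"
  proof (rule least)
    show "\<exists>x :: real ^ 'n\<in>ball 0 R. radial_helmholtz ((j / R)\<^sup>2) x \<noteq> 0"
      using R by (intro bexI[of _ 0]) auto
  qed
  then have "lam * R\<^sup>2 \<le> j\<^sup>2" using R by (simp add: power_divide le_divide_eq)
  with ge have eq: "lam * R\<^sup>2 = j\<^sup>2" by simp
  have "sqrt (lam * R\<^sup>2) = sqrt (j\<^sup>2)" by (simp only: eq)
  then have Rj: "R = j / sqrt lam" using lam R j by (simp add: real_sqrt_mult eq_divide_eq mult.commute)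
  then show "R = Bessel_J_zero1 (nu CARD('n)) / sqrt lam" by (simp add: j_def)
  let ?F = "radial_helmholtz lam :: real ^ 'n \<Rightarrow> real"
  have Fd: "dirichlet_helmholtz lam (ball 0 R) ?F"
    by (rule radial_helmholtz_dirichlet[OF m R]) (simp add: eq j_def)
  have Fpos: "0 < ?F x" if "x \<in> ball 0 R" for x
  proof -
    have "lam * (norm x)\<^sup>2 < lam * R\<^sup>2" using that lam by (intro mult_strict_left_mono power_strict_mono) auto
    then show ?thesis using eq lam by (intro radial_helmholtz_pos[OF m]) (auto simp: j_def)
  qed
  have half: "measure lebesgue (ball (0 :: real ^ 'n) R) \<le> measure lebesgue {x \<in> ball 0 R. p * u x + q * ?F x > 0}"
    if "y \<in> ball 0 R" "p * u y + q * ?F y > 0" for p q y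
    by (rule positive_part_volume[OF m lam R _ dirichlet_helmholtz_lincomb[OF open_ball ud Fd] that])
       (simp add: eq j_def)
  fix x assume x: "x \<in> ball (0 :: real ^ 'n) R"
  show "u x = u 0 * ?F x"
  proof (rule ccontr)
    assume ne: "u x \<noteq> u 0 * ?F x"
    define h where "h = u x / ?F x"
    have h: "u x = h * ?F x" using Fpos[OF x] by (simp add: h_def)
    then have "h \<noteq> u 0" using ne by auto
    define k where "k = (h + u 0) / 2"
    \<comment> \<open>the sign makes the combination positive at \<open>x\<close> and negative at the centre\<close>
    define s :: real where "s = (if u 0 < h then 1 else -1)"
    let ?A = "{x \<in> ball (0 :: real ^ 'n) R. s * u x + (- (s * k)) * ?F x > 0}"
    let ?B = "{x \<in> ball (0 :: real ^ 'n) R. (- s) * u x + (s * k) * ?F x > 0}"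
    have sk: "0 < s * (h - k)" "0 < s * (k - u 0)"
      using \<open>h \<noteq> u 0\<close> by (auto simp: s_def k_def field_simps)
    have "s * u x + (- (s * k)) * ?F x = s * (h - k) * ?F x" unfolding h by (simp add: algebra_simps)
    then have A: "measure lebesgue (ball (0 :: real ^ 'n) R) \<le> measure lebesgue ?A"
      using sk(1) Fpos[OF x] x by (intro half[of x]) auto
    have "(- s) * u 0 + (s * k) * ?F 0 = s * (k - u 0)" by (simp add: algebra_simps)
    then have B: "measure lebesgue (ball (0 :: real ^ 'n) R) \<le> measure lebesgue ?B"
      using sk(2) R by (intro half[of 0]) auto
    have cont: "continuous_on (ball 0 R) u" "continuous_on (ball 0 R) ?F"
      using ud Fd by (auto simp: dirichlet_helmholtz_def C2_on_def C1_on_def)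
    have opn: "open {x \<in> ball (0 :: real ^ 'n) R. p * u x + q * ?F x > 0}" for p q
    proof -
      have "continuous_on (ball 0 R) (\<lambda>x. p * u x + q * ?F x)"
        by (intro continuous_on_add continuous_on_mult continuous_on_const cont)
      then show ?thesis by (rule open_strict_superlevel[OF open_ball])
    qed
    have meas: "{x \<in> ball (0 :: real ^ 'n) R. p * u x + q * ?F x > 0} \<in> lmeasurable" for p q
      by (intro lmeasurable_open opn bounded_subset[OF bounded_ball[of 0 R]]) auto
    have "?A \<inter> ?B = {}" by auto
    then have "measure lebesgue ?A + measure lebesgue ?B = measure lebesgue (?A \<union> ?B)"
      using measure_Un3[OF meas[of s "- (s * k)"] meas[of "- s" "s * k"]] by simp
    also have "\<dots> \<le> measure lebesgue (ball (0 :: real ^ 'n) R)"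
      by (rule measure_mono_fmeasurable[OF _ fmeasurableD[OF fmeasurable.Un[OF meas meas]]]) auto
    finally have "measure lebesgue ?A + measure lebesgue ?B \<le> measure lebesgue (ball (0 :: real ^ 'n) R)" .
    moreover have "0 < measure lebesgue (ball (0 :: real ^ 'n) R)"
      by (rule measure_open_pos) (use R in auto)
    ultimately show False using A B by linarith
  qed
qed

lemma radial_helmholtz_le_1:
  fixes x :: "real ^ 'n::finite"
  assumes m: "CARD('n) \<ge> 2" and lam: "lam > 0" and x: "norm x \<le> Bessel_J_zero1 (nu CARD('n)) / sqrt lam"
  shows "radial_helmholtz lam x \<le> 1"
proof (cases "x = 0")
  case False
  let ?j = "Bessel_J_zero1 (nu CARD('n))"
  have "(norm x)\<^sup>2 \<le> (?j / sqrt lam)\<^sup>2" using x by (intro power_mono) auto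
  then have "lam * (norm x)\<^sup>2 \<le> lam * (?j / sqrt lam)\<^sup>2" using lam by (intro mult_left_mono) auto
  also have "\<dots> = ?j\<^sup>2" using lam by (simp add: power_divide)
  finally have "lam * (norm x)\<^sup>2 / 4 \<le> ?j\<^sup>2 / 4" by simp
  then have "bessel_series (real CARD('n) / 2) (lam * (norm x)\<^sup>2 / 4) < bessel_series (real CARD('n) / 2) 0"
    using False lam by (intro bessel_series_strict_decreasing[OF m]) auto
  then show ?thesis by (simp add: radial_helmholtz_def)
qed simp

text \<open>The component of the centre contains the ball on which \<open>\<phi> > l\<close>, and
  being connected it cannot cross the bounding sphere, where \<open>\<phi> = l\<close>.\<close>

lemma radial_superlevel_component_volume:
  fixes \<phi> :: "real ^ 'n::finite \<Rightarrow> real"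
  assumes m: "CARD('n) \<ge> 2" and lam: "lam > 0" and \<phi>: "regular_radial_helmholtz lam \<phi>" and l: "0 \<le> l"
    and C: "C \<in> components {x. \<phi> x > l}" "0 \<in> C"
  shows "bounded C" "\<And>x. x \<in> C \<Longrightarrow> \<forall>y\<in>C. \<phi> y \<le> \<phi> x \<Longrightarrow> measure lebesgue C = level_volume_bound TYPE('n) lam (l / \<phi> x)"
proof -
  define R where "R = Bessel_J_zero1 (nu CARD('n)) / sqrt lam"
  let ?F = "radial_helmholtz lam :: real ^ 'n \<Rightarrow> real"
  have eq: "\<phi> x = \<phi> 0 * ?F x" if "norm x \<le> R" for x
    using regular_radial_helmholtz_unique[OF m lam \<phi>] that by (simp only: R_def)
  have p: "0 < \<phi> 0" using \<phi> unfolding regular_radial_helmholtz_def by blast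
  have CS: "C \<subseteq> {x. \<phi> x > l}" by (rule in_components_subset[OF C(1)])
  then have lp: "l < \<phi> 0" using C(2) by auto
  have \<theta>: "0 \<le> l / \<phi> 0" "l / \<phi> 0 < 1" using l lp p by auto
  obtain \<rho> where \<rho>: "0 < \<rho>" "\<rho> \<le> R" "\<And>x. norm x \<le> R \<Longrightarrow> l / \<phi> 0 < ?F x \<longleftrightarrow> norm x < \<rho>"
      "\<And>x. norm x = \<rho> \<Longrightarrow> ?F x = l / \<phi> 0" "measure lebesgue (ball (0 :: real ^ 'n) \<rho>) = level_volume_bound TYPE('n) lam (l / \<phi> 0)"
    using radial_helmholtz_levels[OF m lam \<theta>] unfolding R_def by blast
  have "ball 0 \<rho> \<subseteq> C"
  proof (rule components_maximal[OF C(1)])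
    show "ball 0 \<rho> \<subseteq> {x. \<phi> x > l}"
    proof
      fix x :: "real ^ 'n" assume "x \<in> ball 0 \<rho>"
      then have x: "norm x < \<rho>" "norm x \<le> R" using \<rho>(2) by auto
      then have "l / \<phi> 0 < ?F x" using \<rho>(3) by blast
      then have "l < \<phi> 0 * ?F x" using p by (simp add: divide_less_eq mult.commute)
      then show "x \<in> {x. \<phi> x > l}" using eq[OF x(2)] by simp
    qed
    show "C \<inter> ball 0 \<rho> \<noteq> {}" using C(2) \<rho>(1) by (metis IntI centre_in_ball empty_iff)
  qed simp
  moreover have "C \<subseteq> ball 0 \<rho>"
  proof (rule ccontr)
    assume "\<not> C \<subseteq> ball 0 \<rho>"
    then have "C - ball 0 \<rho> \<noteq> {}" by blast
    moreover have "C \<inter> ball 0 \<rho> \<noteq> {}" using C(2) \<rho>(1) by (metis IntI centre_in_ball empty_iff)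
    ultimately have "C \<inter> frontier (ball 0 \<rho>) \<noteq> {}"
      using in_components_connected[OF C(1)] by (intro connected_Int_frontier)
    then obtain x where xf: "x \<in> C" "x \<in> frontier (ball 0 \<rho>)" by blast
    then have x: "x \<in> C" "norm x = \<rho>" using \<rho>(1) by (simp_all add: frontier_ball)
    then have "\<phi> x = l" using eq[of x] \<rho>(2) \<rho>(4)[of x] p by simp
    then show False using CS x(1) by auto
  qed
  ultimately have CB: "C = ball 0 \<rho>" by blast
  show "bounded C" unfolding CB by simp
  fix x assume x: "x \<in> C" "\<forall>y\<in>C. \<phi> y \<le> \<phi> x"
  have xR: "norm x \<le> R" using x(1) \<rho>(2) unfolding CB by simp
  have "?F x \<le> 1" using radial_helmholtz_le_1[OF m lam, of x] xR by (simp only: R_def)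
  then have "\<phi> 0 * ?F x \<le> \<phi> 0 * 1" using p by (intro mult_left_mono) auto
  then have "\<phi> x = \<phi> 0" using eq[OF xR] x(2) C(2) by (intro antisym) auto
  then show "measure lebesgue C = level_volume_bound TYPE('n) lam (l / \<phi> x)" using \<rho>(5) CB by simp
qed

lemma first_eigenfunction_superlevel_volume:
  fixes u :: "real ^ 'n::finite \<Rightarrow> real"
  assumes m: "CARD('n) \<ge> 2" and lam: "lam > 0" and R: "R > 0"
    and u: "first_dirichlet_eigenfunction (ball 0 R) lam u" "u 0 > 0" and l: "0 \<le> l"
    and C: "C \<in> components {x \<in> ball 0 R. u x > l}" and x: "x \<in> C" "\<forall>y\<in>C. u y \<le> u x"
  shows "measure lebesgue C = level_volume_bound TYPE('n) lam (l / u x)"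
proof -
  let ?F = "radial_helmholtz lam :: real ^ 'n \<Rightarrow> real" and ?S = "{x \<in> ball 0 R. u x > l}"
  note rad = first_eigenfunction_radial[OF m lam R u(1)]
  have le: "u y \<le> u 0" if "y \<in> ball 0 R" for y
  proof -
    have "norm y \<le> Bessel_J_zero1 (nu CARD('n)) / sqrt lam" using that unfolding rad(1)[symmetric] by simp
    then have "u 0 * ?F y \<le> u 0 * 1" using u(2) by (intro mult_left_mono radial_helmholtz_le_1[OF m lam]) auto
    then show ?thesis using rad(2)[OF that] by simp
  qed
  have CS: "C \<subseteq> ?S" by (rule in_components_subset[OF C])
  have xS: "x \<in> ball 0 R" "l < u x" using CS x(1) by auto
  have lp: "l < u 0" using le[OF xS(1)] xS(2) by simp
  have \<theta>: "0 \<le> l / u 0" "l / u 0 < 1" using l lp u(2) by auto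
  obtain \<rho> where \<rho>: "0 < \<rho>" "\<rho> \<le> R" "\<And>x. norm x \<le> R \<Longrightarrow> l / u 0 < ?F x \<longleftrightarrow> norm x < \<rho>"
      "measure lebesgue (ball (0 :: real ^ 'n) \<rho>) = level_volume_bound TYPE('n) lam (l / u 0)"
    using radial_helmholtz_levels[OF m lam \<theta>] unfolding rad(1)[symmetric] by blast
  have iff: "l < u y \<longleftrightarrow> norm y < \<rho>" if y: "y \<in> ball 0 R" for y
  proof -
    have "l / u 0 < ?F y \<longleftrightarrow> norm y < \<rho>" by (rule \<rho>(3)) (use y in simp)
    moreover have "l / u 0 < ?F y \<longleftrightarrow> l < u 0 * ?F y" using u(2) by (simp add: divide_less_eq mult.commute)
    ultimately show ?thesis using rad(2)[OF y] by simp
  qed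
  have SB: "?S = ball 0 \<rho>"
  proof (intro equalityI subsetI)
    fix y assume "y \<in> ?S"
    then show "y \<in> ball 0 \<rho>" using iff[of y] by auto
  next
    fix y :: "real ^ 'n" assume y: "y \<in> ball 0 \<rho>"
    then have "y \<in> ball 0 R" using \<rho>(2) by auto
    then show "y \<in> ?S" using iff[of y] y by auto
  qed
  have "?S \<subseteq> C"
  proof (rule components_maximal[OF C])
    show "connected ?S" unfolding SB by simp
    show "C \<inter> ?S \<noteq> {}" using CS x(1) by auto
  qed simp
  then have CB: "C = ball 0 \<rho>" using CS SB by blast
  have "0 \<in> C" unfolding CB using \<rho>(1) by simp
  then have "u x = u 0" using x(2) le[OF xS(1)] by (intro antisym) auto
  then show ?thesis using \<rho>(4) CB by simp
qed

lemma regular_radial_first_eigenfunction: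
  fixes \<phi> :: "real ^ 'n::finite \<Rightarrow> real"
  assumes m: "CARD('n) \<ge> 2" and lam: "lam > 0" and \<phi>: "regular_radial_helmholtz lam \<phi>"
  shows "first_dirichlet_eigenfunction (ball 0 (Bessel_J_zero1 (nu CARD('n)) / sqrt lam)) lam \<phi>"
proof -
  define R where "R = Bessel_J_zero1 (nu CARD('n)) / sqrt lam"
  have R: "0 < R" "lam * R\<^sup>2 = (Bessel_J_zero1 (nu CARD('n)))\<^sup>2"
    using Bessel_J_zero1_series(1)[OF m] lam by (auto simp: R_def power_divide)
  let ?F = "radial_helmholtz lam :: real ^ 'n \<Rightarrow> real"
  have p: "0 < \<phi> 0" and \<phi>2: "C2_on UNIV \<phi>" and pde: "\<forall>x. laplacian \<phi> x + lam * \<phi> x = 0"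
    using \<phi> unfolding regular_radial_helmholtz_def by blast+
  have \<phi>c: "continuous_on S \<phi>" for S
    using \<phi>2 by (auto simp: C2_on_def C1_on_def intro: continuous_on_subset)
  have Fd: "dirichlet_helmholtz lam (ball 0 R) ?F" by (rule radial_helmholtz_dirichlet[OF m R])
  have "dirichlet_helmholtz lam (ball 0 R) \<phi>"
    unfolding dirichlet_helmholtz_def
  proof (intro conjI ballI)
    show "C2_on (ball 0 R) \<phi>" by (rule C2_on_subset[OF \<phi>2]) simp
    show "laplacian \<phi> x + lam * \<phi> x = 0" for x using pde by blast
    fix x assume x: "x \<in> frontier (ball (0 :: real ^ 'n) R)"
    then have "norm x \<le> R" using R(1) by (simp add: frontier_ball)
    then have "\<phi> x = \<phi> 0 * ?F x" using regular_radial_helmholtz_unique[OF m lam \<phi>] by (simp only: R_def)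
    moreover have "?F x = 0" using Fd x unfolding dirichlet_helmholtz_def by blast
    ultimately show "\<phi> x = 0" by simp
  qed (rule \<phi>c)
  moreover have "\<exists>x\<in>ball 0 R. \<phi> x \<noteq> 0" using p R(1) by (intro bexI[of _ 0]) auto
  moreover have "lam \<le> \<mu>" if v: "dirichlet_helmholtz \<mu> (ball 0 R) v" "\<exists>x\<in>ball 0 R. v x \<noteq> 0" for \<mu> and v :: "real ^ 'n \<Rightarrow> real"
  proof (rule ccontr)
    assume "\<not> lam \<le> \<mu>"
    then have "\<mu> * R\<^sup>2 < lam * R\<^sup>2" using R(1) by (intro mult_strict_right_mono) auto
    then have "\<mu> * R\<^sup>2 < (Bessel_J_zero1 (nu CARD('n)))\<^sup>2" unfolding R(2) .
    then show False using dirichlet_eq_0_below_first_zero[OF m R(1) v(1)] v(2) by blast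
  qed
  ultimately show ?thesis unfolding first_dirichlet_eigenfunction_def R_def[symmetric] by blast
qed

lemma radial_helmholtz_regular:
  assumes m: "CARD('n::finite) \<ge> 2"
  shows "regular_radial_helmholtz lam (radial_helmholtz lam :: real ^ 'n \<Rightarrow> real)"
  unfolding regular_radial_helmholtz_def
proof (intro conjI allI impI)
  show "radial_helmholtz lam x = radial_helmholtz lam y" if "norm x = norm y" for x y :: "real ^ 'n"
    using that by (simp add: radial_helmholtz_def)
qed (use radial_helmholtz_C2[OF m, of lam] in auto)

lemma level_volume_bound_tendsto:
  assumes m: "CARD('n::finite) \<ge> 2" and lam: "lam > 0"
  shows "(level_volume_bound TYPE('n) lam \<longlongrightarrow>
        measure lebesgue (ball (0 :: real ^ 'n) 1) *
          ((Bessel_J_zero1 (nu CARD('n)))\<^sup>2 / lam) powr (real CARD('n) / 2)) (at_right 0)"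
proof -
  let ?j = "Bessel_J_zero1 (nu CARD('n))" and ?c = "measure lebesgue (ball (0 :: real ^ 'n) 1)"
  have j: "0 < ?j" by (rule Bessel_J_zero1_series(1)[OF m])
  have "((\<lambda>\<theta>. ?c * (2 * level_beta CARD('n) \<theta> / lam) powr (real CARD('n) / 2)) \<longlongrightarrow>
      ?c * (2 * (?j\<^sup>2 / 2) / lam) powr (real CARD('n) / 2)) (at_right 0)"
    using lam j by (intro tendsto_intros level_beta_tendsto_zero_level[OF m]) auto
  moreover have "\<forall>\<^sub>F \<theta> in at_right 0. ?c * (2 * level_beta CARD('n) \<theta> / lam) powr (real CARD('n) / 2) = level_volume_bound TYPE('n) lam \<theta>"
    using eventually_at_right_less[of "0::real"] by eventually_elim (simp add: level_volume_bound_def)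
  ultimately have "(level_volume_bound TYPE('n) lam \<longlongrightarrow> ?c * (2 * (?j\<^sup>2 / 2) / lam) powr (real CARD('n) / 2)) (at_right 0)"
    using tendsto_cong by fastforce
  then show ?thesis by simp
qed

theorem corollary7p3:
  fixes lam :: real
  assumes "CARD('n::finite) \<ge> 2" and "lam > 0"
  shows
    "(\<forall>\<theta>. 0 < \<theta> \<and> \<theta> < 1 \<longrightarrow> (\<exists>!\<beta>. is_level_beta CARD('n) \<theta> \<beta>)) \<and>

     (\<forall>(\<Omega> :: (real ^ 'n) set) \<phi> l C.
        open \<Omega> \<and> dirichlet_helmholtz lam \<Omega> \<phi> \<and> 0 \<le> l \<and>
        C \<in> components {x \<in> \<Omega>. \<phi> x > l} \<and> bounded C \<longrightarrow>
          (\<exists>x\<in>C. \<forall>y\<in>C. \<phi> y \<le> \<phi> x) \<and>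
          (\<forall>x\<in>C. (\<forall>y\<in>C. \<phi> y \<le> \<phi> x) \<longrightarrow>
             measure lebesgue C \<ge> level_volume_bound TYPE('n) lam (l / \<phi> x))) \<and>

     (\<exists>\<phi> :: real ^ 'n \<Rightarrow> real. regular_radial_helmholtz lam \<phi>) \<and>

     (\<forall>\<phi> :: real ^ 'n \<Rightarrow> real. regular_radial_helmholtz lam \<phi> \<longrightarrow>
        first_dirichlet_eigenfunction (ball 0 (Bessel_J_zero1 (nu CARD('n)) / sqrt lam)) lam \<phi> \<and>
        (\<forall>l C. 0 \<le> l \<and> C \<in> components {x. \<phi> x > l} \<and> 0 \<in> C \<longrightarrow>
           bounded C \<and>
           (\<forall>x\<in>C. (\<forall>y\<in>C. \<phi> y \<le> \<phi> x) \<longrightarrow>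
              measure lebesgue C = level_volume_bound TYPE('n) lam (l / \<phi> x)))) \<and>

     (\<forall>R (u :: real ^ 'n \<Rightarrow> real) l C.
        R > 0 \<and> first_dirichlet_eigenfunction (ball 0 R) lam u \<and> u 0 > 0 \<and> 0 \<le> l \<and>
        C \<in> components {x \<in> ball 0 R. u x > l} \<longrightarrow>
          (\<forall>x\<in>C. (\<forall>y\<in>C. u y \<le> u x) \<longrightarrow>
             measure lebesgue C = level_volume_bound TYPE('n) lam (l / u x))) \<and>

     (\<lambda>\<theta>. level_beta CARD('n) \<theta> - real CARD('n) * (1 - \<theta>)) \<in> O[at_left 1](\<lambda>\<theta>. (1 - \<theta>)\<^sup>2) \<and>

     (level_beta CARD('n) \<longlongrightarrow> (Bessel_J_zero1 (nu CARD('n)))\<^sup>2 / 2) (at_right 0) \<and>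

     (level_volume_bound TYPE('n) lam \<longlongrightarrow>
        measure lebesgue (ball (0 :: real ^ 'n) 1) *
          ((Bessel_J_zero1 (nu CARD('n)))\<^sup>2 / lam) powr (real CARD('n) / 2)) (at_right 0)"
proof (intro conjI allI impI)
  note m = assms(1) and lam = assms(2)
  show "\<exists>!\<beta>. is_level_beta CARD('n) \<theta> \<beta>" if "0 < \<theta> \<and> \<theta> < 1" for \<theta>
    using ex1_level_beta[OF m] that by blast
  show "\<exists>x\<in>C. \<forall>y\<in>C. \<phi> y \<le> \<phi> x"
    if "open \<Omega> \<and> dirichlet_helmholtz lam \<Omega> \<phi> \<and> 0 \<le> l \<and> C \<in> components {x \<in> \<Omega>. \<phi> x > l} \<and> bounded C"
    for \<Omega> :: "(real ^ 'n) set" and \<phi> l C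
  proof -
    interpret superlevel_component C \<phi> l lam
      using that by (intro component_superlevel_component[OF m lam]) auto
    show ?thesis by (rule max_attained)
  qed
  show "\<forall>x\<in>C. (\<forall>y\<in>C. \<phi> y \<le> \<phi> x) \<longrightarrow> measure lebesgue C \<ge> level_volume_bound TYPE('n) lam (l / \<phi> x)"
    if "open \<Omega> \<and> dirichlet_helmholtz lam \<Omega> \<phi> \<and> 0 \<le> l \<and> C \<in> components {x \<in> \<Omega>. \<phi> x > l} \<and> bounded C"
    for \<Omega> :: "(real ^ 'n) set" and \<phi> l C
  proof -
    interpret superlevel_component C \<phi> l lam
      using that by (intro component_superlevel_component[OF m lam]) auto
    show ?thesis using volume_bound by blast
  qed
  show "\<exists>\<phi> :: real ^ 'n \<Rightarrow> real. regular_radial_helmholtz lam \<phi>"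
    using radial_helmholtz_regular[OF m] by blast
  show "first_dirichlet_eigenfunction (ball 0 (Bessel_J_zero1 (nu CARD('n)) / sqrt lam)) lam \<phi>"
    if "regular_radial_helmholtz lam \<phi>" for \<phi> :: "real ^ 'n \<Rightarrow> real"
    by (rule regular_radial_first_eigenfunction[OF m lam that])
  show "bounded C"
    if "regular_radial_helmholtz lam \<phi>" "0 \<le> l \<and> C \<in> components {x. \<phi> x > l} \<and> 0 \<in> C" for \<phi> :: "real ^ 'n \<Rightarrow> real" and l C
    using radial_superlevel_component_volume(1)[OF m lam that(1)] that(2) by blast
  show "\<forall>x\<in>C. (\<forall>y\<in>C. \<phi> y \<le> \<phi> x) \<longrightarrow> measure lebesgue C = level_volume_bound TYPE('n) lam (l / \<phi> x)"
    if "regular_radial_helmholtz lam \<phi>" "0 \<le> l \<and> C \<in> components {x. \<phi> x > l} \<and> 0 \<in> C" for \<phi> :: "real ^ 'n \<Rightarrow> real" and l C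
    using radial_superlevel_component_volume(2)[OF m lam that(1)] that(2) by blast
  show "\<forall>x\<in>C. (\<forall>y\<in>C. u y \<le> u x) \<longrightarrow> measure lebesgue C = level_volume_bound TYPE('n) lam (l / u x)"
    if "R > 0 \<and> first_dirichlet_eigenfunction (ball 0 R) lam u \<and> u 0 > 0 \<and> 0 \<le> l \<and>
        C \<in> components {x \<in> ball 0 R. u x > l}" for R and u :: "real ^ 'n \<Rightarrow> real" and l C
    using first_eigenfunction_superlevel_volume[OF m lam] that by blast
  show "(\<lambda>\<theta>. level_beta CARD('n) \<theta> - real CARD('n) * (1 - \<theta>)) \<in> O[at_left 1](\<lambda>\<theta>. (1 - \<theta>)\<^sup>2)"
    by (rule level_beta_expansion[OF m])
  show "(level_beta CARD('n) \<longlongrightarrow> (Bessel_J_zero1 (nu CARD('n)))\<^sup>2 / 2) (at_right 0)"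
    by (rule level_beta_tendsto_zero_level[OF m])
  show "(level_volume_bound TYPE('n) lam \<longlongrightarrow>
        measure lebesgue (ball (0 :: real ^ 'n) 1) *
          ((Bessel_J_zero1 (nu CARD('n)))\<^sup>2 / lam) powr (real CARD('n) / 2)) (at_right 0)"
    by (rule level_volume_bound_tendsto[OF m lam])
qed

end
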